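(* Let $n\ge 1$ and let $V_1,V_2\in C^\infty(\mathbb{T}^n)$. Given $H:\mathbb{R}^n\to\mathbb{R}$ as specified in each part, let $\overline H_i$ ($i=1,2$) be the effective Hamiltonian associated with $H(p)+V_i(x)$. (1) Suppose that $H\in C^2(\mathbb{R}^n)$, $\sup_{\mathbb{R}^n}\|D^2H\|<+\infty$ and $H$ is superlinear. Then for $i=1,2$ and any vector $Q\in\mathbb{R}^n$ satisfying a Diophantine condition, $$\int_{\mathbb{T}^n}V_i\,dx=\lim_{\lambda\to+\infty}\left(\overline H_i(\lambda P_\lambda)-H(\lambda P_\lambda)\right),$$ where $P_\lambda\in\mathbb{R}^n$ is chosen such that $DH(\lambda P_\lambda)=\lambda Q$. In particular, $$\overline H_1\equiv\overline H_2\ \Longrightarrow\ \int_{\mathbb{T}^n}V_1\,dx=\int_{\mathbb{T}^n}V_2\,dx.$$ (2) Suppose that $H(p)=\frac12|p|^2$. Then for $i=1,2$ and any irrational vector $Q\in\mathbb{R}^n$, $$\int_{\mathbb{T}^n}V_i\,dx=\lim_{\lambda\to+\infty}\left(\overline H_i(\lambda Q)-\tfrac12\lambda^2|Q|^2\right)$$ and $$\lim_{\lambda\to+\infty}\left(\lambda^2|Q|^2-\max_{q\in\partial\overline H_i(\lambda Q)}q\cdot\lambda Q\right)=0.$$ (3) Suppose that $H(p)=\frac12|p|^2$. If there exists $\tau>0$ such that $$\sum_{k\in\mathbb{Z}^n}\left(|\lambda_{k1}|^2+|\lambda_{k2}|^2\right)e^{|k|^{n+\tau}}<+\infty,$$ where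 $\{\lambda_{ki}\}_{k\in\mathbb{Z}^n}$ are the Fourier coefficients of $V_i$, then $$\overline H_1\equiv\overline H_2\ \Longrightarrow\ \int_{\mathbb{T}^n}|V_1|^2\,dx=\int_{\mathbb{T}^n}|V_2|^2\,dx.$$
   Context: $\mathbb{T}^n=\mathbb{R}^n/\mathbb{Z}^n$; functions on $\mathbb{T}^n$ are identified with $\mathbb{Z}^n$-periodic functions on $\mathbb{R}^n$. For a continuous coercive $H:\mathbb{R}^n\to\mathbb{R}$ (i.e. $H(p)\to+\infty$ as $|p|\to\infty$) and $V\in C(\mathbb{T}^n)$, the effective Hamiltonian $\overline H:\mathbb{R}^n\to\mathbb{R}$ associated with $H(p)+V(x)$ is defined as follows: for each $p\in\mathbb{R}^n$, $\overline H(p)$ is the unique constant $c\in\mathbb{R}$ such that the cell problem $H(p+Dv(x))+V(x)=c$ in $\mathbb{T}^n$ has a continuous viscosity solution $v\in C(\mathbb{T}^n)$. When $H$ is convex, $\overline H$ is convex, and $\partial\overline H(p)$ denotes its subdifferential at $p$. $H$ is superlinear if $H(p)/|p|\to+\infty$ as $|p|\to\infty$. A vector $Q\in\mathbb{R}^n$ satisfies a Diophantine condition if there exist $C,\alpha>0$ such that $|Q\cdot k|\ge C/|k|^\alpha$ for every $k\in\mathbb{Z}^n\setminus\{0\}$. A vector $Q\in\mathbb{R}^n$ is irrational if $Q\cdot m\ne0$ for all $m\in\mathbb{Z}^n\setminus\{0\}$. The Fourier coefficients of $V_i$ are $\lambda_{ki}=\int_{\mathbb{T}^n}V_i(x)e^{-2\pi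 i\,k\cdot x}\,dx$ (in the exponent $i$ is the imaginary unit). *)

theory Defs
  imports "HOL-Analysis.Analysis"
begin

section \<open>Functions on the torus\<close>

definition int_lattice :: "(real ^ 'n) set" where
  "int_lattice = {k. \<forall>i. k $ i \<in> \<int>}"

definition lattice_periodic :: "(real ^ 'n \<Rightarrow> 'b) \<Rightarrow> bool" where
  "lattice_periodic f \<longleftrightarrow> (\<forall>k\<in>int_lattice. \<forall>x. f (x + k) = f x)"

text \<open>Here \<open>1 :: real ^ 'n\<close> is the vector all of whose components are 1, so the domain of
  integration is the closed unit cube, a fundamental domain up to a null set.\<close>

definition torus_integral :: "(real ^ 'n \<Rightarrow> 'b :: euclidean_space) \<Rightarrow> 'b" where
  "torus_integral f = integral (cbox 0 1) f"

definition fourier_coeff :: "(real ^ 'n \<Rightarrow> real) \<Rightarrow> real ^ 'n \<Rightarrow> complex" where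
  "fourier_coeff V k =
     torus_integral (\<lambda>x. complex_of_real (V x) * exp (- 2 * of_real pi * \<i> * of_real (k \<bullet> x)))"

section \<open>Regularity\<close>

definition partial_deriv :: "'n \<Rightarrow> (real ^ 'n \<Rightarrow> real) \<Rightarrow> real ^ 'n \<Rightarrow> real" where
  "partial_deriv i f x = frechet_derivative f (at x) (axis i 1)"

definition grad :: "(real ^ 'n \<Rightarrow> real) \<Rightarrow> real ^ 'n \<Rightarrow> real ^ 'n" where
  "grad f x = (\<chi> i. partial_deriv i f x)"

definition hessian :: "(real ^ 'n \<Rightarrow> real) \<Rightarrow> real ^ 'n \<Rightarrow> real ^ 'n ^ 'n" where
  "hessian f x = (\<chi> i j. partial_deriv j (partial_deriv i f) x)"

text \<open>\<open>C_k m f\<close> means that \<open>f\<close> is of class \<open>C\<^sup>m\<close> on the whole space. Differentiability is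
  required explicitly because the value of \<open>frechet_derivative\<close> at a point of
  non-differentiability is unspecified.\<close>

primrec C_k :: "nat \<Rightarrow> (real ^ 'n \<Rightarrow> real) \<Rightarrow> bool" where
  "C_k 0 f \<longleftrightarrow> continuous_on UNIV f"
| "C_k (Suc m) f \<longleftrightarrow> (\<forall>x. f differentiable (at x)) \<and> (\<forall>i. C_k m (partial_deriv i f))"

definition C_inf_torus :: "(real ^ 'n \<Rightarrow> real) \<Rightarrow> bool" where
  "C_inf_torus V \<longleftrightarrow> lattice_periodic V \<and> (\<forall>m. C_k m V)"

section \<open>Viscosity solutions and the effective Hamiltonian\<close>

text \<open>Continuous viscosity sub- and supersolutions of \<open>F(x, Dv(x)) = 0\<close> on the whole space,
  with \<open>C\<^sup>1\<close> test functions touching at local extrema.\<close>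

definition viscosity_subsolution ::
    "(real ^ 'n \<Rightarrow> real ^ 'n \<Rightarrow> real) \<Rightarrow> (real ^ 'n \<Rightarrow> real) \<Rightarrow> bool" where
  "viscosity_subsolution F v \<longleftrightarrow> continuous_on UNIV v \<and>
     (\<forall>\<phi> x0. C_k 1 \<phi> \<and> (\<forall>\<^sub>F x in nhds x0. v x - \<phi> x \<le> v x0 - \<phi> x0) \<longrightarrow> F x0 (grad \<phi> x0) \<le> 0)"

definition viscosity_supersolution ::
    "(real ^ 'n \<Rightarrow> real ^ 'n \<Rightarrow> real) \<Rightarrow> (real ^ 'n \<Rightarrow> real) \<Rightarrow> bool" where
  "viscosity_supersolution F v \<longleftrightarrow> continuous_on UNIV v \<and>
     (\<forall>\<phi> x0. C_k 1 \<phi> \<and> (\<forall>\<^sub>F x in nhds x0. v x - \<phi> x \<ge> v x0 - \<phi> x0) \<longrightarrow> F x0 (grad \<phi> x0) \<ge> 0)"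

definition viscosity_solution ::
    "(real ^ 'n \<Rightarrow> real ^ 'n \<Rightarrow> real) \<Rightarrow> (real ^ 'n \<Rightarrow> real) \<Rightarrow> bool" where
  "viscosity_solution F v \<longleftrightarrow> viscosity_subsolution F v \<and> viscosity_supersolution F v"

text \<open>A solution on the torus is a lattice periodic solution on the whole space.\<close>

definition cell_problem_solvable ::
    "(real ^ 'n \<Rightarrow> real) \<Rightarrow> (real ^ 'n \<Rightarrow> real) \<Rightarrow> real ^ 'n \<Rightarrow> real \<Rightarrow> bool" where
  "cell_problem_solvable H V p c \<longleftrightarrow>
     (\<exists>v. lattice_periodic v \<and> viscosity_solution (\<lambda>x q. H (p + q) + V x - c) v)"

text \<open>\<open>effective_hamiltonian H V Hb\<close> says that \<open>Hb\<close> is the effective Hamiltonian associated with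
  \<open>H(p) + V(x)\<close>: for each \<open>p\<close>, the number \<open>Hb p\<close> is the unique constant for which the cell
  problem is solvable. For continuous coercive \<open>H\<close> and continuous periodic \<open>V\<close> there is exactly
  one such \<open>Hb\<close>, by the theorem of Lions, Papanicolaou and Varadhan.\<close>

definition effective_hamiltonian ::
    "(real ^ 'n \<Rightarrow> real) \<Rightarrow> (real ^ 'n \<Rightarrow> real) \<Rightarrow> (real ^ 'n \<Rightarrow> real) \<Rightarrow> bool" where
  "effective_hamiltonian H V Hb \<longleftrightarrow> (\<forall>p c. cell_problem_solvable H V p c \<longleftrightarrow> c = Hb p)"

section \<open>Conditions on Hamiltonians and vectors\<close>

definition superlinear :: "(real ^ 'n \<Rightarrow> real) \<Rightarrow> bool" where
  "superlinear H \<longleftrightarrow> filterlim (\<lambda>p. H p / norm p) at_top at_infinity"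

definition subdifferential :: "(real ^ 'n \<Rightarrow> real) \<Rightarrow> real ^ 'n \<Rightarrow> (real ^ 'n) set" where
  "subdifferential f p = {q. \<forall>p'. f p' \<ge> f p + q \<bullet> (p' - p)}"

definition diophantine :: "real ^ 'n \<Rightarrow> bool" where
  "diophantine Q \<longleftrightarrow>
     (\<exists>C>0. \<exists>\<alpha>>0. \<forall>k\<in>int_lattice - {0}. \<bar>Q \<bullet> k\<bar> \<ge> C / norm k powr \<alpha>)"

definition irrational_vector :: "real ^ 'n \<Rightarrow> bool" where
  "irrational_vector Q \<longleftrightarrow> (\<forall>m\<in>int_lattice - {0}. Q \<bullet> m \<noteq> 0)"

definition quadratic_hamiltonian :: "real ^ 'n \<Rightarrow> real" where
  "quadratic_hamiltonian p = 1 / 2 * (norm p)\<^sup>2"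

end

theory Submission
  imports Defs "HOL-Analysis.Analysis"
begin

text \<open>
  If the cell problem at \<open>p\<close> is solvable with constant \<open>c\<close>, touching the viscosity solution at the
  extrema of its difference with a periodic \<open>C\<^sup>1\<close> function \<open>\<phi>\<close> bounds \<open>c\<close> by the extrema of
  \<open>H (p + D\<phi>) + V\<close>. All limits follow by choosing \<open>\<phi>\<close> well. Since trigonometric polynomials are dense,
  the corrector equation \<open>Q \<bullet> Dv + V = const\<close> need only be solved up to an arbitrarily small error,
  which the irrationality of \<open>Q\<close> permits.

  For the subgradients in part (2), the effective Hamiltonian is jointly convex in \<open>(p, V)\<close>, and by
  homogeneity \<open>s * Hb (p / sqrt s)\<close> belongs to the potential \<open>s V\<close>. A convex function of \<open>s\<close> whose values
  converge has converging subgradients, and at \<open>s = 1\<close> these are \<open>Hb p - q \<bullet> p / 2\<close>.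

  For part (3), momenta \<open>l Q0 + s k0\<close> are used where \<open>k0\<close> is a lattice vector and \<open>Q0\<close> is orthogonal to no
  lattice vectors but those on the line of \<open>k0\<close>. As \<open>l\<close> tends to infinity only the Fourier modes of
  \<open>V\<close> on this line survive, and the term of order \<open>1 / s\<^sup>2\<close> of the limit is their energy. Parseval's
  identity sums the energies over all lines.
\<close>

section \<open>Periodic functions and comparison with smooth functions\<close>

text \<open>The order of limits disarms the small denominators. For a prescribed error a
  trigonometric polynomial and its corrector are fixed first; however large the gradient of the
  corrector is, it does not depend on the momentum, which tends to infinity afterwards.

  Convexity in \<open>p\<close> alone is too weak for the subgradients. \<open>Hb (l Q)\<close> is
  known up to o(1), so a difference quotient of step \<open>h\<close> yields
  \<open>q \<bullet> l Q\<close> up to an error of order \<open>l (h + o(1) / h)\<close>, which no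
  choice of \<open>h\<close> need make small. In the coupling \<open>s\<close> the large term
  disappears, because \<open>s\<close> times the kinetic energy of \<open>P / sqrt s\<close> does
  not depend on \<open>s\<close>; steps of fixed length then suffice.

  In part (3) the energy carries the factor 1/s^2, so \<open>Hb\<close> must be known with an error
  of smaller order than 1/s^2. The potentials are approximated up to 1/s^4, and the constants of the
  expansion have to be controlled by the sup norm, since the approximating polynomials change with
  \<open>s\<close>.\<close>

lemma int_lattice_0 [simp]: "0 \<in> int_lattice"
  by (simp add: int_lattice_def)

lemma int_lattice_add: "k \<in> int_lattice \<Longrightarrow> l \<in> int_lattice \<Longrightarrow> k + l \<in> int_lattice"
  by (auto simp: int_lattice_def)

lemma int_lattice_diff: "k \<in> int_lattice \<Longrightarrow> l \<in> int_lattice \<Longrightarrow> k - l \<in> int_lattice"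
  by (auto simp: int_lattice_def)

lemma int_lattice_minus: "k \<in> int_lattice \<Longrightarrow> - k \<in> int_lattice"
  by (auto simp: int_lattice_def)

lemma int_lattice_axis: "axis i 1 \<in> int_lattice"
  by (auto simp: int_lattice_def axis_def)

lemma int_lattice_inner: "k \<in> int_lattice \<Longrightarrow> l \<in> int_lattice \<Longrightarrow> k \<bullet> l \<in> \<int>"
  by (auto simp: int_lattice_def inner_vec_def intro!: Ints_sum)

lemma int_lattice_scale: "k \<in> int_lattice \<Longrightarrow> a \<in> \<int> \<Longrightarrow> a *\<^sub>R k \<in> int_lattice"
  by (auto simp: int_lattice_def)

lemma countable_int_lattice: "countable (int_lattice :: (real ^ 'n) set)"
proof -
  have "(int_lattice :: (real ^ 'n) set) \<subseteq> range (\<lambda>m :: int ^ 'n. \<chi> i. of_int (m $ i))"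
  proof
    fix k :: "real ^ 'n" assume k: "k \<in> int_lattice"
    have "k = (\<chi> i. of_int ((\<chi> i. \<lfloor>k $ i\<rfloor>) $ i))"
      using k by (simp add: int_lattice_def vec_eq_iff)
    then show "k \<in> range (\<lambda>m :: int ^ 'n. \<chi> i. of_int (m $ i))" by blast
  qed
  then show ?thesis by (rule countable_subset) auto
qed

lemma irrational_vector_exists: "\<exists>Q :: real ^ 'n. irrational_vector Q"
proof -
  have "negligible (\<Union>k\<in>int_lattice - {0}. {Q :: real ^ 'n. k \<bullet> Q = 0})"
    by (intro negligible_countable_Union countable_image countable_Diff countable_int_lattice)
       (auto intro: negligible_hyperplane)
  then have "(\<Union>k\<in>int_lattice - {0}. {Q :: real ^ 'n. k \<bullet> Q = 0}) \<noteq> UNIV"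
    using non_negligible_UNIV by metis
  then show ?thesis
    by (auto simp: irrational_vector_def inner_commute)
qed

lemma diophantine_irrational:
  assumes "diophantine Q" shows "irrational_vector Q"
  unfolding irrational_vector_def
proof
  fix m :: "real ^ 'a" assume m: "m \<in> int_lattice - {0}"
  obtain C a where "C > 0" and *: "\<And>k. k \<in> int_lattice - {0} \<Longrightarrow> \<bar>Q \<bullet> k\<bar> \<ge> C / norm k powr a"
    using assms unfolding diophantine_def by blast
  have "C / norm m powr a > 0" using \<open>C > 0\<close> m by simp
  with *[OF m] show "Q \<bullet> m \<noteq> 0" by auto
qed

lemma lattice_translate_to_unit_cube:
  fixes x :: "real ^ 'n"
  obtains k where "k \<in> int_lattice" "x + k \<in> cbox 0 1"
proof
  show "(\<chi> i. - of_int \<lfloor>x $ i\<rfloor>) \<in> int_lattice" by (simp add: int_lattice_def)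
  show "x + (\<chi> i. - of_int \<lfloor>x $ i\<rfloor>) \<in> cbox 0 1"
    by (auto simp: mem_box_cart) linarith
qed

lemma lattice_periodicD: "lattice_periodic f \<Longrightarrow> k \<in> int_lattice \<Longrightarrow> f (x + k) = f x"
  by (simp add: lattice_periodic_def)

lemma lattice_periodic_attains_max:
  fixes f :: "real ^ 'n \<Rightarrow> real"
  assumes "lattice_periodic f" "continuous_on UNIV f"
  obtains x0 where "\<And>x. f x \<le> f x0"
proof -
  have "cbox (0 :: real ^ 'n) 1 \<noteq> {}" by (auto simp: interval_ne_empty_cart)
  then obtain x0 where x0: "\<And>x. x \<in> cbox 0 1 \<Longrightarrow> f x \<le> f x0"
    using continuous_attains_sup[of "cbox 0 1" f] continuous_on_subset[OF assms(2)] by auto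
  have "f x \<le> f x0" for x
    by (metis lattice_translate_to_unit_cube lattice_periodicD[OF assms(1)] x0)
  then show thesis using that by blast
qed

lemma lattice_periodic_bounded:
  fixes f :: "real ^ 'n \<Rightarrow> real"
  assumes "lattice_periodic f" "continuous_on UNIV f"
  obtains B where "B > 0" "\<And>x. \<bar>f x\<bar> \<le> B"
proof -
  obtain x0 where x0: "\<And>x. \<bar>f x\<bar> \<le> \<bar>f x0\<bar>"
    using lattice_periodic_attains_max[of "\<lambda>x. \<bar>f x\<bar>"] assms
    by (auto simp: lattice_periodic_def intro!: continuous_intros)
  show thesis
    by (rule that[of "\<bar>f x0\<bar> + 1"]) (use x0 in \<open>auto simp: add_increasing2\<close>)
qed

text \<open>At a global maximum of \<open>\<phi> - v\<close>, attained by periodicity,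
  \<open>\<phi>\<close> touches the supersolution \<open>v\<close> from below and serves as the test
  function itself. One of the two functions compared is smooth, which spares the doubling of
  variables.\<close>

lemma cell_problem_le:
  assumes "cell_problem_solvable H V p c" "C_k 1 \<phi>" "continuous_on UNIV \<phi>" "lattice_periodic \<phi>"
    and "\<And>x. H (p + grad \<phi> x) + V x \<le> B"
  shows "c \<le> B"
proof -
  obtain v where v: "lattice_periodic v" "viscosity_supersolution (\<lambda>x q. H (p + q) + V x - c) v"
    using assms(1) by (auto simp: cell_problem_solvable_def viscosity_solution_def)
  have "lattice_periodic (\<lambda>x. \<phi> x - v x)"
    using v(1) assms(4) by (simp add: lattice_periodic_def)
  moreover have "continuous_on UNIV (\<lambda>x. \<phi> x - v x)"
    using v(2) assms(3) by (auto simp: viscosity_supersolution_def intro!: continuous_intros)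
  ultimately obtain x0 where "\<And>x. \<phi> x - v x \<le> \<phi> x0 - v x0"
    using lattice_periodic_attains_max[of "\<lambda>x. \<phi> x - v x"] by auto
  then have "\<forall>\<^sub>F x in nhds x0. v x - \<phi> x \<ge> v x0 - \<phi> x0"
    by (intro always_eventually) (smt (verit))
  then have "H (p + grad \<phi> x0) + V x0 - c \<ge> 0"
    using v(2) assms(2) unfolding viscosity_supersolution_def by blast
  with assms(5)[of x0] show ?thesis by linarith
qed

lemma cell_problem_ge:
  assumes "cell_problem_solvable H V p c" "C_k 1 \<phi>" "continuous_on UNIV \<phi>" "lattice_periodic \<phi>"
    and "\<And>x. H (p + grad \<phi> x) + V x \<ge> B"
  shows "c \<ge> B"
proof -
  obtain v where v: "lattice_periodic v" "viscosity_subsolution (\<lambda>x q. H (p + q) + V x - c) v"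
    using assms(1) by (auto simp: cell_problem_solvable_def viscosity_solution_def)
  have "lattice_periodic (\<lambda>x. v x - \<phi> x)"
    using v(1) assms(4) by (simp add: lattice_periodic_def)
  moreover have "continuous_on UNIV (\<lambda>x. v x - \<phi> x)"
    using v(2) assms(3) by (auto simp: viscosity_subsolution_def intro!: continuous_intros)
  ultimately obtain x0 where "\<And>x. v x - \<phi> x \<le> v x0 - \<phi> x0"
    using lattice_periodic_attains_max[of "\<lambda>x. v x - \<phi> x"] by auto
  then have "\<forall>\<^sub>F x in nhds x0. v x - \<phi> x \<le> v x0 - \<phi> x0"
    by (intro always_eventually) auto
  then have "H (p + grad \<phi> x0) + V x0 - c \<le> 0"
    using v(2) assms(2) unfolding viscosity_subsolution_def by blast
  with assms(5)[of x0] show ?thesis by linarith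
qed

section \<open>Gradients and the class C^1\<close>

lemma grad_unique:
  assumes "(f has_derivative (\<lambda>h. g \<bullet> h)) (at x)"
  shows "grad f x = g"
proof -
  have "frechet_derivative f (at x) = (\<lambda>h. g \<bullet> h)"
    using frechet_derivative_at[OF assms] by simp
  then show ?thesis by (simp add: grad_def partial_deriv_def vec_eq_iff inner_axis)
qed

lemma has_derivative_grad:
  assumes "f differentiable (at x)"
  shows "(f has_derivative (\<lambda>h. grad f x \<bullet> h)) (at x)"
proof -
  let ?D = "frechet_derivative f (at x)"
  have D: "(f has_derivative ?D) (at x)" using assms frechet_derivative_works by blast
  have lin: "linear ?D" using D has_derivative_linear by blast
  have "?D h = grad f x \<bullet> h" for h
  proof -
    have "?D h = ?D (\<Sum>i\<in>UNIV. (h $ i) *\<^sub>R axis i 1)"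
      using basis_expansion[of h] by (simp add: scalar_mult_eq_scaleR)
    also have "\<dots> = (\<Sum>i\<in>UNIV. h $ i * ?D (axis i 1))"
      by (simp add: linear_sum[OF lin] linear_cmul[OF lin])
    also have "\<dots> = grad f x \<bullet> h"
      by (simp add: grad_def partial_deriv_def inner_vec_def mult.commute)
    finally show ?thesis .
  qed
  then have "?D = (\<lambda>h. grad f x \<bullet> h)" by auto
  with D show ?thesis by simp
qed

lemma C_k_1_I:
  assumes "\<And>x. (f has_derivative (\<lambda>h. g x \<bullet> h)) (at x)" "continuous_on UNIV g"
  shows "C_k 1 f"
proof -
  have "partial_deriv i f = (\<lambda>x. g x $ i)" for i
    using grad_unique[OF assms(1)] by (auto simp: grad_def vec_eq_iff)
  moreover have "continuous_on UNIV (\<lambda>x. g x $ i)" for i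
    using assms(2) by (intro continuous_intros)
  moreover have "f differentiable (at x)" for x
    using assms(1) differentiable_def by blast
  ultimately show ?thesis by simp
qed

lemma C_inf_torusD:
  assumes "C_inf_torus V"
  shows "lattice_periodic V" "continuous_on UNIV V"
  using assms unfolding C_inf_torus_def by (auto dest: spec[of _ 0])

section \<open>Trigonometric polynomials\<close>

inductive_set trig_poly :: "(real ^ 'n) set \<Rightarrow> (real ^ 'n \<Rightarrow> real) set" for S where
  zero: "(\<lambda>x. 0) \<in> trig_poly S"
| wave: "k \<in> S \<Longrightarrow> (\<lambda>x. c * cos (2 * pi * (k \<bullet> x) + d)) \<in> trig_poly S"
| add: "f \<in> trig_poly S \<Longrightarrow> g \<in> trig_poly S \<Longrightarrow> (\<lambda>x. f x + g x) \<in> trig_poly S"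

lemma trig_poly_mono: "f \<in> trig_poly S \<Longrightarrow> S \<subseteq> T \<Longrightarrow> f \<in> trig_poly T"
  by (induction rule: trig_poly.induct) (auto intro: trig_poly.intros)

lemma trig_poly_const: "0 \<in> S \<Longrightarrow> (\<lambda>x. c) \<in> trig_poly S"
  using trig_poly.wave[of 0 S c 0] by simp

lemma trig_poly_cmult: "f \<in> trig_poly S \<Longrightarrow> (\<lambda>x. a * f x) \<in> trig_poly S"
proof (induction rule: trig_poly.induct)
  case (wave k c d)
  then show ?case using trig_poly.wave[of k S "a * c" d] by (simp add: mult.assoc)
qed (auto simp: distrib_left intro: trig_poly.intros)

lemma trig_poly_diff: "f \<in> trig_poly S \<Longrightarrow> g \<in> trig_poly S \<Longrightarrow> (\<lambda>x. f x - g x) \<in> trig_poly S"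
  using trig_poly.add[of f S "\<lambda>x. (- 1) * g x"] trig_poly_cmult[of g S "- 1"] by simp

lemma trig_poly_sum:
  "finite I \<Longrightarrow> (\<And>i. i \<in> I \<Longrightarrow> f i \<in> trig_poly S) \<Longrightarrow> (\<lambda>x. \<Sum>i\<in>I. f i x) \<in> trig_poly S"
  by (induction rule: finite_induct) (auto intro: trig_poly.intros)

lemma trig_poly_mult:
  assumes "f \<in> trig_poly S" "g \<in> trig_poly S"
    and S: "\<And>k l. k \<in> S \<Longrightarrow> l \<in> S \<Longrightarrow> k + l \<in> S \<and> k - l \<in> S"
  shows "(\<lambda>x. f x * g x) \<in> trig_poly S"
  using assms(1)
proof (induction rule: trig_poly.induct)
  case (wave k c d)
  note k = this
  show ?case using assms(2)
  proof (induction rule: trig_poly.induct)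
    case (wave l c' d')
    have "(\<lambda>x. c * cos (2 * pi * (k \<bullet> x) + d) * (c' * cos (2 * pi * (l \<bullet> x) + d'))) =
          (\<lambda>x. (c * c' / 2) * cos (2 * pi * ((k - l) \<bullet> x) + (d - d'))
             + (c * c' / 2) * cos (2 * pi * ((k + l) \<bullet> x) + (d + d')))"
    proof
      fix x
      have e: "2 * pi * ((k - l) \<bullet> x) + (d - d') = (2 * pi * (k \<bullet> x) + d) - (2 * pi * (l \<bullet> x) + d')"
        "2 * pi * ((k + l) \<bullet> x) + (d + d') = (2 * pi * (k \<bullet> x) + d) + (2 * pi * (l \<bullet> x) + d')"
        by (simp_all add: inner_add_left inner_diff_left algebra_simps)
      show "c * cos (2 * pi * (k \<bullet> x) + d) * (c' * cos (2 * pi * (l \<bullet> x) + d')) =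
          (c * c' / 2) * cos (2 * pi * ((k - l) \<bullet> x) + (d - d'))
             + (c * c' / 2) * cos (2 * pi * ((k + l) \<bullet> x) + (d + d'))"
        unfolding e cos_add cos_diff by (simp add: field_simps)
    qed
    then show ?case
      by (simp only:) (intro trig_poly.add trig_poly.wave conjunct1[OF S[OF k wave]] conjunct2[OF S[OF k wave]])
  qed (auto simp: distrib_left intro: trig_poly.intros)
qed (auto simp: distrib_right intro: trig_poly.intros)

lemma trig_poly_periodic:
  assumes "f \<in> trig_poly S" "S \<subseteq> int_lattice"
  shows "lattice_periodic f"
  using assms(1)
proof (induction rule: trig_poly.induct)
  case (wave k c d)
  show ?case unfolding lattice_periodic_def
  proof (intro ballI allI)
    fix m x :: "real ^ 'a" assume "m \<in> int_lattice"
    then obtain j where "k \<bullet> m = of_int j"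
      using int_lattice_inner wave assms(2) by (metis Ints_cases subsetD)
    then have "2 * pi * (k \<bullet> (x + m)) + d = (2 * pi * (k \<bullet> x) + d) + 2 * pi * of_int j"
      by (simp add: inner_add_right algebra_simps)
    then show "c * cos (2 * pi * (k \<bullet> (x + m)) + d) = c * cos (2 * pi * (k \<bullet> x) + d)"
      by (simp only: cos_add[of _ "2 * pi * of_int j"] cos_int_2pin sin_int_2pin) simp
  qed
qed (auto simp: lattice_periodic_def)

text \<open>That the gradient stays in the span of the frequencies makes correctors with frequencies
  on a line invisible to directions orthogonal to it.\<close>

lemma trig_poly_gradient:
  assumes "f \<in> trig_poly S"
  obtains g where "\<And>x. (f has_derivative (\<lambda>h. g x \<bullet> h)) (at x)"
    "\<And>b. (\<lambda>x. b \<bullet> g x) \<in> trig_poly S" "\<And>x. g x \<in> span S"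
proof -
  have "\<exists>g. (\<forall>x. (f has_derivative (\<lambda>h. g x \<bullet> h)) (at x)) \<and>
    (\<forall>b. (\<lambda>x. b \<bullet> g x) \<in> trig_poly S) \<and> (\<forall>x. g x \<in> span S)"
    using assms
  proof (induction rule: trig_poly.induct)
    case zero
    show ?case by (intro exI[of _ "\<lambda>x. 0"]) (auto intro: trig_poly.zero span_zero)
  next
    case (wave k c d)
    let ?g = "\<lambda>x. (2 * pi * c * cos (2 * pi * (k \<bullet> x) + (d + pi / 2))) *\<^sub>R k"
    have "((\<lambda>x. c * cos (2 * pi * (k \<bullet> x) + d)) has_derivative (\<lambda>h. ?g x \<bullet> h)) (at x)" for x
    proof -
      have e: "cos (2 * pi * (k \<bullet> x) + (d + pi / 2)) = - sin (2 * pi * (k \<bullet> x) + d)"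
        by (simp add: minus_sin_cos_eq add.assoc)
      show ?thesis unfolding e
        by (auto intro!: derivative_eq_intros simp: fun_eq_iff)
    qed
    moreover have "(\<lambda>x. b \<bullet> ?g x) \<in> trig_poly S" for b
      using trig_poly.wave[OF wave, of "2 * pi * c * (b \<bullet> k)" "d + pi / 2"]
      by (simp add: mult_ac)
    moreover have "?g x \<in> span S" for x
      using wave by (intro span_scale span_base)
    ultimately show ?case by (intro exI[of _ ?g]) blast
  next
    case (add f1 f2)
    then obtain g1 g2 where g:
      "\<And>x. (f1 has_derivative (\<lambda>h. g1 x \<bullet> h)) (at x)" "\<And>x. (f2 has_derivative (\<lambda>h. g2 x \<bullet> h)) (at x)"
      "\<And>b. (\<lambda>x. b \<bullet> g1 x) \<in> trig_poly S" "\<And>b. (\<lambda>x. b \<bullet> g2 x) \<in> trig_poly S"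
      "\<And>x. g1 x \<in> span S" "\<And>x. g2 x \<in> span S" by metis
    have "((\<lambda>x. f1 x + f2 x) has_derivative (\<lambda>h. (g1 x + g2 x) \<bullet> h)) (at x)" for x
      using has_derivative_add[OF g(1,2)] by (simp add: inner_add_left)
    moreover have "(\<lambda>x. b \<bullet> (g1 x + g2 x)) \<in> trig_poly S" for b
      using g(3,4) by (auto simp: inner_add_right intro: trig_poly.add)
    ultimately show ?case using g(5,6) by (intro exI[of _ "\<lambda>x. g1 x + g2 x"]) (auto intro: span_add)
  qed
  then show thesis using that by blast
qed

lemma trig_poly_has_derivative:
  assumes "f \<in> trig_poly S"
  shows "(f has_derivative (\<lambda>h. grad f x \<bullet> h)) (at x)"
  using assms by (metis trig_poly_gradient grad_unique)

lemma trig_poly_inner_grad: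
  assumes "f \<in> trig_poly S"
  shows "(\<lambda>x. b \<bullet> grad f x) \<in> trig_poly S"
proof -
  obtain g where g: "\<And>x. (f has_derivative (\<lambda>h. g x \<bullet> h)) (at x)" "\<And>b. (\<lambda>x. b \<bullet> g x) \<in> trig_poly S"
    using trig_poly_gradient[OF assms] by metis
  have "grad f = g" using grad_unique[OF g(1)] by auto
  with g(2) show ?thesis by simp
qed

lemma trig_poly_grad_in_span:
  assumes "f \<in> trig_poly S"
  shows "grad f x \<in> span S"
  using assms by (metis trig_poly_gradient grad_unique)

lemma trig_poly_continuous:
  assumes "f \<in> trig_poly S"
  shows "continuous_on T f"
  using assms by (induction rule: trig_poly.induct) (auto intro!: continuous_intros)

lemma trig_poly_grad_continuous:
  assumes "f \<in> trig_poly S"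
  shows "continuous_on T (grad f)"
proof -
  have "continuous_on T (\<lambda>x. \<chi> i. axis i 1 \<bullet> grad f x)"
    by (rule continuous_on_vec_lambda, rule trig_poly_continuous[where S = S], rule trig_poly_inner_grad[OF assms])
  then show ?thesis by (simp add: inner_axis' vec_lambda_eta)
qed

lemma trig_poly_grad_bounded:
  fixes f :: "real ^ 'n \<Rightarrow> real"
  assumes "f \<in> trig_poly S" "S \<subseteq> int_lattice"
  obtains G where "G > 0" "\<And>x. norm (grad f x) \<le> G"
proof -
  have "\<exists>B. \<forall>x. \<bar>grad f x $ i\<bar> \<le> B" for i
  proof -
    have "(\<lambda>x. axis i 1 \<bullet> grad f x) \<in> trig_poly S" using trig_poly_inner_grad[OF assms(1)] .
    then obtain B where "\<And>x. \<bar>axis i 1 \<bullet> grad f x\<bar> \<le> B"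
      using lattice_periodic_bounded trig_poly_continuous trig_poly_periodic assms(2) by metis
    then show ?thesis by (auto simp: inner_axis')
  qed
  then obtain B where B: "\<And>i x. \<bar>grad f x $ i\<bar> \<le> B i" by metis
  have "norm (grad f x) \<le> (\<Sum>i\<in>UNIV. B i)" for x
    using norm_le_l1_cart[of "grad f x"] sum_mono[of UNIV "\<lambda>i. \<bar>grad f x $ i\<bar>" B] B by force
  then have "norm (grad f x) \<le> \<bar>\<Sum>i\<in>UNIV. B i\<bar> + 1" for x by (smt (verit))
  then show thesis by (intro that[of "\<bar>\<Sum>i\<in>UNIV. B i\<bar> + 1"]) auto
qed

lemma trig_poly_grad_add:
  assumes "f \<in> trig_poly S" "g \<in> trig_poly T"
  shows "grad (\<lambda>x. f x + g x) x = grad f x + grad g x"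
  using has_derivative_add[OF trig_poly_has_derivative[OF assms(1)] trig_poly_has_derivative[OF assms(2)]]
  by (intro grad_unique) (simp add: inner_add_left)

text \<open>The terms of frequency \<open>k\<close> with \<open>Q \<bullet> k \<noteq> 0\<close> can be integrated along \<open>Q\<close>; the others remain.\<close>

lemma trig_poly_cohomological_equation:
  assumes "f \<in> trig_poly S"
  obtains v w where "v \<in> trig_poly (S \<inter> {k. Q \<bullet> k \<noteq> 0})" "w \<in> trig_poly (S \<inter> {k. Q \<bullet> k = 0})"
    "\<And>x. Q \<bullet> grad v x + f x = w x"
proof -
  have "\<exists>v w. v \<in> trig_poly (S \<inter> {k. Q \<bullet> k \<noteq> 0}) \<and> w \<in> trig_poly (S \<inter> {k. Q \<bullet> k = 0}) \<and>
    (\<forall>x. Q \<bullet> grad v x + f x = w x)"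
    using assms
  proof (induction rule: trig_poly.induct)
    case zero
    have "grad (\<lambda>x. 0) x = 0" for x :: "real ^ 'a"
      by (rule grad_unique) (auto intro!: derivative_eq_intros)
    then show ?case by (intro exI[of _ "\<lambda>x. 0"]) (auto intro: trig_poly.zero)
  next
    case (wave k c d)
    show ?case
    proof (cases "Q \<bullet> k = 0")
      case True
      have "grad (\<lambda>x. 0) x = 0" for x :: "real ^ 'a"
        by (rule grad_unique) (auto intro!: derivative_eq_intros)
      with True wave show ?thesis
        by (intro exI[of _ "\<lambda>x. 0"] exI[of _ "\<lambda>x. c * cos (2 * pi * (k \<bullet> x) + d)"])
           (auto intro: trig_poly.intros)
    next
      case False
      \<comment> \<open>Integrating a wave along \<open>Q\<close> divides its amplitude by
        \<open>2 * pi * (Q \<bullet> k)\<close> and delays its phase by \<open>pi / 2\<close>; the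
        sign makes the derivative cancel the wave.\<close>
      let ?a = "- c / (2 * pi * (Q \<bullet> k))"
      let ?v = "\<lambda>x. ?a * cos (2 * pi * (k \<bullet> x) + (d - pi / 2))"
      have e: "cos (y + (d - pi / 2)) = sin (y + d)" for y
        by (metis add_diff_eq cos_diff cos_pi_half mult_zero_right sin_pi_half mult.right_neutral add_0)
      have "grad (\<lambda>x. a * cos (2 * pi * (k \<bullet> x) + (d - pi / 2))) x
          = (2 * pi * a * cos (2 * pi * (k \<bullet> x) + d)) *\<^sub>R k" for a x
        unfolding e by (rule grad_unique) (auto intro!: derivative_eq_intros simp: fun_eq_iff)
      from this[of ?a] have "Q \<bullet> grad ?v x + c * cos (2 * pi * (k \<bullet> x) + d) = 0" for x
        using False by (simp only:) simp
      moreover have "?v \<in> trig_poly (S \<inter> {k. Q \<bullet> k \<noteq> 0})"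
        by (rule trig_poly.wave) (use False wave in auto)
      ultimately show ?thesis
        by (intro exI[of _ ?v] exI[of _ "\<lambda>x. 0"]) (auto intro: trig_poly.zero)
    qed
  next
    case (add f1 f2)
    then obtain v1 w1 v2 w2 where
      *: "v1 \<in> trig_poly (S \<inter> {k. Q \<bullet> k \<noteq> 0})" "w1 \<in> trig_poly (S \<inter> {k. Q \<bullet> k = 0})"
      "\<And>x. Q \<bullet> grad v1 x + f1 x = w1 x"
      "v2 \<in> trig_poly (S \<inter> {k. Q \<bullet> k \<noteq> 0})" "w2 \<in> trig_poly (S \<inter> {k. Q \<bullet> k = 0})"
      "\<And>x. Q \<bullet> grad v2 x + f2 x = w2 x" by metis
    have "Q \<bullet> grad (\<lambda>x. v1 x + v2 x) x + (f1 x + f2 x) = w1 x + w2 x" for x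
      using *(3)[of x] *(6)[of x] by (simp add: trig_poly_grad_add[OF *(1,4)] inner_add_right)
    then show ?case
      using trig_poly.add[OF *(1,4)] trig_poly.add[OF *(2,5)] by blast
  qed
  then show thesis using that by blast
qed

lemma trig_poly_zero_frequency:
  assumes "f \<in> trig_poly {0}"
  obtains c where "f = (\<lambda>x. c)"
proof -
  have "\<exists>c. f = (\<lambda>x. c)"
    using assms by (induction rule: trig_poly.induct) auto
  then show thesis using that by blast
qed

text \<open>The invariant part \<open>w\<close> is a limit of averages of \<open>f\<close> along \<open>Q\<close>; were \<open>w x > B\<close>,
  the bounded function \<open>v\<close> would grow linearly along the line through \<open>x\<close>.\<close>

lemma cohomological_equation_le:
  fixes f :: "real ^ 'n \<Rightarrow> real"
  assumes v: "v \<in> trig_poly S" "S \<subseteq> int_lattice"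
    and w: "w \<in> trig_poly (T \<inter> {k. Q \<bullet> k = 0})"
    and eq: "\<And>x. Q \<bullet> grad v x + f x = w x"
    and B: "\<And>x. f x \<le> B"
  shows "w x \<le> B"
proof (rule ccontr)
  assume "\<not> w x \<le> B"
  then have pos: "w x - B > 0" by simp
  obtain C where C: "C > 0" "\<And>x. \<bar>v x\<bar> \<le> C"
    using lattice_periodic_bounded[OF trig_poly_periodic[OF v] trig_poly_continuous[OF v(1)]] by blast
  have inv: "w (x + t *\<^sub>R Q) = w x" for t
    using w
  proof (induction rule: trig_poly.induct)
    case (wave k c d)
    then show ?case by (simp add: inner_add_right inner_commute)
  qed auto
  \<comment> \<open>Long enough for the growth \<open>t * (w x - B)\<close> to exceed
    \<open>2 * C\<close>, the largest possible oscillation of \<open>v\<close>, by one.\<close>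
  define t where "t = (2 * C + 1) / (w x - B)"
  have "t > 0" using pos C by (simp add: t_def)
  have der: "((\<lambda>s. v (x + s *\<^sub>R Q)) has_real_derivative Q \<bullet> grad v (x + s *\<^sub>R Q)) (at s)" for s
  proof -
    have "((\<lambda>s. v (x + s *\<^sub>R Q)) has_derivative (\<lambda>h. grad v (x + s *\<^sub>R Q) \<bullet> (h *\<^sub>R Q))) (at s)"
      by (rule has_derivative_compose[OF _ trig_poly_has_derivative[OF v(1)]])
         (auto intro!: derivative_eq_intros)
    then show ?thesis
      by (simp add: has_field_derivative_def inner_commute mult_commute_abs)
  qed
  obtain s where "v (x + t *\<^sub>R Q) - v (x + 0 *\<^sub>R Q) = (t - 0) * (Q \<bullet> grad v (x + s *\<^sub>R Q))"
    using MVT2[OF \<open>t > 0\<close>, of "\<lambda>s. v (x + s *\<^sub>R Q)" "\<lambda>s. Q \<bullet> grad v (x + s *\<^sub>R Q)"] der by blast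
  moreover have "Q \<bullet> grad v (x + s *\<^sub>R Q) \<ge> w x - B"
    using eq[of "x + s *\<^sub>R Q"] B[of "x + s *\<^sub>R Q"] inv[of s] by linarith
  ultimately have "v (x + t *\<^sub>R Q) - v x \<ge> t * (w x - B)"
    using \<open>t > 0\<close> by simp
  also have "t * (w x - B) = 2 * C + 1" using pos by (simp add: t_def)
  finally show False using C(2)[of x] C(2)[of "x + t *\<^sub>R Q"] by linarith
qed

text \<open>The lower bound is the upper bound for \<open>- f\<close>. Reversing \<open>Q\<close> at
  the same time lets the same \<open>v\<close> solve the equation, as
  \<open>(- Q) \<bullet> grad v x - f x = - w x\<close>.\<close>

lemma cohomological_equation_bound:
  fixes f :: "real ^ 'n \<Rightarrow> real"
  assumes v: "v \<in> trig_poly S" "S \<subseteq> int_lattice"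
    and w: "w \<in> trig_poly (T \<inter> {k. Q \<bullet> k = 0})"
    and eq: "\<And>x. Q \<bullet> grad v x + f x = w x"
    and B: "\<And>x. \<bar>f x\<bar> \<le> B"
  shows "\<bar>w x\<bar> \<le> B"
proof -
  have "- Q \<bullet> grad v x + - f x = - w x" for x using eq[of x] by simp
  moreover have "(\<lambda>x. - w x) \<in> trig_poly (T \<inter> {k. - Q \<bullet> k = 0})"
    using trig_poly_cmult[OF w, of "- 1"] by simp
  moreover have "f x \<le> B" "- f x \<le> B" for x using B[of x] by auto
  ultimately have "- w x \<le> B" "w x \<le> B"
    using cohomological_equation_le[OF v _ , where f = "\<lambda>x. - f x" and w = "\<lambda>x. - w x" and Q = "- Q"]
      cohomological_equation_le[OF v w eq] by blast+
  then show ?thesis by auto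
qed

subsection \<open>Density\<close>

text \<open>The cosines and sines of the coordinates embed the torus as a compact set
  \<open>range E\<close> in Euclidean space. A continuous periodic function factors through
  \<open>E\<close>, and polynomials in the coordinates of \<open>E\<close> are trigonometric
  polynomials, so Stone-Weierstrass on \<open>range E\<close> applies.\<close>

lemma trig_poly_dense:
  fixes V :: "real ^ 'n \<Rightarrow> real"
  assumes V: "lattice_periodic V" "continuous_on UNIV V" and e: "e > 0"
  obtains f where "f \<in> trig_poly int_lattice" "\<And>x. \<bar>V x - f x\<bar> \<le> e"
proof -
  define E :: "real ^ 'n \<Rightarrow> (real ^ 'n) \<times> (real ^ 'n)"
    where "E x = (\<chi> i. cos (2 * pi * (x $ i)), \<chi> i. sin (2 * pi * (x $ i)))" for x
  have E_eq: "\<exists>k\<in>int_lattice. y = x + k" if "E x = E y" for x y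
  proof
    have "cos (2 * pi * (y $ i)) = cos (2 * pi * (x $ i))" "sin (2 * pi * (y $ i)) = sin (2 * pi * (x $ i))" for i
      using that by (auto simp: E_def vec_eq_iff)
    then have "\<exists>n::int. 2 * pi * (y $ i) = 2 * pi * (x $ i) + 2 * pi * n" for i
      using sin_cos_eq_iff[of "2 * pi * (y $ i)" "2 * pi * (x $ i)"] by (metis mult.assoc mult.commute)
    then have "\<exists>n::int. 2 * pi * (y $ i) = 2 * pi * (x $ i + n)" for i
      by (simp add: distrib_left)
    then have "\<exists>n::int. y $ i = x $ i + n" for i
      by simp
    then have "y $ i - x $ i \<in> \<int>" for i
      by (metis Ints_of_int add_diff_cancel_left')
    then show "y - x \<in> int_lattice" by (simp add: int_lattice_def)
  qed simp
  have E_cont: "continuous_on A E" for A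
    unfolding E_def by (intro continuous_intros)
  have E_surj: "E ` cbox 0 1 = range E"
  proof -
    have "E (x + k) = E x" if "k \<in> int_lattice" for x k
    proof -
      have "cos (2 * pi * (x $ i + k $ i)) = cos (2 * pi * (x $ i)) \<and>
            sin (2 * pi * (x $ i + k $ i)) = sin (2 * pi * (x $ i))" for i
      proof -
        obtain j where j: "k $ i = of_int j" using \<open>k \<in> int_lattice\<close> by (auto simp: int_lattice_def Ints_def)
        show ?thesis unfolding j distrib_left sin_add cos_add cos_int_2pin sin_int_2pin by simp
      qed
      then show ?thesis by (simp add: E_def)
    qed
    note per = this
    have "E x \<in> E ` cbox 0 1" for x
      by (metis lattice_translate_to_unit_cube per imageI)
    then show ?thesis by auto
  qed
  have V_E: "V x = V y" if "E x = E y" for x y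
    using E_eq[OF that] lattice_periodicD[OF V(1)] by auto
  define g where "g = (\<lambda>z. V (SOME x. E x = z))"
  have gE: "g (E x) = V x" for x
    unfolding g_def by (rule V_E) (rule someI[of "\<lambda>y. E y = E x"], simp)
  have cpt: "compact (range E)"
    using compact_continuous_image[OF E_cont compact_cbox[of 0 1]] E_surj by simp
  \<comment> \<open>\<open>E\<close> is a closed map on the compact unit cube, hence a quotient map:
    the set where \<open>g\<close> lies in \<open>C\<close> is the image of a compact set.\<close>
  have "continuous_on (range E) g"
    unfolding continuous_on_closed_invariant
  proof (intro allI impI)
    fix C :: "real set" assume "closed C"
    have "compact (cbox 0 1 \<inter> V -` C)"
      by (intro compact_Int_closed compact_cbox closed_vimage V(2) \<open>closed C\<close>)
    then have "closed (E ` (cbox 0 1 \<inter> V -` C))"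
      by (intro compact_imp_closed compact_continuous_image E_cont)
    moreover have "E ` (cbox 0 1 \<inter> V -` C) \<inter> range E = g -` C \<inter> range E"
    proof (intro subset_antisym subsetI)
      fix z assume z: "z \<in> g -` C \<inter> range E"
      then have "z \<in> E ` cbox 0 1" using E_surj by blast
      then obtain x where x: "x \<in> cbox 0 1" "z = E x" by blast
      then show "z \<in> E ` (cbox 0 1 \<inter> V -` C) \<inter> range E" using z gE by auto
    qed (use gE in auto)
    ultimately show "\<exists>A. closed A \<and> A \<inter> range E = g -` C \<inter> range E" by blast
  qed
  then obtain P where P: "real_polynomial_function P" "\<And>z. z \<in> range E \<Longrightarrow> \<bar>g z - P z\<bar> < e"
    by (rule Stone_Weierstrass_real_polynomial_function[OF cpt _ e]) blast
  have "(\<lambda>x. P (E x)) \<in> trig_poly int_lattice"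
    using P(1)
  proof (induction rule: real_polynomial_function.induct)
    case (linear L)
    interpret bounded_linear L by fact
    have L: "L (E x) = (\<Sum>i\<in>UNIV. L (axis i 1, 0) * cos (2 * pi * (axis i 1 \<bullet> x) + 0) +
      L (0, axis i 1) * cos (2 * pi * (axis i 1 \<bullet> x) + - (pi / 2)))" for x
    proof -
      have s: "cos (y + - (pi / 2)) = sin y" for y by (simp add: cos_add cos_diff)
      have "E x = (\<Sum>i\<in>UNIV. cos (2 * pi * (x $ i)) *\<^sub>R (axis i 1, 0) + sin (2 * pi * (x $ i)) *\<^sub>R (0, axis i 1))"
        by (auto simp: E_def prod_eq_iff fst_sum snd_sum vec_eq_iff axis_def if_distrib
            cong: if_cong)
      then have "L (E x) = (\<Sum>i\<in>UNIV. cos (2 * pi * (x $ i)) * L (axis i 1, 0) + sin (2 * pi * (x $ i)) * L (0, axis i 1))"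
        by (simp only: sum add scale real_scaleR_def)
      then show ?thesis
        unfolding s by (simp add: inner_axis' mult.commute)
    qed
    show ?case unfolding L by (intro trig_poly_sum trig_poly.add trig_poly.wave int_lattice_axis) simp
  next
    case (const c)
    show ?case by (rule trig_poly_const) simp
  next
    case (mult f1 f2)
    then show ?case
      by (intro trig_poly_mult) (auto intro: int_lattice_add int_lattice_diff)
  qed (auto intro: trig_poly.add)
  moreover have "\<bar>V x - P (E x)\<bar> \<le> e" for x
    using P(2)[of "E x"] gE by auto
  ultimately show thesis using that by blast
qed

section \<open>Integration over the torus and Parseval's identity\<close>

lemma integrable_on_unit_cube:
  fixes f :: "real ^ 'n \<Rightarrow> 'b :: euclidean_space"
  assumes "continuous_on UNIV f"
  shows "f integrable_on cbox a b"
  using assms by (intro integrable_continuous) (rule continuous_on_subset, auto)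

lemma torus_integral_has_integral:
  fixes f :: "real ^ 'n \<Rightarrow> 'b :: euclidean_space"
  assumes "continuous_on UNIV f"
  shows "(f has_integral torus_integral f) (cbox 0 1)"
  unfolding torus_integral_def by (intro integrable_integral integrable_on_unit_cube assms)

lemma content_unit_cube: "measure lborel (cbox (0 :: real ^ 'n) 1) = 1"
  by (subst content_cbox_cart) (auto simp: interval_ne_empty_cart)

lemma torus_integral_const: "torus_integral (\<lambda>x :: real ^ 'n. c) = c"
  unfolding torus_integral_def by (simp add: content_unit_cube)

lemma torus_integral_mono:
  fixes f g :: "real ^ 'n \<Rightarrow> real"
  assumes "continuous_on UNIV f" "continuous_on UNIV g" "\<And>x. f x \<le> g x"
  shows "torus_integral f \<le> torus_integral g"
  unfolding torus_integral_def by (intro integral_le integrable_on_unit_cube assms)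

lemma torus_integral_diff:
  fixes f g :: "real ^ 'n \<Rightarrow> 'b :: euclidean_space"
  assumes "continuous_on UNIV f" "continuous_on UNIV g"
  shows "torus_integral (\<lambda>x. f x - g x) = torus_integral f - torus_integral g"
  unfolding torus_integral_def by (intro integral_diff integrable_on_unit_cube assms)

lemma torus_integral_close:
  fixes f g :: "real ^ 'n \<Rightarrow> real"
  assumes "continuous_on UNIV f" "continuous_on UNIV g" "\<And>x. \<bar>f x - g x\<bar> \<le> e"
  shows "\<bar>torus_integral f - torus_integral g\<bar> \<le> e"
proof -
  have c: "continuous_on UNIV (\<lambda>x. f x - g x)" by (intro continuous_intros assms)
  have "f x - g x \<le> e" "- e \<le> f x - g x" for x using assms(3)[of x] by auto
  then have "torus_integral (\<lambda>x. f x - g x) \<le> torus_integral (\<lambda>x :: real ^ 'n. e)"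
    "torus_integral (\<lambda>x :: real ^ 'n. - e) \<le> torus_integral (\<lambda>x. f x - g x)"
    by (intro torus_integral_mono c continuous_intros; simp)+
  then show ?thesis by (simp add: torus_integral_const torus_integral_diff[OF assms(1,2)])
qed

text \<open>The slab of the translated cube beyond the face where coordinate \<open>i\<close> is 1
  is moved back by one lattice step and fills the gap that the translation left.\<close>

lemma torus_integral_translate:
  fixes f :: "real ^ 'n \<Rightarrow> 'b :: euclidean_space"
  assumes per: "lattice_periodic f" and cont: "continuous_on UNIV f" and a: "0 \<le> a" "a \<le> 1"
  shows "torus_integral (\<lambda>x. f (x + axis i a)) = torus_integral f"
proof -
  let ?c = "axis i a :: real ^ 'n" and ?e = "axis i 1 :: real ^ 'n"
  let ?u = "1 + ?c - ?e"
  note int = integrable_on_unit_cube[OF cont]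
  have B: "?e \<in> Basis" by simp
  have nth: "(1 :: real ^ 'n) $ j = 1" "(0 :: real ^ 'n) $ j = 0" "axis i t $ j = (if j = i then t else 0)"
    "x \<bullet> ?e = x $ i" for t :: real and j x by (simp_all add: inner_axis) (simp add: axis_def)
  have sets: "cbox ?c (1 + ?c) \<inter> {x. x \<bullet> ?e \<le> 1} = cbox ?c 1"
    unfolding set_eq_iff Int_iff mem_box_cart mem_Collect_eq vector_add_component nth
    by (smt (verit) a)
  have sets2: "cbox ?c (1 + ?c) \<inter> {x. x \<bullet> ?e \<ge> 1} = cbox ?e (1 + ?c)"
    unfolding set_eq_iff Int_iff mem_box_cart mem_Collect_eq vector_add_component nth
    by (smt (verit) a)
  have sets3: "cbox 0 1 \<inter> {x. x \<bullet> ?e \<le> a} = cbox 0 ?u"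
    unfolding set_eq_iff Int_iff mem_box_cart mem_Collect_eq vector_add_component vector_minus_component nth
    by (smt (verit) a)
  have sets4: "cbox 0 1 \<inter> {x. x \<bullet> ?e \<ge> a} = cbox ?c 1"
    unfolding set_eq_iff Int_iff mem_box_cart mem_Collect_eq nth
    by (smt (verit) a)
  note sets = sets sets2 sets3 sets4
  have "integral (cbox ?e (1 + ?c)) f = integral (cbox 0 ?u) (\<lambda>x. f (x + ?e))"
    using integral_shift_cbox[of ?e ?e "1 + ?c" f] by simp
  also have "\<dots> = integral (cbox 0 ?u) f"
    using per by (simp add: lattice_periodic_def int_lattice_axis)
  finally have shift: "integral (cbox ?e (1 + ?c)) f = integral (cbox 0 ?u) f" .
  have "torus_integral (\<lambda>x. f (x + ?c)) = integral (cbox ?c (1 + ?c)) f"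
    using integral_shift_cbox[of ?c ?c "1 + ?c" f] by (simp add: torus_integral_def)
  also have "\<dots> = integral (cbox ?c 1) f + integral (cbox 0 ?u) f"
    using integral_split[OF int B, of ?c "1 + ?c" 1] by (simp add: sets shift)
  also have "\<dots> = torus_integral f"
    using integral_split[OF int B, of 0 1 a] by (simp add: sets torus_integral_def add.commute)
  finally show ?thesis .
qed

section \<open>Characters, Fourier coefficients and Parseval's identity\<close>

definition torus_char :: "real ^ 'n \<Rightarrow> real ^ 'n \<Rightarrow> complex" where
  "torus_char k x = cis (2 * pi * (k \<bullet> x))"

lemma torus_char_continuous: "continuous_on A (torus_char k)"
  unfolding torus_char_def cis_conv_exp by (intro continuous_intros)

lemma torus_char_add: "torus_char k (x + y) = torus_char k x * torus_char k y"
  by (simp add: torus_char_def cis_mult inner_add_right distrib_left)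

lemma torus_char_mult_cnj: "torus_char k x * cnj (torus_char l x) = torus_char (k - l) x"
  by (simp add: torus_char_def cis_cnj cis_mult inner_diff_left right_diff_distrib)

lemma torus_char_int_lattice:
  assumes "k \<in> int_lattice" "m \<in> int_lattice"
  shows "torus_char k m = 1"
  using int_lattice_inner[OF assms] by (auto simp: torus_char_def elim!: Ints_cases intro!: cis_multiple_2pi)

lemma torus_integral_char:
  assumes "k \<in> int_lattice"
  shows "torus_integral (torus_char k) = (if k = 0 then 1 else 0)"
proof (cases "k = 0")
  case True
  then have "torus_char k = (\<lambda>x. 1)" by (simp add: torus_char_def fun_eq_iff)
  with True show ?thesis by (simp add: torus_integral_const)
next
  case False
  then obtain i where i: "k $ i \<noteq> 0" by (auto simp: vec_eq_iff)
  \<comment> \<open>Half a period of the character along axis \<open>i\<close>: this translation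
    changes its sign but not its integral, which must vanish. Since
    \<open>\<bar>k $ i\<bar> \<ge> 1\<close>, it is at most 1.\<close>
  define a where "a = 1 / (2 * \<bar>k $ i\<bar>)"
  have "\<bar>k $ i\<bar> \<ge> 1"
    using assms i by (auto simp: int_lattice_def intro!: Ints_nonzero_abs_ge1)
  then have a: "0 \<le> a" "a \<le> 1" by (simp_all add: a_def divide_le_eq)
  have "k \<bullet> axis i a = k $ i * a" by (simp add: inner_axis)
  also have "\<dots> = (if k $ i > 0 then 1 / 2 else - 1 / 2)" using i by (simp add: a_def)
  finally have "torus_char k (axis i a) = -1" by (simp add: torus_char_def cis.code complex_eq_iff)
  then have "torus_char k (x + axis i a) = - torus_char k x" for x by (simp add: torus_char_add)
  moreover have "torus_integral (\<lambda>x. torus_char k (x + axis i a)) = torus_integral (torus_char k)"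
    by (intro torus_integral_translate torus_char_continuous a)
       (simp add: lattice_periodic_def torus_char_add torus_char_int_lattice[OF assms])
  ultimately have "- torus_integral (torus_char k) = torus_integral (torus_char k)"
    by (simp add: torus_integral_def)
  then show ?thesis using False by (simp add: eq_neg_iff_add_eq_0)
qed

lemma fourier_coeff_has_integral:
  assumes "continuous_on UNIV f"
  shows "((\<lambda>x. of_real (f x) * cnj (torus_char k x)) has_integral fourier_coeff f k) (cbox 0 1)"
proof -
  have "exp (- 2 * of_real pi * \<i> * of_real (k \<bullet> x)) = cnj (torus_char k x)" for x
    by (simp only: torus_char_def cis_cnj) (simp add: cis_conv_exp mult_ac)
  then have "fourier_coeff f k = torus_integral (\<lambda>x. of_real (f x) * cnj (torus_char k x))"
    by (simp add: fourier_coeff_def)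
  moreover have "continuous_on UNIV (\<lambda>x. of_real (f x) * cnj (torus_char k x))"
    by (intro continuous_intros assms torus_char_continuous)
  ultimately show ?thesis using torus_integral_has_integral by metis
qed

lemma fourier_coeff_diff:
  assumes "continuous_on UNIV f" "continuous_on UNIV g"
  shows "fourier_coeff (\<lambda>x. f x - g x) k = fourier_coeff f k - fourier_coeff g k"
proof -
  have "continuous_on UNIV (\<lambda>x. f x - g x)" by (intro continuous_intros assms)
  note fourier_coeff_has_integral[OF this, of k]
  moreover note has_integral_diff[OF fourier_coeff_has_integral[OF assms(1), of k]
      fourier_coeff_has_integral[OF assms(2), of k]]
  ultimately show ?thesis by (intro has_integral_unique) (auto simp: left_diff_distrib)
qed

lemma fourier_coeff_add:
  assumes "continuous_on UNIV f" "continuous_on UNIV g"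
  shows "fourier_coeff (\<lambda>x. f x + g x) k = fourier_coeff f k + fourier_coeff g k"
proof -
  have "continuous_on UNIV (\<lambda>x. f x + g x)" by (intro continuous_intros assms)
  note fourier_coeff_has_integral[OF this, of k]
  moreover note has_integral_add[OF fourier_coeff_has_integral[OF assms(1), of k]
      fourier_coeff_has_integral[OF assms(2), of k]]
  ultimately show ?thesis by (intro has_integral_unique) (auto simp: distrib_right)
qed

lemma torus_char_has_integral:
  assumes "k \<in> int_lattice"
  shows "(torus_char k has_integral (if k = 0 then 1 else 0)) (cbox 0 1)"
  using torus_integral_has_integral[OF torus_char_continuous[of UNIV k]] torus_integral_char[OF assms] by simp

lemma fourier_coeff_0:
  assumes "continuous_on UNIV f"
  shows "fourier_coeff f 0 = of_real (torus_integral f)"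
proof -
  have "((\<lambda>x. complex_of_real (f x)) has_integral of_real (torus_integral f)) (cbox 0 1)"
    by (intro has_integral_of_real torus_integral_has_integral assms)
  then show ?thesis
    using has_integral_unique[OF fourier_coeff_has_integral[OF assms, of 0]] by (simp add: torus_char_def)
qed

lemma wave_eq_chars:
  "complex_of_real (c * cos (2 * pi * (k \<bullet> x) + d)) =
     of_real (c / 2) * cis d * torus_char k x + of_real (c / 2) * cis (- d) * torus_char (- k) x"
  by (simp add: torus_char_def complex_eq_iff cos_add field_simps)

lemma trig_poly_eq_char_sum:
  assumes "f \<in> trig_poly S" "S \<subseteq> int_lattice"
  obtains K a where "finite K" "K \<subseteq> int_lattice" "\<And>x. complex_of_real (f x) = (\<Sum>k\<in>K. a k * torus_char k x)"
proof -
  have "\<exists>K a. finite K \<and> K \<subseteq> int_lattice \<and> (\<forall>x. complex_of_real (f x) = (\<Sum>k\<in>K. a k * torus_char k x))"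
    using assms(1)
  proof (induction rule: trig_poly.induct)
    case zero
    show ?case by (intro exI[of _ "{}"]) auto
  next
    case (wave k c d)
    \<comment> \<open>The two contributions are added rather than separated by cases, so that
      \<open>k = 0\<close>, where \<open>k\<close> and \<open>- k\<close> coincide, is
      covered.\<close>
    let ?a = "\<lambda>l. (if l = k then of_real (c / 2) * cis d else 0) + (if l = - k then of_real (c / 2) * cis (- d) else 0)"
    have "complex_of_real (c * cos (2 * pi * (k \<bullet> x) + d)) = (\<Sum>l\<in>{k, - k}. ?a l * torus_char l x)" for x
    proof -
      have p: "(\<Sum>l\<in>{k, - k}. (if l = m then A else 0) * torus_char l x) = A * torus_char m x" if "m \<in> {k, - k}" for m A
      proof -
        have "(\<Sum>l\<in>{k, - k}. (if l = m then A else 0) * torus_char l x) = (\<Sum>l\<in>{k, - k}. if l = m then A * torus_char m x else 0)"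
          by (rule sum.cong) simp_all
        also have "\<dots> = A * torus_char m x"
          using that by (subst sum.delta) simp_all
        finally show ?thesis .
      qed
      show ?thesis
        unfolding distrib_right sum.distrib wave_eq_chars by (subst (1 2) p) simp_all
    qed
    moreover have "{k, - k} \<subseteq> int_lattice" using wave assms(2) int_lattice_minus by blast
    ultimately show ?case by (intro exI[of _ "{k, - k}"] exI[of _ ?a]) auto
  next
    case (add f g)
    from add.IH(1) obtain K a where K: "finite K" "K \<subseteq> int_lattice"
      "\<And>x. complex_of_real (f x) = (\<Sum>k\<in>K. a k * torus_char k x)" by (elim exE conjE) (rule that, auto)
    from add.IH(2) obtain L b where L: "finite L" "L \<subseteq> int_lattice"
      "\<And>x. complex_of_real (g x) = (\<Sum>k\<in>L. b k * torus_char k x)" by (elim exE conjE) (rule that, auto)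
    have e: "(\<Sum>k\<in>K. a k * torus_char k x) = (\<Sum>k\<in>K \<union> L. (if k \<in> K then a k else 0) * torus_char k x)"
      "(\<Sum>k\<in>L. b k * torus_char k x) = (\<Sum>k\<in>K \<union> L. (if k \<in> L then b k else 0) * torus_char k x)" for x
      using K(1) L(1) by (auto intro!: sum.mono_neutral_cong_left)
    have "complex_of_real (f x + g x) =
      (\<Sum>k\<in>K \<union> L. ((if k \<in> K then a k else 0) + (if k \<in> L then b k else 0)) * torus_char k x)" for x
      by (simp add: K(3) L(3) e distrib_right sum.distrib del: sum.If_cases)
    then show ?case
      using K L by (intro exI[of _ "K \<union> L"] exI[of _ "\<lambda>k. (if k \<in> K then a k else 0) + (if k \<in> L then b k else 0)"]) auto
  qed
  then show thesis using that by blast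
qed

text \<open>Both \<open>k\<close> and \<open>- k\<close> must avoid \<open>S\<close>, since a real
  wave of frequency \<open>l\<close> carries the characters \<open>l\<close> and
  \<open>- l\<close>.\<close>

lemma trig_poly_fourier_coeff_eq_0:
  assumes "f \<in> trig_poly S" "S \<subseteq> int_lattice" "k \<in> int_lattice" "k \<notin> S" "- k \<notin> S"
  shows "fourier_coeff f k = 0"
  using assms(1)
proof (induction rule: trig_poly.induct)
  case zero
  show ?case by (simp add: fourier_coeff_def torus_integral_const)
next
  case (wave l c d)
  have l: "l - k \<in> int_lattice" "- l - k \<in> int_lattice" "l - k \<noteq> 0" "- l - k \<noteq> 0"
    using assms(2-5) wave int_lattice_diff int_lattice_minus by (auto simp: subset_iff)
  have "((\<lambda>x. of_real (c / 2) * cis d * torus_char (l - k) x + of_real (c / 2) * cis (- d) * torus_char (- l - k) x)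
      has_integral of_real (c / 2) * cis d * 0 + of_real (c / 2) * cis (- d) * 0) (cbox 0 1)"
    using torus_char_has_integral[OF l(1)] torus_char_has_integral[OF l(2)] l(3,4)
    by (intro has_integral_add has_integral_mult_right) auto
  moreover have "complex_of_real (c * cos (2 * pi * (l \<bullet> x) + d)) * cnj (torus_char k x) =
    of_real (c / 2) * cis d * torus_char (l - k) x + of_real (c / 2) * cis (- d) * torus_char (- l - k) x" for x
    by (subst wave_eq_chars) (simp only: distrib_right mult.assoc torus_char_mult_cnj)
  moreover have "((\<lambda>x. complex_of_real (c * cos (2 * pi * (l \<bullet> x) + d)) * cnj (torus_char k x))
      has_integral fourier_coeff (\<lambda>x. c * cos (2 * pi * (l \<bullet> x) + d)) k) (cbox 0 1)"
    by (intro fourier_coeff_has_integral continuous_intros)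
  ultimately show ?case by (simp add: has_integral_unique)
next
  case (add f g)
  then show ?case by (simp add: fourier_coeff_add trig_poly_continuous)
qed

text \<open>Completing the square around the Fourier coefficients. Taking \<open>a\<close> equal to
  them gives Bessel's inequality; taking \<open>a\<close> from an approximating polynomial bounds
  the missing energy.\<close>

lemma torus_integral_char_sum_error:
  assumes f: "continuous_on UNIV f" and K: "finite K" "K \<subseteq> int_lattice"
  shows "torus_integral (\<lambda>x. (cmod (of_real (f x) - (\<Sum>k\<in>K. a k * torus_char k x)))\<^sup>2) =
    torus_integral (\<lambda>x. (f x)\<^sup>2) - (\<Sum>k\<in>K. (cmod (fourier_coeff f k))\<^sup>2)
      + (\<Sum>k\<in>K. (cmod (a k - fourier_coeff f k))\<^sup>2)"
proof -
  let ?c = "fourier_coeff f"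
  let ?r = "\<lambda>x. of_real (f x) - (\<Sum>k\<in>K. a k * torus_char k x)"
  have cont: "continuous_on UNIV (\<lambda>x. (cmod (?r x))\<^sup>2)"
    by (intro continuous_intros f torus_char_continuous)
  have expand: "of_real ((cmod (?r x))\<^sup>2) = of_real ((f x)\<^sup>2)
      - (\<Sum>k\<in>K. cnj (a k) * (of_real (f x) * cnj (torus_char k x)))
      - (\<Sum>k\<in>K. a k * cnj (of_real (f x) * cnj (torus_char k x)))
      + (\<Sum>k\<in>K. \<Sum>l\<in>K. (a k * cnj (a l)) * torus_char (k - l) x)" for x
    unfolding torus_char_mult_cnj[symmetric]
    by (subst complex_norm_square,
        simp add: algebra_simps power2_eq_square sum_distrib_left sum_distrib_right sum_product)
       (rule sum.swap)
  have i1: "((\<lambda>x. complex_of_real ((f x)\<^sup>2)) has_integral of_real (torus_integral (\<lambda>x. (f x)\<^sup>2))) (cbox 0 1)"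
    by (intro has_integral_of_real torus_integral_has_integral continuous_intros f)
  have i2: "((\<lambda>x. \<Sum>k\<in>K. cnj (a k) * (of_real (f x) * cnj (torus_char k x))) has_integral (\<Sum>k\<in>K. cnj (a k) * ?c k)) (cbox 0 1)"
    by (intro has_integral_sum has_integral_mult_right fourier_coeff_has_integral f K)
  have i3: "((\<lambda>x. \<Sum>k\<in>K. a k * cnj (of_real (f x) * cnj (torus_char k x))) has_integral (\<Sum>k\<in>K. a k * cnj (?c k))) (cbox 0 1)"
    using has_integral_linear[OF fourier_coeff_has_integral[OF f] bounded_linear_cnj]
    by (intro has_integral_sum has_integral_mult_right K) (simp add: o_def)
  have i4: "((\<lambda>x. \<Sum>k\<in>K. \<Sum>l\<in>K. (a k * cnj (a l)) * torus_char (k - l) x) has_integral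
      (\<Sum>k\<in>K. \<Sum>l\<in>K. (a k * cnj (a l)) * (if k - l = 0 then 1 else 0))) (cbox 0 1)"
    using K by (intro has_integral_sum has_integral_mult_right torus_char_has_integral int_lattice_diff) auto
  have diag: "(\<Sum>k\<in>K. \<Sum>l\<in>K. (a k * cnj (a l)) * (if k - l = 0 then 1 else 0)) = (\<Sum>k\<in>K. a k * cnj (a k))"
    using K(1) by (intro sum.cong) (simp_all add: if_distrib cong: if_cong)
  have "((\<lambda>x. complex_of_real ((cmod (?r x))\<^sup>2)) has_integral
     of_real (torus_integral (\<lambda>x. (f x)\<^sup>2)) - (\<Sum>k\<in>K. cnj (a k) * ?c k) - (\<Sum>k\<in>K. a k * cnj (?c k))
      + (\<Sum>k\<in>K. a k * cnj (a k))) (cbox 0 1)"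
    unfolding expand using has_integral_add[OF has_integral_diff[OF has_integral_diff[OF i1 i2] i3] i4]
    unfolding diag .
  moreover have "((\<lambda>x. complex_of_real ((cmod (?r x))\<^sup>2)) has_integral
     of_real (torus_integral (\<lambda>x. (cmod (?r x))\<^sup>2))) (cbox 0 1)"
    by (intro has_integral_of_real torus_integral_has_integral cont)
  ultimately have "complex_of_real (torus_integral (\<lambda>x. (cmod (?r x))\<^sup>2)) =
    of_real (torus_integral (\<lambda>x. (f x)\<^sup>2)) - (\<Sum>k\<in>K. cnj (a k) * ?c k) - (\<Sum>k\<in>K. a k * cnj (?c k))
      + (\<Sum>k\<in>K. a k * cnj (a k))" by (rule has_integral_unique[rotated])
  also have "\<dots> = of_real (torus_integral (\<lambda>x. (f x)\<^sup>2) - (\<Sum>k\<in>K. (cmod (?c k))\<^sup>2)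
      + (\<Sum>k\<in>K. (cmod (a k - ?c k))\<^sup>2))"
  proof -
    have "of_real ((cmod (a k - ?c k))\<^sup>2) = of_real ((cmod (?c k))\<^sup>2) - cnj (a k) * ?c k - a k * cnj (?c k) + a k * cnj (a k)" for k
      unfolding complex_norm_square by (simp add: algebra_simps)
    then show ?thesis by (simp add: sum.distrib sum_subtractf del: of_real_power)
  qed
  finally show ?thesis by (simp only: of_real_eq_iff)
qed

text \<open>Bessel's inequality bounds the finite sums from above. Conversely, a polynomial within
  \<open>d\<close> of \<open>f\<close> has finitely many frequencies \<open>K\<close>, and these
  capture all but \<open>d\<^sup>2\<close> of the energy; enlarging \<open>K\<close> only adds to
  the sum.\<close>

lemma parseval_torus:
  fixes f :: "real ^ 'n \<Rightarrow> real"
  assumes f: "lattice_periodic f" "continuous_on UNIV f"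
  shows "((\<lambda>k. (cmod (fourier_coeff f k))\<^sup>2) has_sum torus_integral (\<lambda>x. (f x)\<^sup>2)) int_lattice"
  unfolding has_sum_def
proof (rule tendstoI)
  fix e :: real assume "e > 0"
  then obtain d where d: "d > 0" "d\<^sup>2 < e"
    by (metis real_sqrt_gt_zero real_sqrt_pow2 less_eq_real_def field_sum_of_halves dense zero_less_power2 real_sqrt_less_iff)
  let ?N = "torus_integral (\<lambda>x. (f x)\<^sup>2)" and ?c = "\<lambda>k. (cmod (fourier_coeff f k))\<^sup>2"
  obtain g where g: "g \<in> trig_poly int_lattice" "\<And>x. \<bar>f x - g x\<bar> \<le> d"
    using trig_poly_dense[OF f d(1)] by blast
  obtain K a where K: "finite K" "K \<subseteq> int_lattice" "\<And>x. complex_of_real (g x) = (\<Sum>k\<in>K. a k * torus_char k x)"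
    using trig_poly_eq_char_sum[OF g(1)] by blast
  have "torus_integral (\<lambda>x. (f x - g x)\<^sup>2) \<le> torus_integral (\<lambda>x :: real ^ 'n. d\<^sup>2)"
  proof (rule torus_integral_mono)
    show "(f x - g x)\<^sup>2 \<le> d\<^sup>2" for x using g(2)[of x] abs_le_square_iff[of "f x - g x" d] d by simp
  qed (intro continuous_intros f trig_poly_continuous[OF g(1)])+
  moreover have "(cmod (of_real (f x) - (\<Sum>k\<in>K. a k * torus_char k x)))\<^sup>2 = (f x - g x)\<^sup>2" for x
    unfolding K(3)[symmetric] by (metis norm_of_real of_real_diff power2_abs)
  ultimately have "?N - sum ?c K + (\<Sum>k\<in>K. (cmod (a k - fourier_coeff f k))\<^sup>2) \<le> d\<^sup>2"
    using torus_integral_char_sum_error[OF f(2) K(1,2), of a] by (simp add: torus_integral_const)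
  moreover have "(\<Sum>k\<in>K. (cmod (a k - fourier_coeff f k))\<^sup>2) \<ge> 0" by (intro sum_nonneg) simp
  ultimately have lower: "?N - sum ?c K < e" using d(2) by linarith
  have upper: "sum ?c L \<le> ?N" if L: "finite L" "L \<subseteq> int_lattice" for L
  proof -
    have "0 \<le> torus_integral (\<lambda>x. (cmod (of_real (f x) - (\<Sum>k\<in>L. fourier_coeff f k * torus_char k x)))\<^sup>2)"
      unfolding torus_integral_def
      by (intro integral_nonneg integrable_on_unit_cube continuous_intros f torus_char_continuous) simp
    then show ?thesis unfolding torus_integral_char_sum_error[OF f(2) L] by simp
  qed
  show "\<forall>\<^sub>F L in finite_subsets_at_top int_lattice. dist (sum ?c L) ?N < e"
    unfolding eventually_finite_subsets_at_top
  proof (intro exI[of _ K] conjI K allI impI)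
    fix L assume L: "finite L \<and> K \<subseteq> L \<and> L \<subseteq> int_lattice"
    then have "sum ?c K \<le> sum ?c L" by (intro sum_mono2) auto
    then show "dist (sum ?c L) ?N < e" using lower upper[of L] L by (auto simp: dist_real_def)
  qed
qed

section \<open>The large momentum limit along nonresonant directions\<close>

lemma trig_poly_C1: "f \<in> trig_poly S \<Longrightarrow> C_k 1 f"
  by (rule C_k_1_I[OF trig_poly_has_derivative trig_poly_grad_continuous])

lemma trig_poly_grad_cmult:
  assumes "f \<in> trig_poly S"
  shows "grad (\<lambda>x. a * f x) x = a *\<^sub>R grad f x"
  using has_derivative_mult_right[OF trig_poly_has_derivative[OF assms], of a]
  by (intro grad_unique) simp

text \<open>An approximate corrector with residual at most \<open>e\<close> pins the effective value
  down to \<open>e\<close>. Both asymptotic expansions below use viscosity solutions only through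
  this estimate.\<close>

lemma cell_problem_trig_estimate:
  assumes "cell_problem_solvable H V p c" "\<phi> \<in> trig_poly int_lattice"
    and "\<And>x. \<bar>H (p + grad \<phi> x) + V x - m\<bar> \<le> e"
  shows "\<bar>c - m\<bar> \<le> e"
proof -
  note \<phi> = trig_poly_C1[OF assms(2)] trig_poly_continuous[OF assms(2)] trig_poly_periodic[OF assms(2) order_refl]
  have "H (p + grad \<phi> x) + V x \<le> m + e" "H (p + grad \<phi> x) + V x \<ge> m - e" for x
    using assms(3)[of x] by auto
  from cell_problem_le[OF assms(1) \<phi> this(1)] cell_problem_ge[OF assms(1) \<phi> this(2)]
  show ?thesis by auto
qed

text \<open>\<open>w\<close> is the average of \<open>f\<close> along \<open>Q\<close>. Its sup
  bound makes later constants depend on the size of \<open>f\<close> alone, and its Fourier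
  coefficients identify means and energies.\<close>

lemma trig_poly_resonant_part:
  fixes f :: "real ^ 'n \<Rightarrow> real"
  assumes f: "f \<in> trig_poly S" "S \<subseteq> int_lattice" and B: "\<And>x. \<bar>f x\<bar> \<le> B"
  obtains v w where "v \<in> trig_poly S" "w \<in> trig_poly (S \<inter> {k. Q \<bullet> k = 0})"
    "\<And>x. Q \<bullet> grad v x + f x = w x" "\<And>x. \<bar>w x\<bar> \<le> B"
    "\<And>k. k \<in> int_lattice \<Longrightarrow> fourier_coeff w k = (if Q \<bullet> k = 0 then fourier_coeff f k else 0)"
proof -
  obtain v w where v: "v \<in> trig_poly (S \<inter> {k. Q \<bullet> k \<noteq> 0})"
    and w: "w \<in> trig_poly (S \<inter> {k. Q \<bullet> k = 0})" and eq: "\<And>x. Q \<bullet> grad v x + f x = w x"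
    using trig_poly_cohomological_equation[OF f(1)] by blast
  have v': "v \<in> trig_poly S" using v by (rule trig_poly_mono) auto
  have "\<bar>w x\<bar> \<le> B" for x
    by (rule cohomological_equation_bound[OF v' f(2) w eq B])
  moreover have "fourier_coeff w k = (if Q \<bullet> k = 0 then fourier_coeff f k else 0)" if k: "k \<in> int_lattice" for k
  proof (cases "Q \<bullet> k = 0")
    case True
    \<comment> \<open>Differentiation creates no frequencies, so this derivative has none orthogonal
      to \<open>Q\<close> and does not contribute to the coefficient at \<open>k\<close>.\<close>
    have g: "(\<lambda>x. Q \<bullet> grad v x) \<in> trig_poly (S \<inter> {k. Q \<bullet> k \<noteq> 0})"
      by (rule trig_poly_inner_grad[OF v])
    have "fourier_coeff (\<lambda>x. Q \<bullet> grad v x) k = 0"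
      by (rule trig_poly_fourier_coeff_eq_0[OF g]) (use True k f(2) in auto)
    moreover have "fourier_coeff (\<lambda>x. Q \<bullet> grad v x + f x) k = fourier_coeff (\<lambda>x. Q \<bullet> grad v x) k + fourier_coeff f k"
      by (rule fourier_coeff_add[OF trig_poly_continuous[OF g] trig_poly_continuous[OF f(1)]])
    moreover have "w = (\<lambda>x. Q \<bullet> grad v x + f x)" using eq by auto
    ultimately show ?thesis using True by simp
  next
    case False
    have "fourier_coeff w k = 0"
      by (rule trig_poly_fourier_coeff_eq_0[OF w]) (use False k f(2) in auto)
    with False show ?thesis by simp
  qed
  ultimately show thesis using that[OF v' w eq] by blast
qed

text \<open>Zero is the only lattice frequency orthogonal to an irrational \<open>Q\<close>, so the
  averaged part is a constant, the mean of the approximating polynomial. Half of \<open>e\<close>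
  pays for replacing \<open>V\<close> pointwise, half for replacing its mean.\<close>

lemma irrational_approximate_corrector:
  fixes V :: "real ^ 'n \<Rightarrow> real"
  assumes Q: "irrational_vector Q" and V: "lattice_periodic V" "continuous_on UNIV V" and e: "e > 0"
  obtains v where "v \<in> trig_poly int_lattice" "\<And>x. \<bar>Q \<bullet> grad v x + V x - torus_integral V\<bar> \<le> e"
proof -
  obtain f where f: "f \<in> trig_poly int_lattice" "\<And>x. \<bar>V x - f x\<bar> \<le> e / 2"
    using trig_poly_dense[OF V, of "e / 2"] e by auto
  note fc = trig_poly_continuous[OF f(1)]
  obtain B where B: "\<And>x. \<bar>f x\<bar> \<le> B"
    using lattice_periodic_bounded[OF trig_poly_periodic[OF f(1) order_refl] fc] by blast
  obtain v w where v: "v \<in> trig_poly int_lattice" and w: "w \<in> trig_poly (int_lattice \<inter> {k. Q \<bullet> k = 0})"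
    and eq: "\<And>x. Q \<bullet> grad v x + f x = w x"
    and fw: "\<And>k. k \<in> int_lattice \<Longrightarrow> fourier_coeff w k = (if Q \<bullet> k = 0 then fourier_coeff f k else 0)"
    using trig_poly_resonant_part[OF f(1) order_refl B] by metis
  have "int_lattice \<inter> {k. Q \<bullet> k = 0} = {0}"
    using Q by (auto simp: irrational_vector_def)
  then obtain c where c: "w = (\<lambda>x. c)" using trig_poly_zero_frequency w by metis
  have "complex_of_real (torus_integral w) = of_real (torus_integral f)"
    using fw[of 0] fourier_coeff_0[OF fc] fourier_coeff_0[of w] c by simp
  then have "c = torus_integral f" by (simp add: c torus_integral_const)
  moreover have "\<bar>torus_integral V - torus_integral f\<bar> \<le> e / 2"
    by (rule torus_integral_close[OF V(2) fc f(2)])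
  ultimately have "\<bar>Q \<bullet> grad v x + V x - torus_integral V\<bar> \<le> e" for x
    using eq[of x] f(2)[of x] unfolding c by linarith
  with v show thesis using that by blast
qed

text \<open>\<open>g\<close> stands for the gradient of \<open>H\<close>. Stating the Taylor bound
  as an assumption covers the quadratic and the general Hamiltonian at once.\<close>

lemma effective_hamiltonian_asymptotics:
  fixes V :: "real ^ 'n \<Rightarrow> real"
  assumes Q: "irrational_vector Q" and V: "lattice_periodic V" "continuous_on UNIV V"
    and Hb: "\<And>p. cell_problem_solvable H V p (Hb p)"
    and taylor: "\<And>p h. \<bar>H (p + h) - H p - g p \<bullet> h\<bar> \<le> K * (norm h)\<^sup>2"
    and P: "\<And>l. l > 0 \<Longrightarrow> g (l *\<^sub>R P l) = l *\<^sub>R Q"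
  shows "((\<lambda>l. Hb (l *\<^sub>R P l) - H (l *\<^sub>R P l)) \<longlongrightarrow> torus_integral V) at_top"
proof (rule tendstoI)
  fix e :: real assume e: "e > 0"
  obtain v where v: "v \<in> trig_poly int_lattice" "\<And>x. \<bar>Q \<bullet> grad v x + V x - torus_integral V\<bar> \<le> e / 2"
    using irrational_approximate_corrector[OF Q V, of "e / 2"] e by auto
  obtain G where G: "G > 0" "\<And>x. norm (grad v x) \<le> G"
    using trig_poly_grad_bounded[OF v(1) order_refl] by blast
  have "K \<ge> 0"
    using taylor[of 0 1] zero_le_mult_iff[of K "(norm (1 :: real ^ 'n))\<^sup>2"] by (smt (verit) norm_eq_zero zero_neq_one zero_le_power2 power_eq_0_iff)
  have lim: "((\<lambda>l::real. K * G\<^sup>2 / l\<^sup>2) \<longlongrightarrow> 0) at_top"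
    by (intro tendsto_divide_0[OF tendsto_const] filterlim_at_top_imp_at_infinity
        filterlim_pow_at_top filterlim_ident) simp
  have "\<forall>\<^sub>F l in at_top. K * G\<^sup>2 / l\<^sup>2 < e / 2"
    by (rule order_tendstoD(2)[OF lim]) (use e in auto)
  then show "\<forall>\<^sub>F l in at_top. dist (Hb (l *\<^sub>R P l) - H (l *\<^sub>R P l)) (torus_integral V) < e"
    using eventually_gt_at_top[of 0]
  proof eventually_elim
    fix l :: real assume l: "K * G\<^sup>2 / l\<^sup>2 < e / 2" "l > 0"
    \<comment> \<open>Scaling the corrector by \<open>1 / l\<close> balances the gradient
      \<open>l *\<^sub>R Q\<close>: the linear term is exactly \<open>Q \<bullet> grad v x\<close>,
      while the Taylor remainder is of order \<open>1 / l\<^sup>2\<close>.\<close>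
    let ?p = "l *\<^sub>R P l" and ?\<phi> = "\<lambda>x. (1 / l) * v x"
    have \<phi>: "?\<phi> \<in> trig_poly int_lattice" by (rule trig_poly_cmult[OF v(1)])
    have "\<bar>H (?p + grad ?\<phi> x) + V x - (H ?p + torus_integral V)\<bar> \<le> e / 2 + K * G\<^sup>2 / l\<^sup>2" for x
    proof -
      let ?h = "(1 / l) *\<^sub>R grad v x"
      have "K * (norm ?h)\<^sup>2 \<le> K * G\<^sup>2 / l\<^sup>2"
        using G(2)[of x] \<open>K \<ge> 0\<close> l(2)
        by (simp add: power_divide divide_right_mono mult_left_mono power_mono)
      moreover have "g ?p \<bullet> ?h = Q \<bullet> grad v x" using P[OF l(2)] l(2) by simp
      ultimately show ?thesis
        using taylor[of ?p ?h] v(2)[of x] unfolding trig_poly_grad_cmult[OF v(1)] by linarith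
    qed
    from cell_problem_trig_estimate[OF Hb \<phi> this] l(1)
    show "dist (Hb ?p - H ?p) (torus_integral V) < e" unfolding dist_real_def by linarith
  qed
qed

text \<open>The rows of the Hessian are the gradients of the partial derivatives, so the gradient of
  \<open>H\<close> is Lipschitz. The mean value theorem for \<open>H\<close> minus its linear part
  along the segment turns this into a quadratic remainder.\<close>

lemma C2_quadratic_remainder:
  fixes H :: "real ^ 'n \<Rightarrow> real"
  assumes H: "C_k 2 H" and M: "bdd_above (range (\<lambda>p. norm (hessian H p)))"
  obtains K where "\<And>p h. \<bar>H (p + h) - H p - grad H p \<bullet> h\<bar> \<le> K * (norm h)\<^sup>2"
proof -
  obtain M where M: "\<And>p. norm (hessian H p) \<le> M"
    using assms(2) by (auto simp: bdd_above_def)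
  have diff: "H differentiable (at x)" "partial_deriv i H differentiable (at x)" for x i
    using H by (auto simp: numeral_2_eq_2)
  have lip: "\<bar>partial_deriv i H x - partial_deriv i H y\<bar> \<le> M * norm (x - y)" for i x y
  proof -
    have "norm (partial_deriv i H x - partial_deriv i H y) \<le> M * norm (x - y)"
    proof (rule differentiable_bound[of UNIV _ "\<lambda>x h. grad (partial_deriv i H) x \<bullet> h"])
      fix x
      show "(partial_deriv i H has_derivative (\<bullet>) (grad (partial_deriv i H) x)) (at x within UNIV)"
        using has_derivative_grad[OF diff(2)] by simp
      have "grad (partial_deriv i H) x = hessian H x $ i"
        by (simp add: grad_def hessian_def)
      then have "norm (grad (partial_deriv i H) x) \<le> M"
        using M[of x] Finite_Cartesian_Product.norm_nth_le[of "hessian H x" i] by simp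
      then show "onorm ((\<bullet>) (grad (partial_deriv i H) x)) \<le> M"
        using Cauchy_Schwarz_ineq2[of "grad (partial_deriv i H) x"]
        by (intro onorm_le) (metis mult_right_mono norm_ge_zero order_trans real_norm_def)
    qed auto
    then show ?thesis by simp
  qed
  define N where "N = real CARD('n) * M"
  have N: "norm (grad H x - grad H y) \<le> N * norm (x - y)" for x y
  proof -
    have "norm (grad H x - grad H y) \<le> (\<Sum>i\<in>UNIV. \<bar>(grad H x - grad H y) $ i\<bar>)"
      by (rule norm_le_l1_cart)
    also have "\<dots> \<le> (\<Sum>i\<in>(UNIV :: 'n set). M * norm (x - y))"
      using lip by (intro sum_mono) (simp add: grad_def)
    finally show ?thesis by (simp add: N_def)
  qed
  have "M \<ge> 0" using M[of 0] norm_ge_zero order_trans by blast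
  then have "N \<ge> 0" by (simp add: N_def)
  have "\<bar>H (p + h) - H p - grad H p \<bullet> h\<bar> \<le> N * (norm h)\<^sup>2" for p h
  proof -
    have der: "((\<lambda>s. H (p + s *\<^sub>R h) - s * (grad H p \<bullet> h)) has_real_derivative
        (grad H (p + s *\<^sub>R h) - grad H p) \<bullet> h) (at s)" for s
    proof -
      have "((\<lambda>s. H (p + s *\<^sub>R h)) has_derivative (\<lambda>k. grad H (p + s *\<^sub>R h) \<bullet> (k *\<^sub>R h))) (at s)"
        by (rule has_derivative_compose[OF _ has_derivative_grad[OF diff(1)]])
           (auto intro!: derivative_eq_intros)
      then have "((\<lambda>s. H (p + s *\<^sub>R h)) has_real_derivative grad H (p + s *\<^sub>R h) \<bullet> h) (at s)"
        by (simp add: has_field_derivative_def mult_commute_abs)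
      then show ?thesis
        by (auto intro!: derivative_eq_intros simp: inner_diff_left)
    qed
    obtain s where s: "0 < s" "s < 1" "(H (p + 1 *\<^sub>R h) - 1 * (grad H p \<bullet> h)) - (H (p + 0 *\<^sub>R h) - 0 * (grad H p \<bullet> h))
        = (1 - 0) * ((grad H (p + s *\<^sub>R h) - grad H p) \<bullet> h)"
      using MVT2[of 0 1 "\<lambda>s. H (p + s *\<^sub>R h) - s * (grad H p \<bullet> h)"] der by force
    have "\<bar>(grad H (p + s *\<^sub>R h) - grad H p) \<bullet> h\<bar> \<le> norm (grad H (p + s *\<^sub>R h) - grad H p) * norm h"
      by (rule Cauchy_Schwarz_ineq2)
    also have "\<dots> \<le> (N * norm (s *\<^sub>R h)) * norm h"
      using N[of "p + s *\<^sub>R h" p] by (intro mult_right_mono) auto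
    also have "\<dots> \<le> (N * norm h) * norm h"
      using s \<open>N \<ge> 0\<close> by (intro mult_right_mono mult_left_mono) (auto simp: mult_left_le_one_le)
    finally show ?thesis using s(3) by (simp add: power2_eq_square mult.assoc)
  qed
  then show thesis by (rule that)
qed

text \<open>A global minimum of \<open>H p - y \<bullet> p\<close> exists by superlinearity and is a
  critical point.\<close>

lemma superlinear_grad_surj:
  fixes H :: "real ^ 'n \<Rightarrow> real"
  assumes sl: "superlinear H" and diff: "\<And>x. H differentiable (at x)"
  obtains p where "grad H p = y"
proof -
  define f where "f p = H p - y \<bullet> p" for p
  have der: "(f has_derivative (\<lambda>h. (grad H p - y) \<bullet> h)) (at p)" for p
    unfolding f_def
    by (auto intro!: derivative_eq_intros has_derivative_grad diff simp: inner_diff_left)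
  have "\<forall>\<^sub>F p in at_infinity. H p / norm p \<ge> norm y + 1"
    using sl unfolding superlinear_def filterlim_at_top by blast
  then obtain R where R: "\<And>p. norm p \<ge> R \<Longrightarrow> H p / norm p \<ge> norm y + 1"
    unfolding eventually_at_infinity by blast
  \<comment> \<open>Beyond \<open>R\<close> superlinearity gives \<open>f p \<ge> norm p\<close>,
    and \<open>\<bar>f 0\<bar>\<close> lifts this above \<open>f 0\<close>; the 1 keeps
    \<open>norm p\<close> positive for the division.\<close>
  define r where "r = max (max R 1) \<bar>f 0\<bar>"
  have out: "f p \<ge> f 0" if "norm p \<ge> r" for p
  proof -
    have "norm p \<ge> R" "norm p > 0" "norm p \<ge> \<bar>f 0\<bar>" using that by (auto simp: r_def)
    then have "H p \<ge> (norm y + 1) * norm p" using R[of p] by (simp add: pos_le_divide_eq)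
    moreover have "y \<bullet> p \<le> norm y * norm p" by (rule norm_cauchy_schwarz)
    ultimately show ?thesis using \<open>norm p \<ge> \<bar>f 0\<bar>\<close> by (simp add: f_def algebra_simps)
  qed
  have "continuous_on (cball 0 r) f"
    using der by (meson differentiable_at_imp_differentiable_on differentiable_def differentiable_imp_continuous_on)
  moreover have "r \<ge> 0" by (simp add: r_def)
  ultimately have "\<exists>p\<in>cball 0 r. \<forall>x\<in>cball 0 r. f p \<le> f x"
    by (intro continuous_attains_inf) auto
  then obtain p where p: "\<And>x. x \<in> cball 0 r \<Longrightarrow> f p \<le> f x" by blast
  have "f p \<le> f x" for x
    using p[of x] out[of x] p[of 0] \<open>r \<ge> 0\<close> by (cases "norm x \<le> r") auto
  then have "(\<lambda>h. (grad H p - y) \<bullet> h) = (\<lambda>h. 0)"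
    by (intro has_derivative_local_min[OF der] always_eventually) auto
  then have "(grad H p - y) \<bullet> (grad H p - y) = 0" by meson
  then show thesis using that by simp
qed

lemma quadratic_hamiltonian_add:
  "quadratic_hamiltonian (p + h) = quadratic_hamiltonian p + p \<bullet> h + quadratic_hamiltonian h"
  by (simp add: quadratic_hamiltonian_def power2_norm_eq_inner inner_add_left inner_add_right
      inner_commute)

lemma effective_quadratic_asymptotics:
  fixes V :: "real ^ 'n \<Rightarrow> real"
  assumes Q: "irrational_vector Q" and V: "lattice_periodic V" "continuous_on UNIV V"
    and Hb: "effective_hamiltonian quadratic_hamiltonian V Hb"
  shows "((\<lambda>l. Hb (l *\<^sub>R Q) - 1 / 2 * l\<^sup>2 * (norm Q)\<^sup>2) \<longlongrightarrow> torus_integral V) at_top"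
proof -
  have "((\<lambda>l. Hb (l *\<^sub>R Q) - quadratic_hamiltonian (l *\<^sub>R Q)) \<longlongrightarrow> torus_integral V) at_top"
  proof (rule effective_hamiltonian_asymptotics[where g = "\<lambda>p. p" and K = "1 / 2"])
    show "\<bar>quadratic_hamiltonian (p + h) - quadratic_hamiltonian p - p \<bullet> h\<bar> \<le> 1 / 2 * (norm h)\<^sup>2"
      for p h :: "real ^ 'n"
      unfolding quadratic_hamiltonian_add by (simp add: quadratic_hamiltonian_def)
  qed (use assms in \<open>auto simp: effective_hamiltonian_def\<close>)
  then show ?thesis by (simp add: quadratic_hamiltonian_def power_mult_distrib)
qed

section \<open>Convexity of the effective Hamiltonian\<close>

text \<open>Two centres, because in the tripled problem below \<open>z\<close> is penalized against
  both \<open>x\<close> and \<open>y\<close>. The other two variables use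
  \<open>b = 0\<close>.\<close>

lemma quadratic_test_function:
  fixes u w :: "real ^ 'n" and a b :: real
  defines "\<phi> \<equiv> \<lambda>x. a * (norm (x - u))\<^sup>2 + b * (norm (x - w))\<^sup>2"
  shows "C_k 1 \<phi>" "grad \<phi> x = (2 * a) *\<^sub>R (x - u) + (2 * b) *\<^sub>R (x - w)"
proof -
  have d: "(\<phi> has_derivative (\<lambda>h. ((2 * a) *\<^sub>R (x - u) + (2 * b) *\<^sub>R (x - w)) \<bullet> h)) (at x)" for x
    unfolding \<phi>_def power2_norm_eq_inner
    by (auto intro!: derivative_eq_intros simp: inner_add_left inner_commute algebra_simps)
  show "grad \<phi> x = (2 * a) *\<^sub>R (x - u) + (2 * b) *\<^sub>R (x - w)" using d by (rule grad_unique)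
  show "C_k 1 \<phi>" by (rule C_k_1_I[OF d]) (intro continuous_intros)
qed

text \<open>\<open>V\<close> is uniformly close to a trigonometric polynomial, which is Lipschitz
  since its gradient is bounded. This avoids matching points near opposite faces of a fundamental
  cube.\<close>

lemma lattice_periodic_uniformly_continuous:
  fixes V :: "real ^ 'n \<Rightarrow> real"
  assumes V: "lattice_periodic V" "continuous_on UNIV V" and e: "e > 0"
  obtains d where "d > 0" "\<And>x y. norm (x - y) \<le> d \<Longrightarrow> \<bar>V x - V y\<bar> \<le> e"
proof -
  obtain f where f: "f \<in> trig_poly int_lattice" "\<And>x. \<bar>V x - f x\<bar> \<le> e / 3"
    using trig_poly_dense[OF V, of "e / 3"] e by auto
  obtain G where G: "G > 0" "\<And>x. norm (grad f x) \<le> G"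
    using trig_poly_grad_bounded[OF f(1) order_refl] by blast
  have lip: "norm (f x - f y) \<le> G * norm (x - y)" for x y
  proof (rule differentiable_bound[of UNIV _ "\<lambda>x h. grad f x \<bullet> h"])
    fix x
    show "(f has_derivative (\<bullet>) (grad f x)) (at x within UNIV)"
      using trig_poly_has_derivative[OF f(1)] by simp
    show "onorm ((\<bullet>) (grad f x)) \<le> G"
      using Cauchy_Schwarz_ineq2[of "grad f x"] G(2)[of x]
      by (intro onorm_le) (metis mult_right_mono norm_ge_zero order_trans real_norm_def)
  qed auto
  show thesis
  proof (rule that[of "e / (3 * G)"])
    fix x y :: "real ^ 'n" assume "norm (x - y) \<le> e / (3 * G)"
    then have "G * norm (x - y) \<le> e / 3" using G(1) by (simp add: field_simps)
    then show "\<bar>V x - V y\<bar> \<le> e"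
      using lip[of x y] f(2)[of x] f(2)[of y] unfolding real_norm_def by linarith
  qed (use e G in auto)
qed

text \<open>The triple is periodic only under common translations, so compactness is obtained in the
  coordinates \<open>a = x - z\<close>, \<open>b = y - z\<close> and \<open>z\<close>: the penalty
  confines \<open>a\<close> and \<open>b\<close>, and periodicity moves \<open>z\<close> into the
  unit cube. Comparison with \<open>a = b = 0\<close> bounds the penalty at the maximum.\<close>

lemma periodic_penalization_attains_max:
  fixes f g h :: "real ^ 'n \<Rightarrow> real"
  assumes per: "lattice_periodic f" "lattice_periodic g" "lattice_periodic h"
    and cont: "continuous_on UNIV f" "continuous_on UNIV g" "continuous_on UNIV h"
    and bd: "\<And>x y z. \<bar>f x + g y - h z\<bar> \<le> B" and N: "N > 0"
  obtains x0 y0 z0 where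
    "\<And>x y z. f x + g y - h z - N * ((norm (x - z))\<^sup>2 + (norm (y - z))\<^sup>2)
       \<le> f x0 + g y0 - h z0 - N * ((norm (x0 - z0))\<^sup>2 + (norm (y0 - z0))\<^sup>2)"
    "N * ((norm (x0 - z0))\<^sup>2 + (norm (y0 - z0))\<^sup>2) \<le> 2 * B"
proof -
  define F where "F a b z = f (z + a) + g (z + b) - h z - N * ((norm a)\<^sup>2 + (norm b)\<^sup>2)" for a b z
  \<comment> \<open>Makes \<open>N * R\<^sup>2 \<ge> 2 * B\<close>, so that outside these balls
    \<open>F\<close> is at most \<open>- B\<close>, hence not above \<open>F 0 0 0\<close>; the
    summand 1 serves \<open>R \<le> R\<^sup>2\<close>.\<close>
  define R where "R = 2 * B / N + 1"
  have "B \<ge> 0" using bd[of 0 0 0] by linarith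
  then have R: "R \<ge> 1" using N by (simp add: R_def)
  have R2: "N * R\<^sup>2 \<ge> 2 * B"
  proof -
    have "R \<le> R\<^sup>2" using R by (simp add: power2_eq_square)
    then have "N * R \<le> N * R\<^sup>2" using N by simp
    moreover have "N * R = 2 * B + N" using N by (simp add: R_def field_simps)
    ultimately show ?thesis using N by linarith
  qed
  let ?S = "cball (0 :: real ^ 'n) R \<times> cball (0 :: real ^ 'n) R \<times> cbox 0 (1 :: real ^ 'n)"
  have "(0, 0, 0) \<in> ?S" using R by (auto simp: mem_box_cart)
  moreover have "continuous_on ?S (\<lambda>(a, b, z). F a b z)"
    unfolding F_def case_prod_beta
    by (intro continuous_intros continuous_on_compose2[OF cont(1)] continuous_on_compose2[OF cont(2)]
        continuous_on_compose2[OF cont(3)]) auto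
  ultimately have "\<exists>s\<in>?S. \<forall>t\<in>?S. (\<lambda>(a, b, z). F a b z) t \<le> (\<lambda>(a, b, z). F a b z) s"
    by (intro continuous_attains_sup compact_Times compact_cball compact_cbox) auto
  then obtain a0 b0 z0 where mx: "\<And>a b z. norm a \<le> R \<Longrightarrow> norm b \<le> R \<Longrightarrow> z \<in> cbox 0 1 \<Longrightarrow> F a b z \<le> F a0 b0 z0"
    by fastforce
  have F0: "F 0 0 0 \<le> F a0 b0 z0" using R by (intro mx) (auto simp: mem_box_cart)
  have F00: "F 0 0 0 \<ge> - B" using bd[of 0 0 0] by (simp add: F_def abs_le_iff)
  have all: "F a b z \<le> F a0 b0 z0" for a b z
  proof (cases "norm a \<le> R \<and> norm b \<le> R")
    case True
    obtain k where k: "k \<in> int_lattice" "z + k \<in> cbox 0 1" using lattice_translate_to_unit_cube by blast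
    have "z + k + a = (z + a) + k" "z + k + b = (z + b) + k" by simp_all
    then have "F a b z = F a b (z + k)"
      unfolding F_def using per k(1) by (simp only: lattice_periodicD)
    then show ?thesis using mx[of a b "z + k"] True k(2) by simp
  next
    case False
    then have "(norm a)\<^sup>2 \<ge> R\<^sup>2 \<or> (norm b)\<^sup>2 \<ge> R\<^sup>2"
      using R by (auto intro!: power_mono)
    then have "(norm a)\<^sup>2 + (norm b)\<^sup>2 \<ge> R\<^sup>2"
      by (smt (verit) zero_le_power2)
    then have "N * ((norm a)\<^sup>2 + (norm b)\<^sup>2) \<ge> N * R\<^sup>2" using N by simp
    then have "F a b z \<le> B - 2 * B" using bd[of "z + a" "z + b" z] R2 unfolding F_def by linarith
    then show ?thesis using F0 F00 by linarith
  qed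
  show thesis
  proof (rule that[of "z0 + a0" "z0 + b0" z0])
    fix x y z
    show "f x + g y - h z - N * ((norm (x - z))\<^sup>2 + (norm (y - z))\<^sup>2)
       \<le> f (z0 + a0) + g (z0 + b0) - h z0 - N * ((norm (z0 + a0 - z0))\<^sup>2 + (norm (z0 + b0 - z0))\<^sup>2)"
      using all[of "x - z" "y - z" z] by (simp add: F_def)
  next
    show "N * ((norm (z0 + a0 - z0))\<^sup>2 + (norm (z0 + b0 - z0))\<^sup>2) \<le> 2 * B"
      using F0 F00 bd[of "z0 + a0" "z0 + b0" z0] by (simp add: F_def)
  qed
qed

text \<open>The usual doubling of variables, here with three variables: two for the given solutions
  and one for the solution at the convex combination.\<close>

lemma cell_problem_convex:
  fixes V W :: "real ^ 'n \<Rightarrow> real"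
  assumes H: "convex_on UNIV H" and t: "0 < t" "t < 1"
    and V: "lattice_periodic V" "continuous_on UNIV V"
    and W: "lattice_periodic W" "continuous_on UNIV W"
    and s1: "cell_problem_solvable H V p a" and s2: "cell_problem_solvable H W q b"
    and s: "cell_problem_solvable H (\<lambda>x. (1 - t) * V x + t * W x) ((1 - t) *\<^sub>R p + t *\<^sub>R q) c"
  shows "c \<le> (1 - t) * a + t * b"
proof (rule field_le_epsilon)
  fix e :: real assume e: "e > 0"
  obtain f where f: "lattice_periodic f" "viscosity_subsolution (\<lambda>x r. H (p + r) + V x - a) f"
    using s1 by (auto simp: cell_problem_solvable_def viscosity_solution_def)
  obtain g where g: "lattice_periodic g" "viscosity_subsolution (\<lambda>x r. H (q + r) + W x - b) g"
    using s2 by (auto simp: cell_problem_solvable_def viscosity_solution_def)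
  obtain h where h: "lattice_periodic h" "viscosity_supersolution
      (\<lambda>x r. H ((1 - t) *\<^sub>R p + t *\<^sub>R q + r) + ((1 - t) * V x + t * W x) - c) h"
    using s by (auto simp: cell_problem_solvable_def viscosity_solution_def)
  have cont: "continuous_on UNIV f" "continuous_on UNIV g" "continuous_on UNIV h"
    using f(2) g(2) h(2) by (auto simp: viscosity_subsolution_def viscosity_supersolution_def)
  obtain d1 where d1: "d1 > 0" "\<And>x y. norm (x - y) \<le> d1 \<Longrightarrow> \<bar>V x - V y\<bar> \<le> e"
    using lattice_periodic_uniformly_continuous[OF V e] by blast
  obtain d2 where d2: "d2 > 0" "\<And>x y. norm (x - y) \<le> d2 \<Longrightarrow> \<bar>W x - W y\<bar> \<le> e"
    using lattice_periodic_uniformly_continuous[OF W e] by blast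
  define d where "d = min d1 d2"
  have "d > 0" using d1(1) d2(1) by (simp add: d_def)
  obtain B1 where B1: "\<And>x. \<bar>f x\<bar> \<le> B1" using lattice_periodic_bounded[OF f(1) cont(1)] by blast
  obtain B2 where B2: "\<And>x. \<bar>g x\<bar> \<le> B2" using lattice_periodic_bounded[OF g(1) cont(2)] by blast
  obtain B3 where B3: "\<And>x. \<bar>h x\<bar> \<le> B3" using lattice_periodic_bounded[OF h(1) cont(3)] by blast
  define B where "B = B1 + B2 + B3 + 1"
  have "B > 0" using B1[of 0] B2[of 0] B3[of 0] by (simp add: B_def)
  have bd: "\<bar>(1 - t) * f x + t * g y - h z\<bar> \<le> B" for x y z
  proof -
    have "\<bar>(1 - t) * f x\<bar> \<le> B1" "\<bar>t * g y\<bar> \<le> B2"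
      using t B1[of x] B2[of y] mult_mono[of "1 - t" 1 "\<bar>f x\<bar>" B1] mult_mono[of t 1 "\<bar>g y\<bar>" B2]
      by (auto simp: abs_mult)
    then show ?thesis using B3[of z] by (simp add: B_def)
  qed
  \<comment> \<open>With this weight the bound \<open>2 * B\<close> on the penalty forces both
    distances to be at most \<open>d\<close>.\<close>
  define N where "N = 2 * B / d\<^sup>2"
  have N: "N > 0" using \<open>B > 0\<close> \<open>d > 0\<close> by (simp add: N_def)
  obtain x0 y0 z0 where
    mx: "\<And>x y z. (1 - t) * f x + t * g y - h z - N * ((norm (x - z))\<^sup>2 + (norm (y - z))\<^sup>2)
       \<le> (1 - t) * f x0 + t * g y0 - h z0 - N * ((norm (x0 - z0))\<^sup>2 + (norm (y0 - z0))\<^sup>2)"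
    and near: "N * ((norm (x0 - z0))\<^sup>2 + (norm (y0 - z0))\<^sup>2) \<le> 2 * B"
  proof (rule periodic_penalization_attains_max[OF _ _ h(1) _ _ cont(3) bd N])
    show "lattice_periodic (\<lambda>x. (1 - t) * f x)" "lattice_periodic (\<lambda>x. t * g x)"
      using f(1) g(1) by (auto simp: lattice_periodic_def)
    show "continuous_on UNIV (\<lambda>x. (1 - t) * f x)" "continuous_on UNIV (\<lambda>x. t * g x)"
      by (intro continuous_intros cont)+
  qed (rule that; assumption)
  have "(norm (x0 - z0))\<^sup>2 + (norm (y0 - z0))\<^sup>2 \<le> d\<^sup>2"
  proof -
    have "2 * B * ((norm (x0 - z0))\<^sup>2 + (norm (y0 - z0))\<^sup>2) \<le> 2 * B * d\<^sup>2"
      using near \<open>d > 0\<close> by (simp add: N_def field_simps)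
    then show ?thesis using \<open>B > 0\<close> by (subst (asm) mult_le_cancel_left_pos) auto
  qed
  then have "(norm (x0 - z0))\<^sup>2 \<le> d\<^sup>2" "(norm (y0 - z0))\<^sup>2 \<le> d\<^sup>2"
    by (smt (verit) zero_le_power2)+
  then have "norm (x0 - z0) \<le> d" "norm (y0 - z0) \<le> d"
    using \<open>d > 0\<close> by (auto intro: power2_le_imp_le)
  then have VW: "\<bar>V x0 - V z0\<bar> \<le> e" "\<bar>W y0 - W z0\<bar> \<le> e"
    using d1(2) d2(2) by (auto simp: d_def)
  \<comment> \<open>\<open>f\<close> enters the maximum with weight \<open>1 - t\<close>, so its
    test function is the penalty divided by \<open>1 - t\<close>. The momenta in \<open>1\<close>
    and \<open>2\<close> thereby average, with weights \<open>1 - t\<close> and \<open>t\<close>,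
    exactly to the one in \<open>3\<close>.\<close>
  have 1: "H (p + (2 * (N / (1 - t))) *\<^sub>R (x0 - z0)) + V x0 - a \<le> 0"
  proof -
    let ?\<phi> = "\<lambda>x. N / (1 - t) * (norm (x - z0))\<^sup>2 + 0 * (norm (x - z0))\<^sup>2"
    have "f x - ?\<phi> x \<le> f x0 - ?\<phi> x0" for x
    proof -
      have "(1 - t) * f x - N * (norm (x - z0))\<^sup>2 \<le> (1 - t) * f x0 - N * (norm (x0 - z0))\<^sup>2"
        using mx[of x y0 z0] by (simp add: algebra_simps)
      then have "(1 - t) * (f x - ?\<phi> x) \<le> (1 - t) * (f x0 - ?\<phi> x0)"
        using t by (simp only: right_diff_distrib distrib_left) simp
      then show ?thesis using t by (simp only: mult_le_cancel_left_pos)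
    qed
    then have "\<forall>\<^sub>F x in nhds x0. f x - ?\<phi> x \<le> f x0 - ?\<phi> x0" by (intro always_eventually allI)
    then have "H (p + grad ?\<phi> x0) + V x0 - a \<le> 0"
      using f(2) quadratic_test_function(1)[of "N / (1 - t)" z0 0 z0]
      unfolding viscosity_subsolution_def by blast
    then show ?thesis unfolding quadratic_test_function(2) by simp
  qed
  have 2: "H (q + (2 * (N / t)) *\<^sub>R (y0 - z0)) + W y0 - b \<le> 0"
  proof -
    let ?\<phi> = "\<lambda>x. N / t * (norm (x - z0))\<^sup>2 + 0 * (norm (x - z0))\<^sup>2"
    have "g x - ?\<phi> x \<le> g y0 - ?\<phi> y0" for x
    proof -
      have "t * g x - N * (norm (x - z0))\<^sup>2 \<le> t * g y0 - N * (norm (y0 - z0))\<^sup>2"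
        using mx[of x0 x z0] by (simp add: algebra_simps)
      then have "t * (g x - ?\<phi> x) \<le> t * (g y0 - ?\<phi> y0)"
        using t by (simp only: right_diff_distrib distrib_left) simp
      then show ?thesis using t by (simp only: mult_le_cancel_left_pos)
    qed
    then have "\<forall>\<^sub>F x in nhds y0. g x - ?\<phi> x \<le> g y0 - ?\<phi> y0" by (intro always_eventually allI)
    then have "H (q + grad ?\<phi> y0) + W y0 - b \<le> 0"
      using g(2) quadratic_test_function(1)[of "N / t" z0 0 z0]
      unfolding viscosity_subsolution_def by blast
    then show ?thesis unfolding quadratic_test_function(2) by simp
  qed
  let ?r = "(2 * N) *\<^sub>R (x0 - z0) + (2 * N) *\<^sub>R (y0 - z0)"
  have 3: "H ((1 - t) *\<^sub>R p + t *\<^sub>R q + ?r) + ((1 - t) * V z0 + t * W z0) - c \<ge> 0"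
  proof -
    let ?\<phi> = "\<lambda>x. - N * (norm (x - x0))\<^sup>2 + - N * (norm (x - y0))\<^sup>2"
    have "h x - ?\<phi> x \<ge> h z0 - ?\<phi> z0" for x
      using mx[of x0 y0 x] by (simp add: algebra_simps norm_minus_commute)
    then have "\<forall>\<^sub>F x in nhds z0. h x - ?\<phi> x \<ge> h z0 - ?\<phi> z0" by (intro always_eventually allI)
    then have "H ((1 - t) *\<^sub>R p + t *\<^sub>R q + grad ?\<phi> z0) + ((1 - t) * V z0 + t * W z0) - c \<ge> 0"
      using h(2) quadratic_test_function(1)[of "- N" x0 "- N" y0]
      unfolding viscosity_supersolution_def by blast
    moreover have "grad ?\<phi> z0 = ?r"
      unfolding quadratic_test_function(2) by (simp add: algebra_simps)
    ultimately show ?thesis by simp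
  qed
  have split: "(1 - t) *\<^sub>R p + t *\<^sub>R q + ?r = (1 - t) *\<^sub>R (p + (2 * (N / (1 - t))) *\<^sub>R (x0 - z0)) +
      t *\<^sub>R (q + (2 * (N / t)) *\<^sub>R (y0 - z0))"
    using t by (simp add: scaleR_add_right)
  have "H ((1 - t) *\<^sub>R p + t *\<^sub>R q + ?r) \<le> (1 - t) * H (p + (2 * (N / (1 - t))) *\<^sub>R (x0 - z0)) +
      t * H (q + (2 * (N / t)) *\<^sub>R (y0 - z0))"
    unfolding split using t by (intro convex_onD[OF H]) auto
  also have "\<dots> \<le> (1 - t) * (a - V x0) + t * (b - W y0)"
    using 1 2 t by (intro add_mono mult_left_mono) auto
  finally have "c \<le> (1 - t) * a + t * b + ((1 - t) * (V z0 - V x0) + t * (W z0 - W y0))"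
    using 3 by (simp add: algebra_simps)
  moreover have "(1 - t) * (V z0 - V x0) + t * (W z0 - W y0) \<le> (1 - t) * e + t * e"
    using VW t by (intro add_mono mult_left_mono) auto
  ultimately show "c \<le> (1 - t) * a + t * b + e" by (simp add: algebra_simps)
qed

lemma quadratic_hamiltonian_convex: "convex_on UNIV (quadratic_hamiltonian :: real ^ 'n \<Rightarrow> real)"
proof (rule convex_onI)
  fix t :: real and x y :: "real ^ 'n" assume t: "0 < t" "t < 1"
  have "(1 - t) * quadratic_hamiltonian x + t * quadratic_hamiltonian y
      - quadratic_hamiltonian ((1 - t) *\<^sub>R x + t *\<^sub>R y) = t * (1 - t) * quadratic_hamiltonian (x - y)"
    by (simp add: quadratic_hamiltonian_def power2_norm_eq_inner inner_add_left inner_add_right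
        inner_diff_left inner_diff_right inner_commute field_simps)
  moreover have "\<dots> \<ge> 0" using t by (simp add: quadratic_hamiltonian_def)
  ultimately show "quadratic_hamiltonian ((1 - t) *\<^sub>R x + t *\<^sub>R y)
      \<le> (1 - t) * quadratic_hamiltonian x + t * quadratic_hamiltonian y" by linarith
qed simp

text \<open>The Hamiltonian is homogeneous of degree two, so \<open>r * v\<close> solves the
  rescaled problem when \<open>v\<close> solves the given one; a test function \<open>\<phi>\<close>
  for \<open>r * v\<close> becomes \<open>\<phi> / r\<close> for \<open>v\<close>.\<close>

lemma cell_problem_rescale:
  fixes V :: "real ^ 'n \<Rightarrow> real"
  assumes "cell_problem_solvable quadratic_hamiltonian V p c" "r > 0"
  shows "cell_problem_solvable quadratic_hamiltonian (\<lambda>x. r\<^sup>2 * V x) (r *\<^sub>R p) (r\<^sup>2 * c)"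
proof -
  let ?H = "quadratic_hamiltonian :: real ^ 'n \<Rightarrow> real"
  obtain v where v: "lattice_periodic v" "viscosity_subsolution (\<lambda>x q. ?H (p + q) + V x - c) v"
    "viscosity_supersolution (\<lambda>x q. ?H (p + q) + V x - c) v"
    using assms(1) by (auto simp: cell_problem_solvable_def viscosity_solution_def)
  have scale: "C_k 1 (\<lambda>x. \<phi> x / r)" "grad \<phi> x = r *\<^sub>R grad (\<lambda>x. \<phi> x / r) x"
    if "C_k 1 \<phi>" for \<phi> :: "real ^ 'n \<Rightarrow> real" and x
  proof -
    have diff: "\<phi> differentiable (at x)" and cont: "continuous_on UNIV (\<lambda>x. grad \<phi> x)" for x
      using that by (auto simp: grad_def intro!: continuous_on_vec_lambda)
    have d: "((\<lambda>x. \<phi> x / r) has_derivative (\<lambda>h. ((1 / r) *\<^sub>R grad \<phi> x) \<bullet> h)) (at x)" for x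
      using has_derivative_mult_right[OF has_derivative_grad[OF diff], of "1 / r" x] by simp
    show "C_k 1 (\<lambda>x. \<phi> x / r)" by (rule C_k_1_I[OF d]) (intro continuous_intros cont)
    show "grad \<phi> x = r *\<^sub>R grad (\<lambda>x. \<phi> x / r) x" using grad_unique[OF d] assms(2) by simp
  qed
  have hom: "?H (r *\<^sub>R p + r *\<^sub>R q) + r\<^sup>2 * V x - r\<^sup>2 * c = r\<^sup>2 * (?H (p + q) + V x - c)" for q x
    by (simp add: quadratic_hamiltonian_def scaleR_add_right[symmetric] power_mult_distrib algebra_simps del: scaleR_add_right)
  have cont: "continuous_on UNIV (\<lambda>x. r * v x)"
    using v(2) by (auto simp: viscosity_subsolution_def intro!: continuous_intros)
  have touch: "(r * v x - \<phi> x \<le> r * v y - \<phi> y) = (v x - \<phi> x / r \<le> v y - \<phi> y / r)" for \<phi> x y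
  proof -
    have "r * v x - \<phi> x = r * (v x - \<phi> x / r)" for x
      using assms(2) by (simp add: right_diff_distrib)
    then show ?thesis using assms(2) by (simp only: mult_le_cancel_left_pos)
  qed
  have "viscosity_subsolution (\<lambda>x q. ?H (r *\<^sub>R p + q) + r\<^sup>2 * V x - r\<^sup>2 * c) (\<lambda>x. r * v x)"
    unfolding viscosity_subsolution_def
  proof (intro conjI cont allI impI)
    fix \<phi> x0 assume "C_k 1 \<phi> \<and> (\<forall>\<^sub>F x in nhds x0. r * v x - \<phi> x \<le> r * v x0 - \<phi> x0)"
    then have \<phi>: "C_k 1 \<phi>" "\<forall>\<^sub>F x in nhds x0. v x - \<phi> x / r \<le> v x0 - \<phi> x0 / r"
      unfolding touch by auto
    then have "?H (p + grad (\<lambda>x. \<phi> x / r) x0) + V x0 - c \<le> 0"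
      using v(2) scale(1)[OF \<phi>(1)] unfolding viscosity_subsolution_def by blast
    then show "?H (r *\<^sub>R p + grad \<phi> x0) + r\<^sup>2 * V x0 - r\<^sup>2 * c \<le> 0"
      unfolding scale(2)[OF \<phi>(1)] hom by (simp add: mult_nonneg_nonpos)
  qed
  moreover have "viscosity_supersolution (\<lambda>x q. ?H (r *\<^sub>R p + q) + r\<^sup>2 * V x - r\<^sup>2 * c) (\<lambda>x. r * v x)"
    unfolding viscosity_supersolution_def
  proof (intro conjI cont allI impI)
    fix \<phi> x0 assume "C_k 1 \<phi> \<and> (\<forall>\<^sub>F x in nhds x0. r * v x - \<phi> x \<ge> r * v x0 - \<phi> x0)"
    then have \<phi>: "C_k 1 \<phi>" "\<forall>\<^sub>F x in nhds x0. v x - \<phi> x / r \<ge> v x0 - \<phi> x0 / r"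
      unfolding touch by auto
    then have "?H (p + grad (\<lambda>x. \<phi> x / r) x0) + V x0 - c \<ge> 0"
      using v(3) scale(1)[OF \<phi>(1)] unfolding viscosity_supersolution_def by blast
    then show "?H (r *\<^sub>R p + grad \<phi> x0) + r\<^sup>2 * V x0 - r\<^sup>2 * c \<ge> 0"
      unfolding scale(2)[OF \<phi>(1)] hom by simp
  qed
  moreover have "lattice_periodic (\<lambda>x. r * v x)" using v(1) by (simp add: lattice_periodic_def)
  ultimately show ?thesis unfolding cell_problem_solvable_def viscosity_solution_def by blast
qed

section \<open>Subdifferentials\<close>

text \<open>A hyperplane separating \<open>(p, f p)\<close> from the strict epigraph is the graph of
  an affine minorant once it is not vertical.\<close>

lemma convex_subdifferential_nonempty:
  fixes f :: "real ^ 'n \<Rightarrow> real"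
  assumes f: "convex_on UNIV f"
  shows "subdifferential f p \<noteq> {}"
proof -
  let ?T = "{(x, r). f x < r}"
  have "convex ?T"
    unfolding convex_def
  proof (intro ballI allI impI)
    fix x y :: "(real ^ 'n) \<times> real" and u v :: real
    assume xy: "x \<in> ?T" "y \<in> ?T" and uv: "0 \<le> u" "0 \<le> v" "u + v = 1"
    have "f (u *\<^sub>R fst x + v *\<^sub>R fst y) \<le> u * f (fst x) + v * f (fst y)"
      using f uv by (auto simp: convex_on_def)
    also have "\<dots> < u * snd x + v * snd y"
    proof (cases "u = 0")
      case True
      then show ?thesis using xy uv by auto
    next
      case False
      then have "u * f (fst x) < u * snd x" using uv xy by auto
      moreover have "v * f (fst y) \<le> v * snd y" using uv xy by (auto intro!: mult_left_mono)
      ultimately show ?thesis by linarith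
    qed
    finally show "u *\<^sub>R x + v *\<^sub>R y \<in> ?T" by (auto simp: case_prod_beta)
  qed
  moreover have "(p, f p + 1) \<in> ?T" by simp
  then have "?T \<noteq> {}" by blast
  ultimately obtain a c where a: "a \<noteq> 0" "a \<bullet> (p, f p) \<le> c" "\<And>z. z \<in> ?T \<Longrightarrow> a \<bullet> z \<ge> c"
    using separating_hyperplane_sets[of "{(p, f p)}" ?T] by auto
  obtain u \<alpha> where u: "a = (u, \<alpha>)" by (cases a)
  have key: "u \<bullet> p + \<alpha> * f p \<le> u \<bullet> x + \<alpha> * r" if "f x < r" for x r
    using a(2) a(3)[of "(x, r)"] that by (simp add: u)
  have "\<alpha> \<ge> 0" using key[of p "f p + 1"] by (simp add: algebra_simps)
  \<comment> \<open>A vertical hyperplane would bound \<open>u \<bullet> x\<close> from below by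
    \<open>u \<bullet> p\<close> for all \<open>x\<close>, because \<open>f\<close> is finite
    everywhere; \<open>x = p - u\<close> violates this.\<close>
  have "\<alpha> \<noteq> 0"
  proof
    assume "\<alpha> = 0"
    then have "u \<bullet> p \<le> u \<bullet> (p - u)" using key[of "p - u" "f (p - u) + 1"] by simp
    then have "u \<bullet> u \<le> 0" by (simp add: inner_diff_right)
    then have "u \<bullet> u = 0" using inner_ge_zero[of u] by linarith
    then have "u = 0" by simp
    with \<open>\<alpha> = 0\<close> a(1) show False by (simp add: u zero_prod_def)
  qed
  with \<open>\<alpha> \<ge> 0\<close> have \<alpha>: "\<alpha> > 0" by simp
  have "f p + ((- 1 / \<alpha>) *\<^sub>R u) \<bullet> (x - p) \<le> f x" for x
  proof (rule field_le_epsilon)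
    fix e :: real assume "e > 0"
    then have "u \<bullet> p + \<alpha> * f p \<le> u \<bullet> x + \<alpha> * (f x + e)" by (intro key) simp
    then have "\<alpha> * (f p + ((- 1 / \<alpha>) *\<^sub>R u) \<bullet> (x - p)) \<le> \<alpha> * (f x + e)"
      using \<alpha> by (simp add: algebra_simps inner_diff_right)
    then show "f p + ((- 1 / \<alpha>) *\<^sub>R u) \<bullet> (x - p) \<le> f x + e" using \<alpha> by simp
  qed
  then show ?thesis unfolding subdifferential_def by blast
qed

text \<open>Testing \<open>q\<close> one unit along its own direction gives
  \<open>norm q \<le> f (p + sgn q) - f p\<close>, and \<open>f\<close> is bounded on the unit ball
  around \<open>p\<close>.\<close>

lemma convex_subdifferential_compact:
  fixes f :: "real ^ 'n \<Rightarrow> real"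
  assumes f: "convex_on UNIV f"
  shows "compact (subdifferential f p)"
proof -
  have "closed (subdifferential f p)"
  proof -
    have "subdifferential f p = (\<Inter>x. {q. q \<bullet> (x - p) \<le> f x - f p})"
      by (auto simp: subdifferential_def algebra_simps)
    then show ?thesis by (auto intro!: closed_INT closed_Collect_le continuous_intros)
  qed
  moreover have "bounded (subdifferential f p)"
  proof -
    have "continuous_on (cball p 1) f"
      using convex_on_continuous[OF open_UNIV f] continuous_on_subset by blast
    then have "bounded (f ` cball p 1)" by (intro compact_imp_bounded compact_continuous_image compact_cball)
    then obtain B where "\<forall>x\<in>cball p 1. \<bar>f x\<bar> \<le> B"
      by (auto simp: bounded_iff)
    then have B: "\<bar>f x\<bar> \<le> B" if "norm (x - p) \<le> 1" for x
      using that by (simp add: dist_norm norm_minus_commute)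
    have "norm q \<le> B - f p" if q: "q \<in> subdifferential f p" for q
    proof (cases "q = 0")
      case True
      then show ?thesis using B[of p] by simp
    next
      case False
      have "f (p + sgn q) \<ge> f p + q \<bullet> sgn q"
        using q unfolding subdifferential_def by (auto dest: spec[of _ "p + sgn q"])
      moreover have "q \<bullet> sgn q = norm q"
        using False by (simp add: sgn_div_norm power2_norm_eq_inner[symmetric] power2_eq_square)
      moreover have "f (p + sgn q) \<le> B" using B[of "p + sgn q"] False by (simp add: norm_sgn)
      ultimately show ?thesis by linarith
    qed
    then show ?thesis by (auto simp: bounded_iff)
  qed
  ultimately show ?thesis by (simp add: compact_eq_bounded_closed)
qed

lemma convex_subdifferential_attains_max:
  fixes f :: "real ^ 'n \<Rightarrow> real"
  assumes "convex_on UNIV f"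
  obtains q where "q \<in> subdifferential f p" "\<And>q'. q' \<in> subdifferential f p \<Longrightarrow> q' \<bullet> u \<le> q \<bullet> u"
proof -
  have "\<exists>q\<in>subdifferential f p. \<forall>q'\<in>subdifferential f p. q' \<bullet> u \<le> q \<bullet> u"
    by (intro continuous_attains_sup convex_subdifferential_compact convex_subdifferential_nonempty
        assms continuous_intros)
  then show thesis using that by blast
qed

lemma effective_quadratic_convex:
  fixes V :: "real ^ 'n \<Rightarrow> real"
  assumes V: "lattice_periodic V" "continuous_on UNIV V"
    and Hb: "effective_hamiltonian quadratic_hamiltonian V Hb"
  shows "convex_on UNIV Hb"
proof (rule convex_onI)
  fix t :: real and p q :: "real ^ 'n" assume t: "0 < t" "t < 1"
  have s: "cell_problem_solvable quadratic_hamiltonian V p (Hb p)" for p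
    using Hb by (simp add: effective_hamiltonian_def)
  have "(\<lambda>x. (1 - t) * V x + t * V x) = V" by (auto simp: algebra_simps)
  then show "Hb ((1 - t) *\<^sub>R p + t *\<^sub>R q) \<le> (1 - t) * Hb p + t * Hb q"
    using cell_problem_convex[OF quadratic_hamiltonian_convex t V V s s] s by simp
qed simp

text \<open>For \<open>y = sqrt (1 + h)\<close> the error is exactly
  \<open>- (y - 1)\<^sup>2 / 2\<close>, and \<open>h = (y - 1) * (y + 1)\<close> with
  \<open>y + 1 \<ge> 1\<close>.\<close>

lemma sqrt_second_order: "h \<ge> -1 \<Longrightarrow> \<bar>sqrt (1 + h) - 1 - h / 2\<bar> \<le> h\<^sup>2 / 2"
proof -
  assume h: "h \<ge> -1"
  define y where "y = sqrt (1 + h)"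
  have y: "y \<ge> 0" "h = y\<^sup>2 - 1" using h by (auto simp: y_def)
  have "y - 1 - h / 2 = - (y - 1)\<^sup>2 / 2" unfolding y(2) by (simp add: power2_eq_square field_simps)
  moreover have "(y - 1)\<^sup>2 \<le> h\<^sup>2"
  proof -
    have "h\<^sup>2 = (y - 1)\<^sup>2 * (y + 1)\<^sup>2" unfolding y(2) by (simp add: power2_eq_square algebra_simps)
    moreover have "1 \<le> (y + 1)\<^sup>2" using y(1) by (simp add: power2_eq_square algebra_simps)
    ultimately show ?thesis using mult_left_mono[of 1 "(y + 1)\<^sup>2" "(y - 1)\<^sup>2"] by simp
  qed
  ultimately show ?thesis by (simp add: y_def)
qed

text \<open>By homogeneity, \<open>s * Hb (P / sqrt s)\<close> is the effective Hamiltonian of the potential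
  \<open>s V\<close> at \<open>P\<close>, hence convex in \<open>s\<close>. A subgradient \<open>q\<close> of \<open>Hb\<close> at \<open>P\<close> induces the subgradient
  \<open>Hb P - q \<bullet> P / 2\<close> of this function at \<open>s = 1\<close>.\<close>

lemma coupling_subgradient:
  fixes V :: "real ^ 'n \<Rightarrow> real"
  assumes V: "lattice_periodic V" "continuous_on UNIV V"
    and Hb: "effective_hamiltonian quadratic_hamiltonian V Hb"
    and q: "q \<in> subdifferential Hb P" and s: "s > 0"
  shows "(s - 1) * (Hb P - q \<bullet> P / 2) \<le> s * Hb ((1 / sqrt s) *\<^sub>R P) - Hb P"
proof -
  let ?H = "quadratic_hamiltonian :: real ^ 'n \<Rightarrow> real"
  define F where "F u = u * Hb ((1 / sqrt u) *\<^sub>R P)" for u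
  have F: "cell_problem_solvable ?H (\<lambda>x. u * V x) P (F u)" if "u > 0" for u
  proof -
    have "cell_problem_solvable ?H V ((1 / sqrt u) *\<^sub>R P) (Hb ((1 / sqrt u) *\<^sub>R P))"
      using Hb by (simp add: effective_hamiltonian_def)
    from cell_problem_rescale[OF this, of "sqrt u"] that show ?thesis by (simp add: F_def)
  qed
  define h where "h = s - 1"
  define A where "A = Hb P - q \<bullet> P / 2"
  define E where "E = \<bar>q \<bullet> P\<bar> * h\<^sup>2 / 2"
  \<comment> \<open>Convexity compares the chord up to \<open>s\<close> with the chord up to
    \<open>1 + t * h\<close>. On the latter the subgradient inequality for \<open>Hb\<close> and the
    expansion of the square root lose only \<open>t * (t * E)\<close>, so after division by
    \<open>t\<close> the loss \<open>t * E\<close> vanishes with \<open>t\<close>.\<close>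
  have main: "h * A - t * E \<le> F s - F 1" if t: "0 < t" "t < 1" for t
  proof -
    let ?u = "(1 - t) * 1 + t * s"
    have u: "?u = 1 + t * h" by (simp add: h_def algebra_simps)
    have "?u > 0" using t s by (intro add_pos_pos) auto
    have "F ?u \<le> (1 - t) * F 1 + t * F s"
    proof (rule cell_problem_convex[OF quadratic_hamiltonian_convex t])
      show "cell_problem_solvable ?H (\<lambda>x. 1 * V x) P (F 1)" "cell_problem_solvable ?H (\<lambda>x. s * V x) P (F s)"
        using F[of 1] F[OF s] by simp_all
      have "(\<lambda>x. (1 - t) * (1 * V x) + t * (s * V x)) = (\<lambda>x. ?u * V x)"
        by (auto simp: algebra_simps)
      moreover have "(1 - t) *\<^sub>R P + t *\<^sub>R P = P" by (simp add: algebra_simps)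
      ultimately show "cell_problem_solvable ?H (\<lambda>x. (1 - t) * (1 * V x) + t * (s * V x))
          ((1 - t) *\<^sub>R P + t *\<^sub>R P) (F ?u)"
        using F[OF \<open>?u > 0\<close>] by simp
    qed (use V in \<open>auto simp: lattice_periodic_def intro!: continuous_intros\<close>)
    then have "F ?u - F 1 \<le> t * (F s - F 1)" by (simp add: algebra_simps)
    moreover have "F ?u \<ge> ?u * Hb P + (q \<bullet> P) * (sqrt ?u - ?u)"
    proof -
      have "Hb ((1 / sqrt ?u) *\<^sub>R P) \<ge> Hb P + q \<bullet> ((1 / sqrt ?u) *\<^sub>R P - P)"
        using q by (simp only: subdifferential_def mem_Collect_eq)
      then have "?u * Hb ((1 / sqrt ?u) *\<^sub>R P) \<ge> ?u * (Hb P + q \<bullet> ((1 / sqrt ?u) *\<^sub>R P - P))"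
        using \<open>?u > 0\<close> by (intro mult_left_mono) auto
      moreover have "?u * (Hb P + q \<bullet> ((1 / sqrt ?u) *\<^sub>R P - P)) = ?u * Hb P + (q \<bullet> P) * (?u / sqrt ?u - ?u)"
        by (simp add: inner_diff_right algebra_simps)
      moreover have "?u / sqrt ?u = sqrt ?u" using \<open>?u > 0\<close> by (simp add: real_div_sqrt)
      ultimately show ?thesis by (simp add: F_def)
    qed
    moreover have "F 1 = Hb P" by (simp add: F_def)
    moreover have "(q \<bullet> P) * (sqrt ?u - ?u) \<ge> - (q \<bullet> P) * (t * h / 2) - t * (t * E)"
    proof -
      have "\<bar>sqrt (1 + t * h) - 1 - t * h / 2\<bar> \<le> (t * h)\<^sup>2 / 2"
        by (rule sqrt_second_order) (use \<open>?u > 0\<close> u in linarith)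
      then have "\<bar>q \<bullet> P\<bar> * \<bar>sqrt (1 + t * h) - 1 - t * h / 2\<bar> \<le> \<bar>q \<bullet> P\<bar> * ((t * h)\<^sup>2 / 2)"
        by (intro mult_left_mono) auto
      then have "\<bar>(q \<bullet> P) * (sqrt (1 + t * h) - 1 - t * h / 2)\<bar> \<le> t * (t * E)"
        by (simp add: abs_mult E_def power_mult_distrib power2_eq_square mult_ac)
      then show ?thesis unfolding u by (simp add: abs_le_iff algebra_simps)
    qed
    ultimately have "t * (h * A - t * E) \<le> t * (F s - F 1)"
      unfolding u A_def by (simp add: algebra_simps)
    then show ?thesis using t by simp
  qed
  have "h * A \<le> F s - F 1"
  proof (rule field_le_epsilon)
    fix e :: real assume e: "e > 0"
    have "E \<ge> 0" by (simp add: E_def)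
    define t where "t = min (1 / 2) (e / (E + 1))"
    have t: "0 < t" "t < 1" using e \<open>E \<ge> 0\<close> by (auto simp: t_def)
    have "t * E \<le> e / (E + 1) * (E + 1)"
      using \<open>E \<ge> 0\<close> e by (intro mult_mono) (auto simp: t_def)
    then have "t * E \<le> e" using \<open>E \<ge> 0\<close> by simp
    then show "h * A \<le> F s - F 1 + e" using main[OF t] by linarith
  qed
  then show ?thesis by (simp add: h_def A_def F_def)
qed

text \<open>The coupling inequality at \<open>s = 1 / 2\<close> and \<open>s = 3 / 2\<close>
  encloses \<open>Hb P - q \<bullet> P / 2\<close>, for \<open>P = l *\<^sub>R Q\<close>, between
  two quantities with the same limit, the mean of \<open>V\<close>.\<close>

lemma effective_quadratic_subgradient_asymptotics:
  fixes V :: "real ^ 'n \<Rightarrow> real"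
  assumes Q: "irrational_vector Q" and V: "lattice_periodic V" "continuous_on UNIV V"
    and Hb: "effective_hamiltonian quadratic_hamiltonian V Hb"
    and q: "\<And>l. l > 0 \<Longrightarrow> q l \<in> subdifferential Hb (l *\<^sub>R Q)"
  shows "((\<lambda>l. l\<^sup>2 * (norm Q)\<^sup>2 - q l \<bullet> (l *\<^sub>R Q)) \<longlongrightarrow> 0) at_top"
proof -
  define M where "M = torus_integral V"
  define f where "f l = Hb (l *\<^sub>R Q) - 1 / 2 * l\<^sup>2 * (norm Q)\<^sup>2" for l
  have f: "(f \<longlongrightarrow> M) at_top"
    using effective_quadratic_asymptotics[OF Q V Hb] by (simp add: f_def[abs_def] M_def)
  define D where "D s l = s * Hb ((1 / sqrt s) *\<^sub>R l *\<^sub>R Q) - Hb (l *\<^sub>R Q)" for s l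
  have D: "(D s \<longlongrightarrow> s * M - M) at_top" if "s > 0" for s
  proof -
    have "filterlim (\<lambda>l. (1 / sqrt s) * l) at_top at_top"
      using that by (intro filterlim_tendsto_pos_mult_at_top[OF tendsto_const]) (auto intro: filterlim_ident)
    then have "((\<lambda>l. s * f ((1 / sqrt s) * l) - f l) \<longlongrightarrow> s * M - M) at_top"
      by (intro tendsto_diff tendsto_mult tendsto_const f filterlim_compose[OF f])
    \<comment> \<open>The terms of order \<open>l\<^sup>2\<close> cancel, since
      \<open>s * (l / sqrt s)\<^sup>2 = l\<^sup>2\<close>.\<close>
    moreover have "(\<lambda>l. s * f ((1 / sqrt s) * l) - f l) = D s"
      using that by (auto simp: f_def D_def fun_eq_iff power_divide field_simps)
    ultimately show ?thesis by simp
  qed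
  define A where "A l = Hb (l *\<^sub>R Q) - q l \<bullet> (l *\<^sub>R Q) / 2" for l
  have bounds: "- 2 * D (1 / 2) l \<le> A l" "A l \<le> 2 * D (3 / 2) l" if "l > 0" for l
  proof -
    have "(1 / 2 - 1) * A l \<le> D (1 / 2) l" "(3 / 2 - 1) * A l \<le> D (3 / 2) l"
      unfolding A_def D_def by (rule coupling_subgradient[OF V Hb q[OF that]]; simp)+
    then show "- 2 * D (1 / 2) l \<le> A l" "A l \<le> 2 * D (3 / 2) l" by simp_all
  qed
  have "(A \<longlongrightarrow> M) at_top"
  proof (rule tendsto_sandwich)
    show "\<forall>\<^sub>F l in at_top. - 2 * D (1 / 2) l \<le> A l" "\<forall>\<^sub>F l in at_top. A l \<le> 2 * D (3 / 2) l"
      by (rule eventually_mono[OF eventually_gt_at_top[of 0] bounds(1)] eventually_mono[OF eventually_gt_at_top[of 0] bounds(2)]; assumption)+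
    show "((\<lambda>l. - 2 * D (1 / 2) l) \<longlongrightarrow> M) at_top"
      using tendsto_mult[OF tendsto_const D[of "1 / 2"], of "- 2"] by simp
    show "((\<lambda>l. 2 * D (3 / 2) l) \<longlongrightarrow> M) at_top"
      using tendsto_mult[OF tendsto_const D[of "3 / 2"], of "2"] by simp
  qed
  then have "((\<lambda>l. 2 * (A l - f l)) \<longlongrightarrow> 2 * (M - M)) at_top"
    by (intro tendsto_intros f)
  moreover have "(\<lambda>l. 2 * (A l - f l)) = (\<lambda>l. l\<^sup>2 * (norm Q)\<^sup>2 - q l \<bullet> (l *\<^sub>R Q))"
    by (auto simp: A_def f_def)
  ultimately show ?thesis by simp
qed

section \<open>Expansion near a resonant direction\<close>

text \<open>The span is real: if \<open>k0\<close> is not primitive, its lattice fractions are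
  included, so the value depends only on the line of \<open>k0\<close>. Frequency 0 is included too,
  so that this is the mean square of the part of \<open>V\<close> with frequencies on the
  line.\<close>

definition line_energy :: "real ^ 'n \<Rightarrow> (real ^ 'n \<Rightarrow> real) \<Rightarrow> real" where
  "line_energy k0 V = (\<Sum>\<^sub>\<infinity>k\<in>int_lattice \<inter> span {k0}. (cmod (fourier_coeff V k))\<^sup>2)"

lemma fourier_coeff_summable:
  fixes V :: "real ^ 'n \<Rightarrow> real"
  assumes "lattice_periodic V" "continuous_on UNIV V" "A \<subseteq> int_lattice"
  shows "(\<lambda>k. (cmod (fourier_coeff V k))\<^sup>2) summable_on A"
  using has_sum_imp_summable[OF parseval_torus[OF assms(1,2)]] assms(3) by (rule summable_on_subset_banach)

lemma line_energy_le_integral: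
  fixes V :: "real ^ 'n \<Rightarrow> real"
  assumes V: "lattice_periodic V" "continuous_on UNIV V"
  shows "line_energy k0 V \<le> torus_integral (\<lambda>x. (V x)\<^sup>2)"
proof -
  have "line_energy k0 V \<le> (\<Sum>\<^sub>\<infinity>k\<in>int_lattice. (cmod (fourier_coeff V k))\<^sup>2)"
    unfolding line_energy_def
    by (intro infsum_mono_neutral fourier_coeff_summable V) auto
  also have "\<dots> = torus_integral (\<lambda>x. (V x)\<^sup>2)"
    by (rule infsumI[OF parseval_torus[OF V]])
  finally show ?thesis .
qed

lemma torus_integral_square_le:
  fixes f :: "real ^ 'n \<Rightarrow> real"
  assumes "continuous_on UNIV f" "\<And>x. \<bar>f x\<bar> \<le> B"
  shows "torus_integral (\<lambda>x. (f x)\<^sup>2) \<le> B\<^sup>2"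
proof -
  have "torus_integral (\<lambda>x. (f x)\<^sup>2) \<le> torus_integral (\<lambda>x :: real ^ 'n. B\<^sup>2)"
    by (intro torus_integral_mono continuous_intros assms(1))
       (metis assms(2) abs_ge_zero power2_abs power_mono)
  then show ?thesis by (simp add: torus_integral_const)
qed

lemma square_add_le_weighted:
  fixes x y e :: real
  assumes "e > 0"
  shows "(x + y)\<^sup>2 \<le> (1 + e) * x\<^sup>2 + (1 + 1 / e) * y\<^sup>2"
proof -
  have "0 \<le> (e * x - y)\<^sup>2 / e" using assms by simp
  then have "2 * x * y \<le> e * x\<^sup>2 + y\<^sup>2 / e"
    using assms by (simp add: power2_diff field_simps power2_eq_square)
  then show ?thesis by (simp add: power2_sum algebra_simps)
qed

text \<open>With weight \<open>e\<close> in the inequality for squares, the loss is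
  \<open>e * B\<^sup>2\<close> from the energy of \<open>f\<close> plus
  \<open>(1 + 1 / e) * e\<^sup>2 = e\<^sup>2 + e\<close> from that of the difference, and
  \<open>e \<le> 1\<close>.\<close>

lemma line_energy_continuous:
  fixes f g :: "real ^ 'n \<Rightarrow> real"
  assumes f: "lattice_periodic f" "continuous_on UNIV f" and g: "lattice_periodic g" "continuous_on UNIV g"
    and B: "\<And>x. \<bar>f x\<bar> \<le> B" and e: "0 < e" "e \<le> 1" and fg: "\<And>x. \<bar>f x - g x\<bar> \<le> e"
  shows "line_energy k0 g \<le> line_energy k0 f + (B\<^sup>2 + 2) * e"
proof -
  let ?L = "int_lattice \<inter> span {k0}" and ?h = "\<lambda>x. g x - f x"
  have h: "lattice_periodic ?h" "continuous_on UNIV ?h"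
    using f g by (auto simp: lattice_periodic_def intro!: continuous_intros)
  have hfg: "\<bar>g x - f x\<bar> \<le> e" for x using fg[of x] by (simp add: abs_minus_commute)
  have sm: "(\<lambda>k. (cmod (fourier_coeff V k))\<^sup>2) summable_on ?L"
    if "lattice_periodic V" "continuous_on UNIV V" for V :: "real ^ 'n \<Rightarrow> real"
    by (intro fourier_coeff_summable that) auto
  have "line_energy k0 g \<le> (\<Sum>\<^sub>\<infinity>k\<in>?L. (1 + e) * (cmod (fourier_coeff f k))\<^sup>2 + (1 + 1 / e) * (cmod (fourier_coeff ?h k))\<^sup>2)"
    unfolding line_energy_def
  proof (intro infsum_mono summable_on_add summable_on_cmult_right sm f g h)
    fix k
    have "cmod (fourier_coeff g k) \<le> cmod (fourier_coeff f k) + cmod (fourier_coeff ?h k)"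
      unfolding fourier_coeff_diff[OF g(2) f(2)] by (metis add_diff_cancel_left' diff_add_cancel norm_triangle_ineq add.commute)
    then have "(cmod (fourier_coeff g k))\<^sup>2 \<le> (cmod (fourier_coeff f k) + cmod (fourier_coeff ?h k))\<^sup>2"
      by (intro power_mono) auto
    also have "\<dots> \<le> (1 + e) * (cmod (fourier_coeff f k))\<^sup>2 + (1 + 1 / e) * (cmod (fourier_coeff ?h k))\<^sup>2"
      by (rule square_add_le_weighted[OF e(1)])
    finally show "(cmod (fourier_coeff g k))\<^sup>2 \<le> \<dots>" .
  qed
  also have "\<dots> = (1 + e) * line_energy k0 f + (1 + 1 / e) * line_energy k0 ?h"
    unfolding line_energy_def
    by (subst infsum_add) (auto intro!: summable_on_cmult_right sm f h simp: infsum_cmult_right sm f h)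
  also have "\<dots> \<le> line_energy k0 f + e * B\<^sup>2 + (1 + 1 / e) * e\<^sup>2"
  proof -
    have "line_energy k0 f \<le> B\<^sup>2"
      using line_energy_le_integral[OF f] torus_integral_square_le[OF f(2) B] by (rule order_trans)
    then have "e * line_energy k0 f \<le> e * B\<^sup>2" using e by (intro mult_left_mono) auto
    moreover have "line_energy k0 ?h \<le> e\<^sup>2"
      using line_energy_le_integral[OF h] torus_integral_square_le[OF h(2) hfg] by (rule order_trans)
    then have "(1 + 1 / e) * line_energy k0 ?h \<le> (1 + 1 / e) * e\<^sup>2"
      using e by (intro mult_left_mono) auto
    ultimately show ?thesis by (simp add: algebra_simps)
  qed
  also have "(1 + 1 / e) * e\<^sup>2 = e\<^sup>2 + e" using e by (simp add: field_simps power2_eq_square)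
  also have "line_energy k0 f + e * B\<^sup>2 + (e\<^sup>2 + e) \<le> line_energy k0 f + (B\<^sup>2 + 2) * e"
    using mult_left_mono[OF e(2), of e] e by (simp add: algebra_simps power2_eq_square)
  finally show ?thesis .
qed

lemma in_span_singleton:
  fixes g k0 :: "real ^ 'n"
  assumes "g \<in> span {k0}" "k0 \<noteq> 0"
  shows "g = ((k0 \<bullet> g) / (k0 \<bullet> k0)) *\<^sub>R k0" "norm g = \<bar>k0 \<bullet> g\<bar> / norm k0"
proof -
  obtain c where c: "g = c *\<^sub>R k0" using assms(1) by (auto simp: span_singleton)
  show "g = ((k0 \<bullet> g) / (k0 \<bullet> k0)) *\<^sub>R k0" using assms(2) by (simp add: c)
  show "norm g = \<bar>k0 \<bullet> g\<bar> / norm k0"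
    using assms(2) by (simp add: c abs_mult power2_norm_eq_inner[symmetric] power2_eq_square)
qed

text \<open>At momentum \<open>l Q0 + s k0\<close> the fast direction \<open>Q0\<close> averages the potential to its part \<open>w\<close>
  with frequencies in the line of \<open>k0\<close>, as \<open>l\<close> tends to infinity; the remaining problem in the
  direction \<open>k0\<close> is expanded to second order in \<open>1 / s\<close>.\<close>

lemma resonant_expansion:
  fixes V f :: "real ^ 'n \<Rightarrow> real"
  assumes k0: "k0 \<in> int_lattice" "k0 \<noteq> 0" and Q0: "Q0 \<bullet> k0 = 0"
    and res: "\<And>k. k \<in> int_lattice \<Longrightarrow> Q0 \<bullet> k = 0 \<Longrightarrow> k \<in> span {k0}"
    and f: "f \<in> trig_poly int_lattice" "\<And>x. \<bar>f x\<bar> \<le> B" and Vf: "\<And>x. \<bar>V x - f x\<bar> \<le> e"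
    and e: "e > 0" and s: "s \<ge> 1"
    and Hb: "effective_hamiltonian quadratic_hamiltonian V Hb"
  defines "a \<equiv> 2 * B / norm k0" and "b \<equiv> (2 * B / norm k0)\<^sup>2 / norm k0"
    and "m \<equiv> torus_integral f"
  shows "\<forall>\<^sub>F l in at_top. \<bar>Hb (l *\<^sub>R Q0 + s *\<^sub>R k0) - (quadratic_hamiltonian (l *\<^sub>R Q0 + s *\<^sub>R k0)
     + m + (line_energy k0 f - m\<^sup>2) / (2 * (norm k0)\<^sup>2 * s\<^sup>2))\<bar> \<le> 2 * e + (a * b + b\<^sup>2 / 2) / s ^ 4"
proof -
  let ?S = "int_lattice \<inter> {k. Q0 \<bullet> k = 0}"
  let ?\<kappa> = "(norm k0)\<^sup>2"
  have S: "?S = int_lattice \<inter> span {k0}" using res Q0 by (auto simp: span_singleton)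
  have \<kappa>: "?\<kappa> > 0" "k0 \<bullet> k0 = ?\<kappa>" using k0 by (auto simp: power2_norm_eq_inner)
  \<comment> \<open>On the line of \<open>k0\<close> only 0 is orthogonal to \<open>k0\<close>, so
    averaging along \<open>k0\<close> leaves constants.\<close>
  have S0: "?S \<inter> {k. k0 \<bullet> k = 0} = {0}"
    unfolding S using k0 by (auto simp: span_singleton)
  have "B \<ge> 0" using f(2)[of 0] by linarith
  then have ab: "a \<ge> 0" "b \<ge> 0" by (auto simp: a_def b_def)
  note fc = trig_poly_continuous[OF f(1)]
  obtain v w where v: "v \<in> trig_poly int_lattice" and w: "w \<in> trig_poly ?S"
    and v_eq: "\<And>x. Q0 \<bullet> grad v x + f x = w x" and w_le: "\<And>x. \<bar>w x\<bar> \<le> B"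
    and fw: "\<And>k. k \<in> int_lattice \<Longrightarrow> fourier_coeff w k = (if Q0 \<bullet> k = 0 then fourier_coeff f k else 0)"
    using trig_poly_resonant_part[OF f(1) order_refl f(2)] by metis
  note wc = trig_poly_continuous[OF w] and wp = trig_poly_periodic[OF w inf_le1]
  have mw: "torus_integral w = m"
  proof -
    have "complex_of_real (torus_integral w) = of_real (torus_integral f)"
      using fw[of 0] fourier_coeff_0[OF fc] fourier_coeff_0[OF wc] by simp
    then show ?thesis by (simp add: m_def)
  qed
  have energy: "line_energy k0 f = torus_integral (\<lambda>x. (w x)\<^sup>2)"
  proof -
    have "torus_integral (\<lambda>x. (w x)\<^sup>2) = (\<Sum>\<^sub>\<infinity>k\<in>int_lattice. (cmod (fourier_coeff w k))\<^sup>2)"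
      by (rule infsumI[OF parseval_torus[OF wp wc], symmetric])
    also have "\<dots> = line_energy k0 f"
      unfolding line_energy_def S[symmetric] by (rule infsum_cong_neutral) (auto simp: fw)
    finally show ?thesis by simp
  qed
  \<comment> \<open>First order: \<open>u1\<close> balances the oscillation of \<open>w\<close>
    against the momentum \<open>s *\<^sub>R k0\<close> and leaves the mean \<open>m\<close>.\<close>
  obtain u1 w1 where u1: "u1 \<in> trig_poly ?S" and w1: "w1 \<in> trig_poly (?S \<inter> {k. k0 \<bullet> k = 0})"
    and u1_eq: "\<And>x. k0 \<bullet> grad u1 x + w x = w1 x"
    and fw1: "\<And>k. k \<in> int_lattice \<Longrightarrow> fourier_coeff w1 k = (if k0 \<bullet> k = 0 then fourier_coeff w k else 0)"
    using trig_poly_resonant_part[OF w inf_le1 w_le, where Q = k0] by metis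
  obtain c1 where "w1 = (\<lambda>x. c1)" using trig_poly_zero_frequency w1 unfolding S0 by metis
  then have "complex_of_real c1 = of_real (torus_integral w)"
    using fw1[of 0] fourier_coeff_0[OF wc] fourier_coeff_0[of w1] by (simp add: torus_integral_const)
  then have u1_eq: "k0 \<bullet> grad u1 x = m - w x" for x
    using u1_eq[of x] \<open>w1 = _\<close> mw by simp
  have span: "grad u x \<in> span {k0}" if "u \<in> trig_poly ?S" for u x
  proof -
    have "span ?S \<subseteq> span {k0}" unfolding S by (intro span_minimal) auto
    then show ?thesis using trig_poly_grad_in_span[OF that] by blast
  qed
  have Q0_grad: "Q0 \<bullet> grad u x = 0" if "u \<in> trig_poly ?S" for u x
    using in_span_singleton(1)[OF span[OF that] k0(2)] Q0 by (metis inner_scaleR_right mult_zero_right)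
  have g1_norm: "norm (grad u1 x) = \<bar>m - w x\<bar> / norm k0" for x
    using in_span_singleton(2)[OF span[OF u1] k0(2)] u1_eq by simp
  have m_le: "\<bar>m\<bar> \<le> B"
  proof -
    have "\<bar>torus_integral w - torus_integral (\<lambda>x :: real ^ 'n. 0)\<bar> \<le> B"
      by (rule torus_integral_close[OF wc]) (use w_le in auto)
    then show ?thesis by (simp add: mw torus_integral_const)
  qed
  \<comment> \<open>\<open>f\<close> enters this bound through \<open>B\<close> alone, and likewise
    the bound \<open>b\<close> for \<open>grad u2 x\<close> below.\<close>
  have g1_le: "norm (grad u1 x) \<le> a" for x
    unfolding g1_norm a_def using m_le w_le[of x] by (intro divide_right_mono) auto
  \<comment> \<open>The kinetic energy of the first corrector is what remains at order
    \<open>1 / s\<^sup>2\<close>. As \<open>grad u1 x\<close> is parallel to \<open>k0\<close>, it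
    is a multiple of the square of \<open>m - w x\<close>, again a trigonometric polynomial on the
    line. Then \<open>u2\<close> removes its oscillation and leaves its mean, the variance of
    \<open>w\<close> divided by \<open>2 * (norm k0)\<^sup>2\<close>.\<close>
  define z where "z x = (norm (grad u1 x))\<^sup>2 / 2" for x
  have z_eq: "z = (\<lambda>x. (1 / (2 * ?\<kappa>)) * ((m - w x) * (m - w x)))"
    by (auto simp: z_def g1_norm fun_eq_iff power_divide power2_eq_square)
  have z: "z \<in> trig_poly ?S"
    unfolding z_eq
    by (intro trig_poly_cmult trig_poly_mult trig_poly_diff trig_poly_const w)
       (auto simp: inner_add_right inner_diff_right intro: int_lattice_add int_lattice_diff)
  note zc = trig_poly_continuous[OF z]
  have z_bd: "0 \<le> z x" "z x \<le> a\<^sup>2 / 2" for x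
    using g1_le[of x] by (auto simp: z_def intro!: power_mono)
  then have z_abs: "\<bar>z x\<bar> \<le> a\<^sup>2 / 2" for x by simp
  obtain u2 w2 where u2: "u2 \<in> trig_poly ?S" and w2: "w2 \<in> trig_poly (?S \<inter> {k. k0 \<bullet> k = 0})"
    and u2_eq: "\<And>x. k0 \<bullet> grad u2 x + z x = w2 x"
    and fw2: "\<And>k. k \<in> int_lattice \<Longrightarrow> fourier_coeff w2 k = (if k0 \<bullet> k = 0 then fourier_coeff z k else 0)"
    using trig_poly_resonant_part[OF z inf_le1 z_abs, where Q = k0] by metis
  obtain c2 where c2: "w2 = (\<lambda>x. c2)" using trig_poly_zero_frequency w2 unfolding S0 by metis
  then have "complex_of_real c2 = of_real (torus_integral z)"
    using fw2[of 0] fourier_coeff_0[OF zc] fourier_coeff_0[of w2] by (simp add: torus_integral_const)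
  then have c2_int: "c2 = torus_integral z" by simp
  have "torus_integral z = (line_energy k0 f - m\<^sup>2) / (2 * ?\<kappa>)"
  proof -
    have i: "((\<lambda>x. (1 / (2 * ?\<kappa>)) * ((w x)\<^sup>2 - 2 * m * w x + m\<^sup>2)) has_integral
      (1 / (2 * ?\<kappa>)) * (line_energy k0 f - 2 * m * m + torus_integral (\<lambda>x :: real ^ 'n. m\<^sup>2))) (cbox 0 1)"
      unfolding energy
      by (intro has_integral_mult_right has_integral_add has_integral_diff)
         (use mw torus_integral_has_integral[OF wc] in \<open>auto intro!: torus_integral_has_integral continuous_intros wc\<close>)
    moreover have "(\<lambda>x. (1 / (2 * ?\<kappa>)) * ((w x)\<^sup>2 - 2 * m * w x + m\<^sup>2)) = z"
      unfolding z_eq by (auto simp: power2_eq_square algebra_simps)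
    ultimately have "(z has_integral (1 / (2 * ?\<kappa>)) * (line_energy k0 f - 2 * m * m + m\<^sup>2)) (cbox 0 1)"
      by (simp add: torus_integral_const)
    then have "torus_integral z = (1 / (2 * ?\<kappa>)) * (line_energy k0 f - 2 * m * m + m\<^sup>2)"
      using torus_integral_has_integral[OF zc] has_integral_unique by blast
    then show ?thesis by (simp add: power2_eq_square)
  qed
  then have c2_eq: "c2 = (line_energy k0 f - m\<^sup>2) / (2 * ?\<kappa>)" using c2_int by simp
  have c2_bd: "0 \<le> c2" "c2 \<le> a\<^sup>2 / 2"
  proof -
    have "torus_integral (\<lambda>x :: real ^ 'n. 0) \<le> torus_integral z"
      "torus_integral z \<le> torus_integral (\<lambda>x :: real ^ 'n. a\<^sup>2 / 2)"
      by (intro torus_integral_mono zc continuous_intros z_bd)+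
    then show "0 \<le> c2" "c2 \<le> a\<^sup>2 / 2" by (simp_all add: c2_int torus_integral_const)
  qed
  have g2_le: "norm (grad u2 x) \<le> b" for x
  proof -
    have "k0 \<bullet> grad u2 x = c2 - z x" using u2_eq[of x] c2 by simp
    then have "norm (grad u2 x) = \<bar>c2 - z x\<bar> / norm k0"
      using in_span_singleton(2)[OF span[OF u2] k0(2), of x] by simp
    also have "\<dots> \<le> a\<^sup>2 / norm k0"
      using z_bd[of x] c2_bd by (intro divide_right_mono) auto
    finally show ?thesis by (simp add: a_def b_def)
  qed
  obtain G where G: "G > 0" "\<And>x. norm (grad v x) \<le> G"
    using trig_poly_grad_bounded[OF v order_refl] by blast
  \<comment> \<open>Collects the terms that carry a factor \<open>1 / l\<close>:
    \<open>grad v\<close> against \<open>s *\<^sub>R k0\<close>, against the gradients of the other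
    correctors, and its own square, where \<open>l \<ge> 1\<close> is used.\<close>
  define C where "C = s * norm k0 * G + (a + b) * G + G\<^sup>2 / 2"
  have "\<forall>\<^sub>F l in at_top. l \<ge> max 1 (C / e)" by (rule eventually_ge_at_top)
  then show ?thesis
  proof eventually_elim
    fix l :: real assume "l \<ge> max 1 (C / e)"
    then have l: "l \<ge> 1" "C / l \<le> e" using e by (auto simp: field_simps)
    let ?p = "l *\<^sub>R Q0 + s *\<^sub>R k0"
    \<comment> \<open>The powers match: against \<open>s *\<^sub>R k0\<close> the first two terms
      contribute at orders 1 and \<open>1 / s\<^sup>2\<close>, and the last contributes at order 1
      against \<open>l *\<^sub>R Q0\<close>.\<close>
    let ?\<phi> = "\<lambda>x. ((1 / s) * u1 x + (1 / s ^ 3) * u2 x) + (1 / l) * v x"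
    have S_sub: "u \<in> trig_poly int_lattice" if "u \<in> trig_poly ?S" for u
      using that by (rule trig_poly_mono) auto
    have t: "(\<lambda>x. (1 / s) * u1 x) \<in> trig_poly int_lattice" "(\<lambda>x. (1 / s ^ 3) * u2 x) \<in> trig_poly int_lattice"
      "(\<lambda>x. (1 / l) * v x) \<in> trig_poly int_lattice"
      by (intro trig_poly_cmult S_sub u1 u2 v)+
    note t12 = trig_poly.add[OF t(1,2)]
    have \<phi>: "?\<phi> \<in> trig_poly int_lattice" by (rule trig_poly.add[OF t12 t(3)])
    have bound: "\<bar>quadratic_hamiltonian (?p + grad ?\<phi> x) + V x - (quadratic_hamiltonian ?p + m + c2 / s\<^sup>2)\<bar>
        \<le> 2 * e + (a * b + b\<^sup>2 / 2) / s ^ 4" for x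
    proof -
      let ?g1 = "grad u1 x" and ?g2 = "grad u2 x" and ?g0 = "grad v x"
      let ?A = "(1 / s) *\<^sub>R ?g1 + (1 / s ^ 3) *\<^sub>R ?g2"
      let ?C = "(1 / l) *\<^sub>R ?g0"
      have grad: "grad ?\<phi> x = ?A + ?C"
        unfolding trig_poly_grad_add[OF t12 t(3)] trig_poly_grad_add[OF t(1,2)]
          trig_poly_grad_cmult[OF u1] trig_poly_grad_cmult[OF u2] trig_poly_grad_cmult[OF v] ..
      have lin: "?p \<bullet> (?A + ?C) = (k0 \<bullet> ?g1) + (k0 \<bullet> ?g2) / s\<^sup>2 + Q0 \<bullet> ?g0 + (s / l) * (k0 \<bullet> ?g0)"
        using s l Q0_grad[OF u1, of x] Q0_grad[OF u2, of x]
        by (simp add: inner_add_left inner_add_right power2_eq_square power3_eq_cube add_divide_distrib)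
      have qA: "quadratic_hamiltonian ?A = z x / s\<^sup>2 + ((?g1 \<bullet> ?g2) + (norm ?g2)\<^sup>2 / 2 / s\<^sup>2) / s ^ 4"
        unfolding quadratic_hamiltonian_def z_def power2_norm_eq_inner using s
        by (simp add: inner_add_left inner_add_right inner_commute field_simps power_numeral_reduce)
      define R1 where "R1 = ((?g1 \<bullet> ?g2) + (norm ?g2)\<^sup>2 / 2 / s\<^sup>2) / s ^ 4"
      define R2 where "R2 = (s / l) * (k0 \<bullet> ?g0) + ?A \<bullet> ?C + quadratic_hamiltonian ?C"
      have "quadratic_hamiltonian (?p + grad ?\<phi> x) + f x =
         quadratic_hamiltonian ?p + (Q0 \<bullet> ?g0 + f x) + (k0 \<bullet> ?g1) + (k0 \<bullet> ?g2 + z x) / s\<^sup>2 + R1 + R2"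
        unfolding grad quadratic_hamiltonian_add[of ?p] lin quadratic_hamiltonian_add[of ?A] qA
          R1_def R2_def by (simp add: add_divide_distrib)
      also have "\<dots> = quadratic_hamiltonian ?p + m + c2 / s\<^sup>2 + R1 + R2"
        using u2_eq[of x] by (simp add: v_eq u1_eq c2)
      finally have main: "quadratic_hamiltonian (?p + grad ?\<phi> x) + f x
        = quadratic_hamiltonian ?p + m + c2 / s\<^sup>2 + R1 + R2" .
      have "\<bar>R1\<bar> \<le> (a * b + b\<^sup>2 / 2) / s ^ 4"
      proof -
        have "\<bar>?g1 \<bullet> ?g2\<bar> \<le> a * b"
          using Cauchy_Schwarz_ineq2[of ?g1 ?g2] mult_mono[OF g1_le[of x] g2_le[of x]] ab by simp
        moreover have "(norm ?g2)\<^sup>2 / 2 / s\<^sup>2 \<le> b\<^sup>2 / 2"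
        proof -
          have "(norm ?g2)\<^sup>2 / 2 / s\<^sup>2 \<le> (norm ?g2)\<^sup>2 / 2 / 1"
            using s by (intro divide_left_mono) auto
          also have "\<dots> \<le> b\<^sup>2 / 2" using g2_le[of x] by (simp add: power_mono)
          finally show ?thesis .
        qed
        moreover have "(norm ?g2)\<^sup>2 / 2 / s\<^sup>2 \<ge> 0" by simp
        ultimately have "\<bar>(?g1 \<bullet> ?g2) + (norm ?g2)\<^sup>2 / 2 / s\<^sup>2\<bar> \<le> a * b + b\<^sup>2 / 2" by linarith
        then show ?thesis unfolding R1_def abs_divide using s by (simp add: divide_right_mono)
      qed
      moreover have "\<bar>R2\<bar> \<le> C / l"
      proof -
        have "\<bar>k0 \<bullet> ?g0\<bar> \<le> norm k0 * G"
          using Cauchy_Schwarz_ineq2[of k0 ?g0] G(2)[of x] by (meson mult_left_mono norm_ge_zero order_trans)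
        then have 1: "\<bar>(s / l) * (k0 \<bullet> ?g0)\<bar> \<le> s * norm k0 * G / l"
          using s l mult_left_mono[of "\<bar>k0 \<bullet> ?g0\<bar>" "norm k0 * G" "s / l"] by (simp add: abs_mult mult.assoc)
        have "norm ?A \<le> (1 / s) * norm ?g1 + (1 / s ^ 3) * norm ?g2"
          using s by (intro order_trans[OF norm_triangle_ineq]) simp
        also have "\<dots> \<le> 1 * a + 1 * b"
          using s g1_le[of x] g2_le[of x] by (intro add_mono mult_mono) auto
        finally have "norm ?A \<le> a + b" by simp
        moreover have nC: "norm ?C \<le> G / l" using G(2)[of x] l by (simp add: divide_right_mono)
        ultimately have 2: "\<bar>?A \<bullet> ?C\<bar> \<le> (a + b) * (G / l)"
          using Cauchy_Schwarz_ineq2[of ?A ?C] mult_mono[of "norm ?A" "a + b" "norm ?C" "G / l"] ab by fastforce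
        have "quadratic_hamiltonian ?C \<le> (G / l)\<^sup>2 / 2"
          using nC by (simp add: quadratic_hamiltonian_def power_mono del: norm_scaleR)
        also have "\<dots> \<le> G\<^sup>2 / 2 / l"
          using l mult_left_mono[of "1 / l" 1 "G\<^sup>2 / 2 / l"] by (simp add: power_divide power2_eq_square)
        finally have 3: "quadratic_hamiltonian ?C \<le> G\<^sup>2 / 2 / l" .
        have 4: "quadratic_hamiltonian ?C \<ge> 0" by (simp add: quadratic_hamiltonian_def)
        have "C / l = s * norm k0 * G / l + (a + b) * (G / l) + G\<^sup>2 / 2 / l"
          by (simp add: C_def add_divide_distrib)
        then show ?thesis unfolding R2_def using 1 2 3 4 by linarith
      qed
      \<comment> \<open>One \<open>e\<close> pays for replacing \<open>V\<close> by
        \<open>f\<close>, the other for \<open>R2\<close>.\<close>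
      ultimately show ?thesis using main Vf[of x] l(2) by linarith
    qed
    have "cell_problem_solvable quadratic_hamiltonian V ?p (Hb ?p)"
      using Hb by (simp add: effective_hamiltonian_def)
    from cell_problem_trig_estimate[OF this \<phi> bound]
    show "\<bar>Hb ?p - (quadratic_hamiltonian ?p + m + (line_energy k0 f - m\<^sup>2) / (2 * ?\<kappa> * s\<^sup>2))\<bar>
        \<le> 2 * e + (a * b + b\<^sup>2 / 2) / s ^ 4"
      by (simp add: c2_eq)
  qed
qed

text \<open>The two expansions share \<open>Hb\<close>, so at equal momentum their difference
  compares the energies with a coefficient of order \<open>1 / s\<^sup>2\<close>. Errors of order
  \<open>1 / s ^ 4\<close> thus leave an energy gap of order \<open>1 / s\<^sup>2\<close>, for every
  \<open>s \<ge> 1\<close>.\<close>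

lemma line_energy_eq:
  fixes V1 V2 :: "real ^ 'n \<Rightarrow> real"
  assumes V1: "lattice_periodic V1" "continuous_on UNIV V1" and V2: "lattice_periodic V2" "continuous_on UNIV V2"
    and Hb: "effective_hamiltonian quadratic_hamiltonian V1 Hb" "effective_hamiltonian quadratic_hamiltonian V2 Hb"
    and mean: "torus_integral V1 = torus_integral V2"
    and k0: "k0 \<in> int_lattice" "k0 \<noteq> 0"
  shows "line_energy k0 V1 = line_energy k0 V2"
proof -
  obtain Q :: "real ^ 'n" where Q: "irrational_vector Q" using irrational_vector_exists by blast
  \<comment> \<open>A multiple of the projection of \<open>Q\<close> orthogonal to
    \<open>k0\<close>, scaled to avoid denominators: \<open>Q0 \<bullet> k\<close> equals
    \<open>Q\<close> paired with the lattice vector \<open>(k0 \<bullet> k0) *\<^sub>R k - (k0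
    \<bullet> k) *\<^sub>R k0\<close>. If it is zero, irrationality makes this vector
    vanish.\<close>
  define Q0 where "Q0 = (k0 \<bullet> k0) *\<^sub>R Q - (Q \<bullet> k0) *\<^sub>R k0"
  have Q0: "Q0 \<bullet> k0 = 0" by (simp add: Q0_def inner_diff_left)
  have res: "k \<in> span {k0}" if k: "k \<in> int_lattice" "Q0 \<bullet> k = 0" for k
  proof -
    let ?k = "(k0 \<bullet> k0) *\<^sub>R k - (k0 \<bullet> k) *\<^sub>R k0"
    have "?k \<in> int_lattice"
      by (intro int_lattice_diff int_lattice_scale int_lattice_inner k k0)
    moreover have "Q \<bullet> ?k = 0"
      using k(2) by (simp add: Q0_def inner_diff_left inner_diff_right mult.commute)
    ultimately have "?k = 0" using Q unfolding irrational_vector_def by blast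
    then have "(1 / (k0 \<bullet> k0)) *\<^sub>R (k0 \<bullet> k0) *\<^sub>R k = (1 / (k0 \<bullet> k0)) *\<^sub>R (k0 \<bullet> k) *\<^sub>R k0"
      by simp
    then have "k = ((k0 \<bullet> k) / (k0 \<bullet> k0)) *\<^sub>R k0" using k0(2) by simp
    then show ?thesis by (metis span_base span_scale singletonI)
  qed
  obtain B1 where B1: "\<And>x. \<bar>V1 x\<bar> \<le> B1" using lattice_periodic_bounded[OF V1] by blast
  obtain B2 where B2: "\<And>x. \<bar>V2 x\<bar> \<le> B2" using lattice_periodic_bounded[OF V2] by blast
  \<comment> \<open>The summand 1 leaves room for approximations with error
    \<open>e \<le> 1\<close>, so that \<open>B\<close> also bounds them.\<close>
  define B where "B = max B1 B2 + 1"
  have B: "\<bar>V1 x\<bar> \<le> B - 1" "\<bar>V2 x\<bar> \<le> B - 1" for x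
    using B1[of x] B2[of x] by (auto simp: B_def)
  have "B \<ge> 1" using B(1)[of 0] by linarith
  define \<mu> where "\<mu> = torus_integral V1"
  define \<kappa> where "\<kappa> = (norm k0)\<^sup>2"
  have \<kappa>: "\<kappa> > 0" using k0 by (simp add: \<kappa>_def)
  define K where "K = (2 * B / norm k0) * ((2 * B / norm k0)\<^sup>2 / norm k0) + ((2 * B / norm k0)\<^sup>2 / norm k0)\<^sup>2 / 2"
  \<comment> \<open>\<open>2 * (B\<^sup>2 + 2)\<close> pays for replacing the two energies,
    \<open>4 * B\<close> for the squared means, and \<open>2 * \<kappa> * (6 + 2 * K)\<close> for
    the expansions: each has error \<open>(2 + K) * e\<close>, and the means \<open>m1\<close>,
    \<open>m2\<close> differ by up to \<open>2 * e\<close>.\<close>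
  define c where "c = 2 * (B\<^sup>2 + 2) + 4 * B + 2 * \<kappa> * (6 + 2 * K)"
  have bound: "\<bar>line_energy k0 V1 - line_energy k0 V2\<bar> \<le> c / s\<^sup>2" if s: "s \<ge> 1" for s
  proof -
    define e where "e = 1 / s ^ 4"
    have e: "0 < e" "e \<le> 1" using s by (auto simp: e_def)
    obtain f1 where f1: "f1 \<in> trig_poly int_lattice" "\<And>x. \<bar>V1 x - f1 x\<bar> \<le> e"
      using trig_poly_dense[OF V1 e(1)] by blast
    obtain f2 where f2: "f2 \<in> trig_poly int_lattice" "\<And>x. \<bar>V2 x - f2 x\<bar> \<le> e"
      using trig_poly_dense[OF V2 e(1)] by blast
    have fB: "\<bar>f1 x\<bar> \<le> B" "\<bar>f2 x\<bar> \<le> B" for x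
      using f1(2)[of x] f2(2)[of x] B[of x] e by auto
    note per = trig_poly_periodic[OF f1(1) order_refl] trig_poly_periodic[OF f2(1) order_refl]
    note cont = trig_poly_continuous[OF f1(1)] trig_poly_continuous[OF f2(1)]
    define m1 where "m1 = torus_integral f1"
    define m2 where "m2 = torus_integral f2"
    define E1 where "E1 = line_energy k0 f1"
    define E2 where "E2 = line_energy k0 f2"
    note exp1 = resonant_expansion[OF k0 Q0 res f1(1) fB(1) f1(2) e(1) s Hb(1), folded K_def m1_def E1_def]
    note exp2 = resonant_expansion[OF k0 Q0 res f2(1) fB(2) f2(2) e(1) s Hb(2), folded K_def m2_def E2_def]
    let ?X = "\<lambda>l. l *\<^sub>R Q0 + s *\<^sub>R k0"
    obtain l where l: "\<bar>Hb (?X l) - (quadratic_hamiltonian (?X l) + m1 + (E1 - m1\<^sup>2) / (2 * \<kappa> * s\<^sup>2))\<bar> \<le> 2 * e + K / s ^ 4"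
      "\<bar>Hb (?X l) - (quadratic_hamiltonian (?X l) + m2 + (E2 - m2\<^sup>2) / (2 * \<kappa> * s\<^sup>2))\<bar> \<le> 2 * e + K / s ^ 4"
      using eventually_happens'[OF trivial_limit_at_top_linorder eventually_conj[OF exp1 exp2]]
      unfolding \<kappa>_def by blast
    have m: "\<bar>\<mu> - m1\<bar> \<le> e" "\<bar>\<mu> - m2\<bar> \<le> e"
      unfolding \<mu>_def m1_def m2_def using torus_integral_close[OF V1(2) cont(1) f1(2)]
        torus_integral_close[OF V2(2) cont(2) f2(2)] by (simp_all add: mean)
    have mB: "\<bar>m1\<bar> \<le> B" "\<bar>m2\<bar> \<le> B"
      using torus_integral_close[OF cont(1), of "\<lambda>x. 0" B] torus_integral_close[OF cont(2), of "\<lambda>x. 0" B] fB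
      by (simp_all add: m1_def m2_def torus_integral_const)
    have sq: "\<bar>m1\<^sup>2 - m2\<^sup>2\<bar> \<le> 4 * B * e"
    proof -
      have "\<bar>m1\<^sup>2 - m2\<^sup>2\<bar> = \<bar>m1 + m2\<bar> * \<bar>m1 - m2\<bar>"
        by (simp add: abs_mult[symmetric] power2_eq_square algebra_simps)
      also have "\<dots> \<le> (2 * B) * (2 * e)" using m mB by (intro mult_mono) linarith+
      finally show ?thesis by simp
    qed
    have Kse: "K / s ^ 4 = K * e" by (simp add: e_def)
    define D where "D = (E1 - m1\<^sup>2) - (E2 - m2\<^sup>2)"
    have "D / (2 * \<kappa> * s\<^sup>2) = (E1 - m1\<^sup>2) / (2 * \<kappa> * s\<^sup>2) - (E2 - m2\<^sup>2) / (2 * \<kappa> * s\<^sup>2)"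
      by (simp add: D_def diff_divide_distrib)
    then have "\<bar>D / (2 * \<kappa> * s\<^sup>2)\<bar> \<le> 6 * e + 2 * (K * e)"
      using l m unfolding Kse by linarith
    then have "\<bar>D\<bar> \<le> (6 * e + 2 * (K * e)) * (2 * \<kappa> * s\<^sup>2)"
      using \<kappa> s by (simp add: abs_mult pos_divide_le_eq)
    also have "\<dots> = 2 * \<kappa> * (6 + 2 * K) * (e * s\<^sup>2)" by (simp add: algebra_simps)
    finally have D: "\<bar>D\<bar> \<le> 2 * \<kappa> * (6 + 2 * K) / s\<^sup>2"
      using s by (simp add: e_def power_numeral_reduce power2_eq_square)
    have "\<bar>f1 x - V1 x\<bar> \<le> e" "\<bar>f2 x - V2 x\<bar> \<le> e" for x
      using f1(2)[of x] f2(2)[of x] by (auto simp: abs_minus_commute)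
    moreover have "\<bar>V1 x\<bar> \<le> B" "\<bar>V2 x\<bar> \<le> B" for x using B[of x] by auto
    ultimately have E: "\<bar>line_energy k0 V1 - E1\<bar> \<le> (B\<^sup>2 + 2) * e" "\<bar>line_energy k0 V2 - E2\<bar> \<le> (B\<^sup>2 + 2) * e"
      using line_energy_continuous[OF V1 per(1) cont(1) _ e f1(2), of B k0]
        line_energy_continuous[OF per(1) cont(1) V1 fB(1) e, of k0]
        line_energy_continuous[OF V2 per(2) cont(2) _ e f2(2), of B k0]
        line_energy_continuous[OF per(2) cont(2) V2 fB(2) e, of k0]
      unfolding E1_def E2_def by (auto simp: abs_le_iff)
    have "\<bar>line_energy k0 V1 - line_energy k0 V2\<bar> \<le> \<bar>D\<bar> + (2 * (B\<^sup>2 + 2) + 4 * B) * e"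
    proof -
      have "(2 * (B\<^sup>2 + 2) + 4 * B) * e = 2 * ((B\<^sup>2 + 2) * e) + 4 * B * e"
        by (simp add: algebra_simps)
      then show ?thesis using E sq unfolding D_def by linarith
    qed
    also have "\<dots> \<le> 2 * \<kappa> * (6 + 2 * K) / s\<^sup>2 + (2 * (B\<^sup>2 + 2) + 4 * B) / s\<^sup>2"
    proof -
      have "s\<^sup>2 \<le> s ^ 4" using s by (intro power_increasing) auto
      then have "e \<le> 1 / s\<^sup>2" using s by (simp add: e_def frac_le)
      then have "(2 * (B\<^sup>2 + 2) + 4 * B) * e \<le> (2 * (B\<^sup>2 + 2) + 4 * B) * (1 / s\<^sup>2)"
        using \<open>B \<ge> 1\<close> by (intro mult_left_mono) auto
      then show ?thesis using D by simp
    qed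
    also have "\<dots> = c / s\<^sup>2" by (simp add: c_def add_divide_distrib)
    finally show ?thesis .
  qed
  have "((\<lambda>s::real. c / s\<^sup>2) \<longlongrightarrow> 0) at_top"
    by (intro tendsto_divide_0[OF tendsto_const] filterlim_at_top_imp_at_infinity
        filterlim_pow_at_top filterlim_ident) simp
  then have "\<bar>line_energy k0 V1 - line_energy k0 V2\<bar> \<le> 0"
    by (rule tendsto_lowerbound) (auto intro: eventually_mono[OF eventually_ge_at_top[of 1]] bound)
  then show ?thesis by simp
qed

text \<open>Distinct lines through the origin share only the frequency 0, whose energy is the
  squared mean. Once it is split off, the nonzero frequencies are partitioned into classes of equal
  span.\<close>

lemma torus_integral_square_eq:
  fixes V1 V2 :: "real ^ 'n \<Rightarrow> real"
  assumes V1: "lattice_periodic V1" "continuous_on UNIV V1" and V2: "lattice_periodic V2" "continuous_on UNIV V2"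
    and mean: "torus_integral V1 = torus_integral V2"
    and lines: "\<And>k0. k0 \<in> int_lattice \<Longrightarrow> k0 \<noteq> 0 \<Longrightarrow> line_energy k0 V1 = line_energy k0 V2"
  shows "torus_integral (\<lambda>x. (V1 x)\<^sup>2) = torus_integral (\<lambda>x. (V2 x)\<^sup>2)"
proof -
  let ?A = "int_lattice - {0} :: (real ^ 'n) set"
  define cls where "cls = (\<lambda>l. {k \<in> ?A. span {k} = l})"
  define N where "N V = (\<lambda>k. (cmod (fourier_coeff V k))\<^sup>2)" for V :: "real ^ 'n \<Rightarrow> real"
  have sm: "N V summable_on A" if "V = V1 \<or> V = V2" "A \<subseteq> int_lattice" for V A
    using fourier_coeff_summable[of V A] that V1 V2 by (auto simp: N_def)
  have split0: "infsum (N V) (insert 0 A) = (torus_integral V)\<^sup>2 + infsum (N V) A"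
    if V: "V = V1 \<or> V = V2" and A: "A \<subseteq> ?A" for V A
  proof -
    have "continuous_on UNIV V" using V V1 V2 by auto
    then have "N V 0 = (torus_integral V)\<^sup>2" by (simp add: N_def fourier_coeff_0)
    moreover have "infsum (N V) ({0} \<union> A) = infsum (N V) {0} + infsum (N V) A"
      using A by (intro infsum_Un_disjoint sm V) auto
    ultimately show ?thesis by simp
  qed
  have ins: "insert 0 ?A = int_lattice" by auto
  have total: "torus_integral (\<lambda>x. (V x)\<^sup>2) = (torus_integral V)\<^sup>2 + infsum (N V) ?A" if "V = V1 \<or> V = V2" for V
    using split0[OF that order_refl] infsumI[OF parseval_torus[of V]] that V1 V2 unfolding ins by (auto simp: N_def)
  have partition: "infsum (N V) ?A = (\<Sum>\<^sub>\<infinity>l\<in>(\<lambda>k. span {k}) ` ?A. infsum (N V) (cls l))" if V: "V = V1 \<or> V = V2" for V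
  proof -
    let ?h = "\<lambda>k :: real ^ 'n. (span {k}, k)"
    \<comment> \<open>Pairing each frequency with its line turns the partition into a dependent sum,
      which may be summed class by class.\<close>
    have im: "?h ` ?A = Sigma ((\<lambda>k. span {k}) ` ?A) cls" by (auto simp: cls_def)
    have inj: "inj_on ?h ?A" by (auto intro: inj_onI)
    have "N V = (N V \<circ> snd) \<circ> ?h" by auto
    then have "infsum (N V) ?A = infsum (N V \<circ> snd) (?h ` ?A)" "(N V \<circ> snd) summable_on (?h ` ?A)"
      using infsum_reindex[OF inj, of "N V \<circ> snd"] summable_on_reindex[OF inj, of "N V \<circ> snd"] sm[OF V] by auto
    then show ?thesis unfolding im by (simp add: infsum_Sigma_banach[symmetric])
  qed
  have "infsum (N V1) (cls l) = infsum (N V2) (cls l)" if l: "l \<in> (\<lambda>k. span {k}) ` ?A" for l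
  proof -
    obtain k0 where "k0 \<in> ?A" "l = span {k0}" using l by blast
    then have k0: "k0 \<in> int_lattice" "k0 \<noteq> 0" "l = span {k0}" by auto
    have fwd: "span {k} = span {k0}" if k: "k \<in> span {k0}" "k \<noteq> 0" for k
    proof -
      obtain c where c: "k = c *\<^sub>R k0" using k(1) by (auto simp: span_singleton)
      then have "k0 = (1 / c) *\<^sub>R k" using k(2) by simp
      then have "k0 \<in> span {k}" by (metis span_base span_scale singletonI)
      then show ?thesis using k(1) by (simp add: span_eq)
    qed
    have bwd: "k \<in> span {k0}" if "span {k} = span {k0}" for k
      using that span_base[of k "{k}"] by auto
    have "insert 0 (cls l) = int_lattice \<inter> span {k0}"
      unfolding cls_def k0(3) using fwd bwd span_zero[of "{k0}"] int_lattice_0 by blast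
    moreover have "cls l \<subseteq> ?A" by (auto simp: cls_def)
    ultimately have "(torus_integral V)\<^sup>2 + infsum (N V) (cls l) = line_energy k0 V" if "V = V1 \<or> V = V2" for V
      using split0[OF that, of "cls l"] by (simp only: line_energy_def N_def)
    from this[of V1] this[of V2] lines[OF k0(1,2)] mean show ?thesis by simp
  qed
  then have "infsum (N V1) ?A = infsum (N V2) ?A"
    unfolding partition[OF disjI1[OF refl]] partition[OF disjI2[OF refl]] by (rule infsum_cong)
  then show ?thesis by (simp add: total mean)
qed

section \<open>The three parts of the theorem\<close>

lemma smooth_hamiltonian_asymptotics:
  fixes V :: "real ^ 'n \<Rightarrow> real"
  assumes H: "C_k 2 H" "bdd_above (range (\<lambda>p. norm (hessian H p)))"
    and V: "C_inf_torus V" and Hb: "effective_hamiltonian H V Hb" and Q: "irrational_vector Q"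
    and P: "\<And>l. l > 0 \<Longrightarrow> grad H (l *\<^sub>R P l) = l *\<^sub>R Q"
  shows "((\<lambda>l. Hb (l *\<^sub>R P l) - H (l *\<^sub>R P l)) \<longlongrightarrow> torus_integral V) at_top"
proof -
  obtain K where K: "\<And>p h. \<bar>H (p + h) - H p - grad H p \<bullet> h\<bar> \<le> K * (norm h)\<^sup>2"
    using C2_quadratic_remainder[OF H] by blast
  show ?thesis
    by (rule effective_hamiltonian_asymptotics[OF Q C_inf_torusD[OF V] _ K P])
       (use Hb in \<open>auto simp: effective_hamiltonian_def\<close>)
qed

lemma momentum_exists:
  fixes H :: "real ^ 'n \<Rightarrow> real"
  assumes "C_k 2 H" "superlinear H"
  obtains P :: "real \<Rightarrow> real ^ 'n" where "\<And>l. l > 0 \<Longrightarrow> grad H (l *\<^sub>R P l) = l *\<^sub>R Q"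
proof -
  have "H differentiable (at x)" for x using assms(1) by (simp add: numeral_2_eq_2)
  then have "\<exists>p. grad H p = l *\<^sub>R Q" for l
    using superlinear_grad_surj[OF assms(2)] by metis
  then obtain p where p: "\<And>l. grad H (p l) = l *\<^sub>R Q" by metis
  show thesis by (rule that[of "\<lambda>l. (1 / l) *\<^sub>R p l"]) (simp add: p)
qed

text \<open>One irrational direction and one family of momenta serve both potentials, so both means
  are limits of the same function.\<close>

lemma effective_hamiltonian_determines_mean:
  fixes V1 V2 :: "real ^ 'n \<Rightarrow> real"
  assumes H: "C_k 2 H" "bdd_above (range (\<lambda>p. norm (hessian H p)))" "superlinear H"
    and V: "C_inf_torus V1" "C_inf_torus V2"
    and Hb: "effective_hamiltonian H V1 Hb" "effective_hamiltonian H V2 Hb"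
  shows "torus_integral V1 = torus_integral V2"
proof -
  obtain Q :: "real ^ 'n" where Q: "irrational_vector Q" using irrational_vector_exists by blast
  obtain P where P: "\<And>l. l > 0 \<Longrightarrow> grad H (l *\<^sub>R P l) = l *\<^sub>R Q"
    using momentum_exists[OF H(1,3)] by blast
  show ?thesis
    using tendsto_unique[OF trivial_limit_at_top_linorder
        smooth_hamiltonian_asymptotics[OF H(1,2) V(1) Hb(1) Q P]
        smooth_hamiltonian_asymptotics[OF H(1,2) V(2) Hb(2) Q P]] .
qed

lemma effective_quadratic_determines_mean:
  fixes V1 V2 :: "real ^ 'n \<Rightarrow> real"
  assumes V1: "lattice_periodic V1" "continuous_on UNIV V1" and V2: "lattice_periodic V2" "continuous_on UNIV V2"
    and Hb: "effective_hamiltonian quadratic_hamiltonian V1 Hb" "effective_hamiltonian quadratic_hamiltonian V2 Hb"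
  shows "torus_integral V1 = torus_integral V2"
proof -
  obtain Q :: "real ^ 'n" where Q: "irrational_vector Q" using irrational_vector_exists by blast
  show ?thesis
    using tendsto_unique[OF trivial_limit_at_top_linorder
        effective_quadratic_asymptotics[OF Q V1 Hb(1)] effective_quadratic_asymptotics[OF Q V2 Hb(2)]] .
qed

text \<open>The subgradient limit holds for every selection of subgradients, in particular for a
  maximizing one. That the maximum is attained gives the real-valued \<open>SUP\<close> its intended
  meaning.\<close>

lemma effective_quadratic_max_subgradient:
  fixes V :: "real ^ 'n \<Rightarrow> real"
  assumes V: "lattice_periodic V" "continuous_on UNIV V"
    and Hb: "effective_hamiltonian quadratic_hamiltonian V Hb" and Q: "irrational_vector Q"
  shows "\<exists>q\<in>subdifferential Hb p. \<forall>q'\<in>subdifferential Hb p. q' \<bullet> u \<le> q \<bullet> u"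
    and "((\<lambda>l. l\<^sup>2 * (norm Q)\<^sup>2 - (SUP q\<in>subdifferential Hb (l *\<^sub>R Q). q \<bullet> (l *\<^sub>R Q))) \<longlongrightarrow> 0) at_top"
proof -
  note conv = effective_quadratic_convex[OF V Hb]
  show "\<exists>q\<in>subdifferential Hb p. \<forall>q'\<in>subdifferential Hb p. q' \<bullet> u \<le> q \<bullet> u"
    using convex_subdifferential_attains_max[OF conv, of p u] by metis
  have "\<exists>q\<in>subdifferential Hb (l *\<^sub>R Q). \<forall>q'\<in>subdifferential Hb (l *\<^sub>R Q). q' \<bullet> (l *\<^sub>R Q) \<le> q \<bullet> (l *\<^sub>R Q)" for l
    using convex_subdifferential_attains_max[OF conv, of "l *\<^sub>R Q" "l *\<^sub>R Q"] by metis
  then obtain q where q: "\<And>l. q l \<in> subdifferential Hb (l *\<^sub>R Q)"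
    "\<And>l q'. q' \<in> subdifferential Hb (l *\<^sub>R Q) \<Longrightarrow> q' \<bullet> (l *\<^sub>R Q) \<le> q l \<bullet> (l *\<^sub>R Q)" by metis
  have "(SUP q\<in>subdifferential Hb (l *\<^sub>R Q). q \<bullet> (l *\<^sub>R Q)) = q l \<bullet> (l *\<^sub>R Q)" for l
    using q by (intro cSup_eq_maximum) auto
  then show "((\<lambda>l. l\<^sup>2 * (norm Q)\<^sup>2 - (SUP q\<in>subdifferential Hb (l *\<^sub>R Q). q \<bullet> (l *\<^sub>R Q))) \<longlongrightarrow> 0) at_top"
    using effective_quadratic_subgradient_asymptotics[OF Q V Hb q(1)] by simp
qed

theorem theorem1p2:
  fixes V :: "nat \<Rightarrow> real ^ 'n \<Rightarrow> real"
  assumes V_smooth: "\<forall>i\<in>{1, 2}. C_inf_torus (V i)"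
  shows
    "(\<forall>(H :: real ^ 'n \<Rightarrow> real) (Hb :: nat \<Rightarrow> real ^ 'n \<Rightarrow> real).
        C_k 2 H \<and> bdd_above (range (\<lambda>p. norm (hessian H p))) \<and> superlinear H \<and>
        (\<forall>i\<in>{1, 2}. effective_hamiltonian H (V i) (Hb i)) \<longrightarrow>
        (\<forall>i\<in>{1, 2}. \<forall>Q. diophantine Q \<longrightarrow>
           (\<exists>P :: real \<Rightarrow> real ^ 'n. \<forall>l>0. grad H (l *\<^sub>R P l) = l *\<^sub>R Q) \<and>
           (\<forall>P :: real \<Rightarrow> real ^ 'n. (\<forall>l>0. grad H (l *\<^sub>R P l) = l *\<^sub>R Q) \<longrightarrow>
              ((\<lambda>l. Hb i (l *\<^sub>R P l) - H (l *\<^sub>R P l)) \<longlongrightarrow> torus_integral (V i)) at_top)) \<and>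
        (Hb 1 = Hb 2 \<longrightarrow> torus_integral (V 1) = torus_integral (V 2))) \<and>
     (\<forall>Hb :: nat \<Rightarrow> real ^ 'n \<Rightarrow> real.
        (\<forall>i\<in>{1, 2}. effective_hamiltonian quadratic_hamiltonian (V i) (Hb i)) \<longrightarrow>
        (\<forall>i\<in>{1, 2}. \<forall>Q. irrational_vector Q \<longrightarrow>
           ((\<lambda>l. Hb i (l *\<^sub>R Q) - 1 / 2 * l\<^sup>2 * (norm Q)\<^sup>2) \<longlongrightarrow> torus_integral (V i)) at_top \<and>
           (\<forall>l>0. \<exists>q\<in>subdifferential (Hb i) (l *\<^sub>R Q).
              \<forall>q'\<in>subdifferential (Hb i) (l *\<^sub>R Q). q' \<bullet> (l *\<^sub>R Q) \<le> q \<bullet> (l *\<^sub>R Q)) \<and>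
           ((\<lambda>l. l\<^sup>2 * (norm Q)\<^sup>2
                 - (SUP q\<in>subdifferential (Hb i) (l *\<^sub>R Q). q \<bullet> (l *\<^sub>R Q))) \<longlongrightarrow> 0) at_top)) \<and>
     (\<forall>Hb :: nat \<Rightarrow> real ^ 'n \<Rightarrow> real.
        (\<forall>i\<in>{1, 2}. effective_hamiltonian quadratic_hamiltonian (V i) (Hb i)) \<and>
        (\<exists>\<tau>>0. (\<lambda>k. ((cmod (fourier_coeff (V 1) k))\<^sup>2 + (cmod (fourier_coeff (V 2) k))\<^sup>2)
                     * exp (norm k powr (real CARD('n) + \<tau>))) summable_on int_lattice) \<longrightarrow>
        (Hb 1 = Hb 2 \<longrightarrow>
           torus_integral (\<lambda>x. \<bar>V 1 x\<bar>\<^sup>2) = torus_integral (\<lambda>x. \<bar>V 2 x\<bar>\<^sup>2)))"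
proof (intro conjI allI impI)
  fix H :: "real ^ 'n \<Rightarrow> real" and Hb :: "nat \<Rightarrow> real ^ 'n \<Rightarrow> real"
  assume "C_k 2 H \<and> bdd_above (range (\<lambda>p. norm (hessian H p))) \<and> superlinear H \<and>
    (\<forall>i\<in>{1, 2}. effective_hamiltonian H (V i) (Hb i))"
  then have H: "C_k 2 H" "bdd_above (range (\<lambda>p. norm (hessian H p)))" "superlinear H"
    and Hb: "\<forall>i\<in>{1, 2}. effective_hamiltonian H (V i) (Hb i)" by auto
  show "\<forall>i\<in>{1, 2}. \<forall>Q. diophantine Q \<longrightarrow>
     (\<exists>P :: real \<Rightarrow> real ^ 'n. \<forall>l>0. grad H (l *\<^sub>R P l) = l *\<^sub>R Q) \<and>
     (\<forall>P :: real \<Rightarrow> real ^ 'n. (\<forall>l>0. grad H (l *\<^sub>R P l) = l *\<^sub>R Q) \<longrightarrow>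
        ((\<lambda>l. Hb i (l *\<^sub>R P l) - H (l *\<^sub>R P l)) \<longlongrightarrow> torus_integral (V i)) at_top)"
  proof (intro ballI allI impI conjI)
    fix Q :: "real ^ 'n"
    show "\<exists>P :: real \<Rightarrow> real ^ 'n. \<forall>l>0. grad H (l *\<^sub>R P l) = l *\<^sub>R Q"
      using momentum_exists[OF H(1,3)] by metis
  next
    fix i :: nat and Q and P :: "real \<Rightarrow> real ^ 'n"
    assume i: "i \<in> {1, 2}" and "diophantine Q" and P: "\<forall>l>0. grad H (l *\<^sub>R P l) = l *\<^sub>R Q"
    with Hb V_smooth show "((\<lambda>l. Hb i (l *\<^sub>R P l) - H (l *\<^sub>R P l)) \<longlongrightarrow> torus_integral (V i)) at_top"
      by (intro smooth_hamiltonian_asymptotics[OF H(1,2)] diophantine_irrational) blast+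
  qed
  assume "Hb 1 = Hb 2"
  then show "torus_integral (V 1) = torus_integral (V 2)"
    using Hb V_smooth by (intro effective_hamiltonian_determines_mean[OF H, where Hb = "Hb 1"]) auto
next
  fix Hb :: "nat \<Rightarrow> real ^ 'n \<Rightarrow> real"
  assume Hb: "\<forall>i\<in>{1, 2}. effective_hamiltonian quadratic_hamiltonian (V i) (Hb i)"
  show "\<forall>i\<in>{1, 2}. \<forall>Q. irrational_vector Q \<longrightarrow>
     ((\<lambda>l. Hb i (l *\<^sub>R Q) - 1 / 2 * l\<^sup>2 * (norm Q)\<^sup>2) \<longlongrightarrow> torus_integral (V i)) at_top \<and>
     (\<forall>l>0. \<exists>q\<in>subdifferential (Hb i) (l *\<^sub>R Q).
        \<forall>q'\<in>subdifferential (Hb i) (l *\<^sub>R Q). q' \<bullet> (l *\<^sub>R Q) \<le> q \<bullet> (l *\<^sub>R Q)) \<and>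
     ((\<lambda>l. l\<^sup>2 * (norm Q)\<^sup>2
           - (SUP q\<in>subdifferential (Hb i) (l *\<^sub>R Q). q \<bullet> (l *\<^sub>R Q))) \<longlongrightarrow> 0) at_top"
  proof (intro ballI allI impI)
    fix i :: nat and Q :: "real ^ 'n" assume i: "i \<in> {1, 2}" and Q: "irrational_vector Q"
    have Vi: "lattice_periodic (V i)" "continuous_on UNIV (V i)"
      using V_smooth i C_inf_torusD by blast+
    have Hbi: "effective_hamiltonian quadratic_hamiltonian (V i) (Hb i)" using Hb i by blast
    show "((\<lambda>l. Hb i (l *\<^sub>R Q) - 1 / 2 * l\<^sup>2 * (norm Q)\<^sup>2) \<longlongrightarrow> torus_integral (V i)) at_top \<and>
     (\<forall>l>0. \<exists>q\<in>subdifferential (Hb i) (l *\<^sub>R Q).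
        \<forall>q'\<in>subdifferential (Hb i) (l *\<^sub>R Q). q' \<bullet> (l *\<^sub>R Q) \<le> q \<bullet> (l *\<^sub>R Q)) \<and>
     ((\<lambda>l. l\<^sup>2 * (norm Q)\<^sup>2
           - (SUP q\<in>subdifferential (Hb i) (l *\<^sub>R Q). q \<bullet> (l *\<^sub>R Q))) \<longlongrightarrow> 0) at_top"
      by (intro conjI allI impI effective_quadratic_asymptotics[OF Q Vi Hbi]
          effective_quadratic_max_subgradient[OF Vi Hbi Q])
  qed
next
  fix Hb :: "nat \<Rightarrow> real ^ 'n \<Rightarrow> real"
  assume "(\<forall>i\<in>{1, 2}. effective_hamiltonian quadratic_hamiltonian (V i) (Hb i)) \<and>
    (\<exists>\<tau>>0. (\<lambda>k. ((cmod (fourier_coeff (V 1) k))\<^sup>2 + (cmod (fourier_coeff (V 2) k))\<^sup>2)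
                     * exp (norm k powr (real CARD('n) + \<tau>))) summable_on int_lattice)"
    and "Hb 1 = Hb 2"
  then have Hb: "effective_hamiltonian quadratic_hamiltonian (V 1) (Hb 1)"
    "effective_hamiltonian quadratic_hamiltonian (V 2) (Hb 1)" by auto
  have V: "lattice_periodic (V 1)" "continuous_on UNIV (V 1)" "lattice_periodic (V 2)" "continuous_on UNIV (V 2)"
    using V_smooth C_inf_torusD by blast+
  \<comment> \<open>The expansion determines a line energy only after subtraction of the squared
    mean, so the means are compared first.\<close>
  note mean = effective_quadratic_determines_mean[OF V Hb]
  show "torus_integral (\<lambda>x. \<bar>V 1 x\<bar>\<^sup>2) = torus_integral (\<lambda>x. \<bar>V 2 x\<bar>\<^sup>2)"
    unfolding power2_abs
    by (rule torus_integral_square_eq[OF V mean line_energy_eq[OF V Hb mean]])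
qed

end
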